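(* Let $\psi:\mathbb{D}\to\mathbb{C}$ be a holomorphic function, where $\mathbb{D}:=\{z\in\mathbb{C}:|z|<1\}$. If the inequality $$\left|\frac{1-\psi'(\zeta)}{1+\zeta\psi'(\zeta)}\right|\le k<1$$ holds for all $\zeta\in\mathbb{D}$ and some $k\in[0,1)$ (independent of $\zeta$), then $\psi$ admits a $k$-quasiconformal extension to $\overline{\mathbb{C}}$.
   Context: $\overline{\mathbb{C}}=\mathbb{C}\cup\{\infty\}$. A $k$-quasiconformal map is an orientation-preserving homeomorphism $F$ with distributional derivatives $\partial_zF,\partial_{\bar z}F\in L^1_{\rm loc}$ satisfying $|\partial_{\bar z}F|\le k|\partial_zF|$ a.e. (in local coordinates on $\overline{\mathbb{C}}$). A function $\psi$ on $\mathbb{D}$ admits a $k$-quasiconformal extension to $\overline{\mathbb{C}}$ if there is a $k$-quasiconformal homeomorphism $F:\overline{\mathbb{C}}\to\overline{\mathbb{C}}$ with $F|_{\mathbb{D}}=\psi$ (not required to fix $\infty$). *)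

theory Defs
  imports "HOL-Complex_Analysis.Complex_Analysis"
begin

text \<open>The Riemann sphere is the one-point compactification of the plane: \<open>Some z\<close> is the finite
  point \<open>z\<close>, and \<open>None\<close> is \<open>\<infinity>\<close>. Its topological space is the whole type \<open>complex option\<close>.\<close>

abbreviation riemann_sphere :: "complex option topology" where
  "riemann_sphere \<equiv> Alexandroff_compactification euclidean"

definition chart_inf :: "complex \<Rightarrow> complex option" where
  "chart_inf w = (if w = 0 then None else Some (1 / w))"

text \<open>The two standard parametrizations (inverses of the local coordinates \<open>z\<close> and \<open>1/z\<close>); both are
  injective with domain the whole plane.\<close>

definition sphere_charts :: "(complex \<Rightarrow> complex option) set" where
  "sphere_charts = {Some, chart_inf}"

text \<open>A map of the sphere in local coordinates, with chart \<open>a\<close> on the source side and \<open>b\<close> on the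
  target side: \<open>chart_expr\<close> is meaningful exactly on \<open>chart_dom\<close>.\<close>

definition chart_dom ::
  "(complex \<Rightarrow> complex option) \<Rightarrow> (complex \<Rightarrow> complex option) \<Rightarrow>
    (complex option \<Rightarrow> complex option) \<Rightarrow> complex set" where
  "chart_dom a b F = {z. F (a z) \<in> range b}"

definition chart_expr ::
  "(complex \<Rightarrow> complex option) \<Rightarrow> (complex \<Rightarrow> complex option) \<Rightarrow>
    (complex option \<Rightarrow> complex option) \<Rightarrow> complex \<Rightarrow> complex" where
  "chart_expr a b F = inv b \<circ> F \<circ> a"

definition partial_x :: "(complex \<Rightarrow> complex) \<Rightarrow> complex \<Rightarrow> complex" where
  "partial_x f z = frechet_derivative f (at z) 1"

definition partial_y :: "(complex \<Rightarrow> complex) \<Rightarrow> complex \<Rightarrow> complex" where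
  "partial_y f z = frechet_derivative f (at z) \<i>"

definition wirtinger_dz :: "(complex \<Rightarrow> complex) \<Rightarrow> complex \<Rightarrow> complex" where
  "wirtinger_dz f z = (partial_x f z - \<i> * partial_y f z) / 2"

definition wirtinger_dzbar :: "(complex \<Rightarrow> complex) \<Rightarrow> complex \<Rightarrow> complex" where
  "wirtinger_dzbar f z = (partial_x f z + \<i> * partial_y f z) / 2"

text \<open>Differentiability here is real differentiability of maps of the plane.\<close>

primrec Ck_plane :: "nat \<Rightarrow> (complex \<Rightarrow> complex) \<Rightarrow> bool" where
  "Ck_plane 0 f \<longleftrightarrow> continuous_on UNIV f"
| "Ck_plane (Suc n) f \<longleftrightarrow>
     (\<forall>z. f differentiable (at z)) \<and> Ck_plane n (partial_x f) \<and> Ck_plane n (partial_y f)"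

definition test_function_on :: "complex set \<Rightarrow> (complex \<Rightarrow> complex) \<Rightarrow> bool" where
  "test_function_on U \<phi> \<longleftrightarrow>
     (\<forall>n. Ck_plane n \<phi>) \<and> compact (closure {z. \<phi> z \<noteq> 0}) \<and> closure {z. \<phi> z \<noteq> 0} \<subseteq> U"

definition locally_integrable_on :: "complex set \<Rightarrow> (complex \<Rightarrow> complex) \<Rightarrow> bool" where
  "locally_integrable_on U f \<longleftrightarrow> (\<forall>K. compact K \<and> K \<subseteq> U \<longrightarrow> f absolutely_integrable_on K)"

definition has_distr_dz :: "complex set \<Rightarrow> (complex \<Rightarrow> complex) \<Rightarrow> (complex \<Rightarrow> complex) \<Rightarrow> bool" where
  "has_distr_dz U f g \<longleftrightarrow> locally_integrable_on U f \<and> locally_integrable_on U g \<and>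
     (\<forall>\<phi>. test_function_on U \<phi> \<longrightarrow>
        (LINT z:U|lebesgue. f z * wirtinger_dz \<phi> z) = - (LINT z:U|lebesgue. g z * \<phi> z))"

definition has_distr_dzbar :: "complex set \<Rightarrow> (complex \<Rightarrow> complex) \<Rightarrow> (complex \<Rightarrow> complex) \<Rightarrow> bool" where
  "has_distr_dzbar U f g \<longleftrightarrow> locally_integrable_on U f \<and> locally_integrable_on U g \<and>
     (\<forall>\<phi>. test_function_on U \<phi> \<longrightarrow>
        (LINT z:U|lebesgue. f z * wirtinger_dzbar \<phi> z) = - (LINT z:U|lebesgue. g z * \<phi> z))"

text \<open>For a homeomorphism \<open>f\<close> from the open set \<open>U\<close> onto a plane open set: the image of every
  positively oriented circle bounding a disc in \<open>U\<close> winds once, positively, around the image of the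
  centre (local degree \<open>+1\<close>).\<close>

definition orientation_preserving_on :: "complex set \<Rightarrow> (complex \<Rightarrow> complex) \<Rightarrow> bool" where
  "orientation_preserving_on U f \<longleftrightarrow>
     (\<forall>z r. 0 < r \<and> cball z r \<subseteq> U \<longrightarrow> winding_number (f \<circ> circlepath z r) (f z) = 1)"

definition quasiconformal_sphere :: "real \<Rightarrow> (complex option \<Rightarrow> complex option) \<Rightarrow> bool" where
  "quasiconformal_sphere k F \<longleftrightarrow>
     homeomorphic_map riemann_sphere riemann_sphere F \<and>
     (\<forall>a\<in>sphere_charts. \<forall>b\<in>sphere_charts.
        orientation_preserving_on (chart_dom a b F) (chart_expr a b F) \<and>
        (\<exists>p q. has_distr_dz (chart_dom a b F) (chart_expr a b F) p \<and>
               has_distr_dzbar (chart_dom a b F) (chart_expr a b F) q \<and>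
               (AE z in lebesgue. z \<in> chart_dom a b F \<longrightarrow> norm (q z) \<le> k * norm (p z))))"

definition admits_qc_extension :: "real \<Rightarrow> (complex \<Rightarrow> complex) \<Rightarrow> bool" where
  "admits_qc_extension k \<psi> \<longleftrightarrow>
     (\<exists>F. quasiconformal_sphere k F \<and> (\<forall>z\<in>ball 0 1. F (Some z) = Some (\<psi> z)))"

end

theory Submission
  imports Defs
begin

text \<open>
  Put \<open>Q = (1 - \<psi>') / (1 + z \<psi>')\<close>, so that \<open>|Q| \<le> k\<close> and the displacement \<open>u = \<psi> - id\<close> satisfies
  \<open>u' = - (1 + z) Q / (1 + z Q)\<close>. Hence \<open>|u'| \<le> k / (1 - k) |1 + z|\<close>, and \<open>u\<close> extends to the closed disc
  as a Lipschitz function. Let \<open>\<Pi>\<close> be the identity on the closed disc, the projection along the rays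
  from \<open>-1\<close> onto the unit circle where \<open>|w| > 1\<close> and \<open>Re w > -1\<close>, and the constant \<open>-1\<close> on the half-plane
  \<open>Re w \<le> -1\<close>. The extension is \<open>f w = w + u (\<Pi> w)\<close> with \<open>\<infinity> \<mapsto> \<infinity>\<close>: the ray that leaves the circle at \<open>z\<close>
  in the direction \<open>1 + z\<close> is translated so that it leaves \<open>\<psi> z\<close> in the same direction.

  Injectivity: the bound on \<open>Q\<close> implies \<open>Re ((1 + z) \<psi>' z) > 0\<close>, so \<open>\<psi>\<close> is a function with
  positive real part of the derivative in the coordinate \<open>W = Ln (1 + z)\<close>. In this coordinate the
  disc is a strictly convex domain and the direction \<open>1 + z\<close> is the outer normal at a boundary
  point, which keeps the translated rays disjoint from each other and from the image of the disc
  (\<open>inj_ray_ext\<close>). Surjectivity is Brouwer's theorem for a bounded perturbation of the identity, and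
  the local degree is \<open>1\<close> because it is constant on connected sets and \<open>f\<close> is a translation on a
  half-plane (\<open>orientation_preserving_if_conformal_somewhere\<close>).

  Beltrami inequality: outside the disc, with \<open>z = \<Pi> w\<close> and \<open>s = 2 Re (1 / (w + 1)) \<in> (0, 1)\<close>, the
  derivative of \<open>f\<close> with respect to \<open>w\<close> is formally \<open>1 - s z Q / (1 + z Q)\<close> and the one with respect to
  the conjugate has modulus \<open>s |Q| / |1 + z Q|\<close>, where \<open>Q\<close> is taken at \<open>z\<close>; the second is at most \<open>k\<close>
  times the first (\<open>Beltrami_bound\<close>). Here \<open>z\<close> lies on the unit circle, where \<open>Q\<close> has only boundary
  values. To make sense of the formula, \<open>Q z\<close> is replaced by \<open>Q (r\<^sub>n z)\<close> with \<open>r\<^sub>n \<rightarrow> 1\<close>. The resulting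
  maps \<open>f\<^sub>n\<close> are equi-Lipschitz, converge uniformly to \<open>f\<close> and are differentiable off a circle and a
  line. By Parseval a sequence of radii can be chosen along which \<open>Q (r\<^sub>n z)\<close> converges at almost
  every point of the circle (\<open>radial_limit_ae_circle\<close>), hence the derivatives of \<open>f\<^sub>n\<close> converge almost
  everywhere. Integration by parts for Lipschitz functions and dominated convergence then show that
  these limits are the distributional derivatives of \<open>f\<close> (\<open>distr_derivatives_of_limit\<close>). The same
  limit argument works in the charts at \<open>\<infinity>\<close> on either side.
\<close>

section \<open>The disc in the logarithmic coordinate based at \<open>-1\<close>\<close>

lemma ln_cos_below_tangent:
  fixes x y :: real
  assumes "\<bar>x\<bar> < pi/2" "\<bar>y\<bar> < pi/2" "x \<noteq> y"
  shows "ln (cos x) < ln (cos y) - tan y * (x - y)"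
proof -
  have der: "((\<lambda>t. ln (cos t)) has_real_derivative - tan t) (at t)" if "\<bar>t\<bar> < pi/2" for t
    using that cos_gt_zero_pi[of t]
    by (auto intro!: derivative_eq_intros simp: tan_def field_simps)
  consider "x < y" | "y < x" using assms by linarith
  then show ?thesis
  proof cases
    case 1
    obtain t where t: "x < t" "t < y" "ln (cos y) - ln (cos x) = (y - x) * (- tan t)"
      using MVT2[OF 1, of "\<lambda>t. ln (cos t)" "\<lambda>t. - tan t"] der assms by force
    have "tan t < tan y" using t assms by (intro tan_monotone) auto
    then have "(y - x) * tan t < (y - x) * tan y" using 1 by simp
    then show ?thesis using t by (simp add: algebra_simps)
  next
    case 2
    obtain t where t: "y < t" "t < x" "ln (cos x) - ln (cos y) = (x - y) * (- tan t)"
      using MVT2[OF 2, of "\<lambda>t. ln (cos t)" "\<lambda>t. - tan t"] der assms by force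
    have "tan y < tan t" using t assms by (intro tan_monotone) auto
    then have "(x - y) * tan y < (x - y) * tan t" using 2 by simp
    then show ?thesis using t by (simp add: algebra_simps)
  qed
qed

lemma norm_exp_minus_1:
  "(cmod (exp W - 1))\<^sup>2 = 1 + exp (Re W) * (exp (Re W) - 2 * cos (Im W))"
proof -
  have "(cmod (exp W - 1))\<^sup>2 = (exp (Re W) * cos (Im W) - 1)\<^sup>2 + (exp (Re W) * sin (Im W))\<^sup>2"
    by (simp add: cmod_power2 Re_exp Im_exp)
  also have "\<dots> = (exp (Re W))\<^sup>2 * ((cos (Im W))\<^sup>2 + (sin (Im W))\<^sup>2) - 2 * exp (Re W) * cos (Im W) + 1"
    by (simp add: power2_eq_square algebra_simps del: sin_cos_squared_add sin_cos_squared_add2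
        sin_cos_squared_add3)
  finally show ?thesis by (simp add: power2_eq_square algebra_simps)
qed

lemma exp_in_disc_iff:
  assumes "\<bar>Im W\<bar> < pi/2"
  shows "cmod (exp W - 1) \<le> 1 \<longleftrightarrow> Re W \<le> ln 2 + ln (cos (Im W))"
    and "cmod (exp W - 1) < 1 \<longleftrightarrow> Re W < ln 2 + ln (cos (Im W))"
proof -
  have c: "cos (Im W) > 0" using assms by (intro cos_gt_zero_pi) auto
  have l: "ln 2 + ln (cos (Im W)) = ln (2 * cos (Im W))" using c by (simp add: ln_mult)
  have "cmod (exp W - 1) \<le> 1 \<longleftrightarrow> (cmod (exp W - 1))\<^sup>2 \<le> 1" by (simp add: abs_square_le_1)
  also have "\<dots> \<longleftrightarrow> exp (Re W) \<le> 2 * cos (Im W)"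
    unfolding norm_exp_minus_1 by (simp add: mult_le_0_iff)
  also have "\<dots> \<longleftrightarrow> Re W \<le> ln (2 * cos (Im W))" using c by (simp add: ln_ge_iff)
  finally show "cmod (exp W - 1) \<le> 1 \<longleftrightarrow> Re W \<le> ln 2 + ln (cos (Im W))" by (simp add: l)
  have "cmod (exp W - 1) < 1 \<longleftrightarrow> (cmod (exp W - 1))\<^sup>2 < 1"
    by (metis abs_norm_cancel abs_square_less_1)
  also have "\<dots> \<longleftrightarrow> exp (Re W) < 2 * cos (Im W)"
    unfolding norm_exp_minus_1 by (simp add: mult_less_0_iff)
  also have "\<dots> \<longleftrightarrow> Re W < ln (2 * cos (Im W))"
    using c by (metis exp_less_cancel_iff exp_ln mult_pos_pos zero_less_numeral)
  finally show "cmod (exp W - 1) < 1 \<longleftrightarrow> Re W < ln 2 + ln (cos (Im W))" by (simp add: l)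
qed

text \<open>In the coordinate \<open>W = Ln (1 + z)\<close> the closed disc without \<open>-1\<close> is the set
  \<open>Re W \<le> ln 2 + ln (cos (Im W))\<close>, which lies below the graph of a strictly concave function.\<close>

lemma log_disc_strictly_convex:
  assumes "\<bar>Im V\<bar> < pi/2" "\<bar>Im W\<bar> < pi/2" "cmod (exp V - 1) \<le> 1" "cmod (exp W - 1) \<le> 1"
    and "V \<noteq> W" "0 < s" "s < 1"
  defines "P \<equiv> W + of_real s * (V - W)"
  shows "\<bar>Im P\<bar> < pi/2" and "cmod (exp P - 1) < 1"
proof -
  have ImP: "Im P = (1-s) * Im W + s * Im V" and ReP: "Re P = (1-s) * Re W + s * Re V"
    by (simp_all add: P_def algebra_simps)
  have "Im P \<in> {-pi/2<..<pi/2}"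
    using convexD_alt[of "{-pi/2<..<pi/2}" "Im W" "Im V" s] assms(1,2,6,7)
    unfolding ImP by (simp only: abs_less_iff convex_real_interval) auto
  then show b: "\<bar>Im P\<bar> < pi/2" by auto
  define L where "L = (\<lambda>y::real. ln 2 + ln (cos y))"
  define T where "T = (\<lambda>y. L (Im P) - tan (Im P) * (y - Im P))"
  have T: "L y \<le> T y" "y \<noteq> Im P \<Longrightarrow> L y < T y" if "\<bar>y\<bar> < pi/2" for y
    using ln_cos_below_tangent[OF that b] by (cases "y = Im P"; force simp: L_def T_def)+
  have rV: "Re V \<le> L (Im V)" and rW: "Re W \<le> L (Im W)"
    using assms exp_in_disc_iff(1) by (auto simp: L_def)
  have avg: "(1-s) * T (Im W) + s * T (Im V) = L (Im P)"
    by (simp add: T_def ImP algebra_simps)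
  have "Re P < L (Im P)"
  proof (cases "Im V = Im W")
    case True
    then have "Re V \<noteq> Re W" using assms by (auto simp: complex_eq_iff)
    moreover have "L (Im P) = L (Im V)" "L (Im P) = L (Im W)"
      using True by (simp_all add: ImP algebra_simps)
    ultimately have *: "Re V \<le> L (Im P)" "Re W \<le> L (Im P)" "Re V < L (Im P) \<or> Re W < L (Im P)"
      using rV rW by auto
    have "(1-s) * Re W \<le> (1-s) * L (Im P)" "s * Re V \<le> s * L (Im P)" using * assms by auto
    moreover have "(1-s) * Re W < (1-s) * L (Im P) \<or> s * Re V < s * L (Im P)" using * assms by auto
    ultimately show ?thesis unfolding ReP by (simp add: algebra_simps) linarith
  next
    case False
    have "Im W - Im P = s * (Im W - Im V)" by (simp add: ImP algebra_simps)
    then have "Im W \<noteq> Im P" using False assms by auto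
    then have "Re W < T (Im W)" "Re V \<le> T (Im V)" using T assms rV rW by fastforce+
    then have "(1-s) * Re W < (1-s) * T (Im W)" "s * Re V \<le> s * T (Im V)" using assms by auto
    then show ?thesis unfolding ReP using avg by linarith
  qed
  then show "cmod (exp P - 1) < 1" using exp_in_disc_iff(2)[OF b] by (simp add: L_def)
qed

text \<open>The gradient of \<open>|exp W - 1|\<^sup>2\<close> at a point where \<open>|exp W - 1| = 1\<close> is \<open>2 exp W\<close>, so \<open>exp W\<close> is an
  outer normal there and convexity puts \<open>V\<close> on the inner side.\<close>

lemma log_disc_outer_normal:
  assumes "\<bar>Im V\<bar> < pi/2" "\<bar>Im W\<bar> < pi/2" "cmod (exp V - 1) \<le> 1" "cmod (exp W - 1) = 1"
  shows "Re (exp W * cnj (V - W)) \<le> 0"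
proof -
  have c: "cos (Im W) > 0" using assms by (intro cos_gt_zero_pi) auto
  have "Re V \<le> ln 2 + ln (cos (Im V))" using assms exp_in_disc_iff by blast
  moreover have "Re W = ln 2 + ln (cos (Im W))"
    using exp_in_disc_iff[OF assms(2)] assms(4) by force
  moreover have "ln (cos (Im V)) \<le> ln (cos (Im W)) - tan (Im W) * (Im V - Im W)"
    using ln_cos_below_tangent[OF assms(1,2)] by (cases "Im V = Im W") auto
  ultimately have "(Re V - Re W) + tan (Im W) * (Im V - Im W) \<le> 0" by simp
  then have "cos (Im W) * ((Re V - Re W) + tan (Im W) * (Im V - Im W)) \<le> 0"
    using c by (simp add: mult_le_0_iff)
  then have "cos (Im W) * (Re V - Re W) + sin (Im W) * (Im V - Im W) \<le> 0"
    using c by (simp add: tan_def distrib_left)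
  then have "exp (Re W) * (cos (Im W) * (Re V - Re W) + sin (Im W) * (Im V - Im W)) \<le> 0"
    by (simp add: mult_le_0_iff)
  then show ?thesis by (simp add: Re_exp Im_exp algebra_simps)
qed

lemma Re_pos_closed_disc:
  assumes "cmod z \<le> 1" "z \<noteq> -1"
  shows "Re (1 + z) > 0"
proof -
  have "(Re z)\<^sup>2 + (Im z)\<^sup>2 \<le> 1"
    using assms(1) by (metis cmod_power2 norm_ge_zero power_le_one)
  moreover have "Re z \<noteq> -1 \<or> Im z \<noteq> 0" using assms(2) by (auto simp: complex_eq_iff)
  moreover have "- 1 \<le> Re z" using abs_Re_le_cmod[of z] assms(1) by linarith
  ultimately show ?thesis by (cases "Re z = -1") auto
qed

lemma Ln_disc:
  assumes "cmod z \<le> 1" "z \<noteq> -1"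
  shows "exp (Ln (1 + z)) = 1 + z" "\<bar>Im (Ln (1 + z))\<bar> < pi/2"
proof -
  have "Re (1 + z) > 0" "1 + z \<noteq> 0" using Re_pos_closed_disc[OF assms] by force+
  then show "exp (Ln (1 + z)) = 1 + z" "\<bar>Im (Ln (1 + z))\<bar> < pi/2"
    using Re_Ln_pos_lt[of "1+z"] by simp_all
qed

section \<open>Functions that increase in the logarithmic coordinate\<close>

lemma Re_increasing_along_path:
  fixes p :: "real \<Rightarrow> complex"
  assumes cont: "continuous_on (cball 0 1) \<psi>" and hol: "\<psi> holomorphic_on ball 0 1"
    and ends: "p 0 \<in> cball 0 1" "p 1 \<in> cball 0 1" and p: "continuous_on {0..1} p"
    and in_ball: "\<And>s. 0 < s \<Longrightarrow> s < 1 \<Longrightarrow> p s \<in> ball 0 1"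
    and dp: "\<And>s. (p has_vector_derivative p' s) (at s)"
    and pos: "\<And>s. 0 < s \<Longrightarrow> s < 1 \<Longrightarrow> Re (p' s * deriv \<psi> (p s) * w) > 0"
  shows "Re (\<psi> (p 0) * w) < Re (\<psi> (p 1) * w)"
proof -
  define g where "g = (\<lambda>s. Re (\<psi> (p s) * w))"
  have in_cball: "p ` {0..1} \<subseteq> cball 0 1"
  proof
    fix x assume "x \<in> p ` {0..1}"
    then obtain s where "s \<in> {0..1}" "x = p s" by auto
    then show "x \<in> cball 0 1"
      using in_ball[of s] ends by (cases "s = 0"; cases "s = 1"; force)
  qed
  have "g 0 < g 1"
  proof (rule DERIV_pos_imp_increasing_open[where f = g])
    show "continuous_on {0..1} g"
      unfolding g_def by (intro continuous_intros continuous_on_compose2[OF cont p in_cball])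
    fix s :: real assume s: "0 < s" "s < 1"
    have "(\<psi> has_field_derivative deriv \<psi> (p s)) (at (p s))"
      using hol in_ball[OF s] holomorphic_derivI open_ball by blast
    from field_vector_diff_chain_at[OF dp this]
    have "((\<lambda>t. \<psi> (p t)) has_vector_derivative p' s * deriv \<psi> (p s)) (at s)" by (simp add: o_def)
    then have "((\<lambda>t. \<psi> (p t) * w) has_vector_derivative p' s * deriv \<psi> (p s) * w) (at s)"
      by (rule has_vector_derivative_mult_left)
    then have "(g has_vector_derivative Re (p' s * deriv \<psi> (p s) * w)) (at s)"
      unfolding g_def by (rule bounded_linear.has_vector_derivative[OF bounded_linear_Re])
    then show "\<exists>d. (g has_real_derivative d) (at s) \<and> 0 < d"
      using pos[OF s] by (metis has_real_derivative_iff_has_vector_derivative)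
  qed simp
  then show ?thesis by (simp add: g_def)
qed

text \<open>The derivative of \<open>\<psi>\<close> with respect to \<open>W = Ln (1 + z)\<close> is \<open>(1 + z) \<psi>'\<close>. Its real part is positive on
  a convex domain, so the argument of Noshiro and Warschawski applies; strict convexity extends it to
  boundary points, since the open segment between them runs inside the domain.\<close>

lemma log_coordinate_increasing:
  assumes cont: "continuous_on (cball 0 1) \<psi>" and hol: "\<psi> holomorphic_on ball 0 1"
    and pos: "\<And>z. z \<in> ball 0 1 \<Longrightarrow> Re ((1 + z) * deriv \<psi> z) > 0"
    and z: "cmod y \<le> 1" "y \<noteq> -1" "cmod z \<le> 1" "z \<noteq> -1" "y \<noteq> z"
  shows "Re ((\<psi> y - \<psi> z) * cnj (Ln (1 + y) - Ln (1 + z))) > 0"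
proof -
  define V where "V = Ln (1 + y)"
  define W where "W = Ln (1 + z)"
  have V: "exp V = 1 + y" "\<bar>Im V\<bar> < pi/2" and W: "exp W = 1 + z" "\<bar>Im W\<bar> < pi/2"
    using Ln_disc z by (auto simp: V_def W_def)
  have VW: "V \<noteq> W" using V W z by auto
  define p where "p = (\<lambda>s::real. exp (W + of_real s * (V - W)) - 1)"
  have in_ball: "p s \<in> ball 0 1" if "0 < s" "s < 1" for s
    using log_disc_strictly_convex(2)[of V W s] that V W VW z by (simp add: p_def)
  have p01: "p 0 = z" "p 1 = y" using V W by (simp_all add: p_def)
  have "Re (\<psi> (p 0) * cnj (V - W)) < Re (\<psi> (p 1) * cnj (V - W))"
  proof (rule Re_increasing_along_path[OF cont hol _ _ _ in_ball])
    show "continuous_on {0..1} p" unfolding p_def by (intro continuous_intros)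
    show "(p has_vector_derivative (V - W) * (1 + p s)) (at s)" for s
      unfolding p_def by (auto intro!: derivative_eq_intros has_vector_derivative_real_field simp: algebra_simps)
    fix s :: real assume s: "0 < s" "s < 1"
    have eq: "(V - W) * (1 + p s) * deriv \<psi> (p s) * cnj (V - W)
        = of_real ((cmod (V - W))\<^sup>2) * ((1 + p s) * deriv \<psi> (p s))"
      using complex_norm_square[of "V - W"] by (simp only: mult_ac)
    have "Re (of_real ((cmod (V - W))\<^sup>2) * ((1 + p s) * deriv \<psi> (p s))) > 0"
      using pos[OF in_ball[OF s]] VW unfolding scaleR_conv_of_real[symmetric] by simp
    then show "Re ((V - W) * (1 + p s) * deriv \<psi> (p s) * cnj (V - W)) > 0" unfolding eq .
  qed (use p01 z in auto)
  then show ?thesis using p01 by (simp add: V_def W_def algebra_simps)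
qed

text \<open>The point \<open>-1\<close> is at infinity in the logarithmic coordinate and needs its own path: on the segment
  from \<open>-1\<close> to \<open>z\<close> the direction \<open>1 + z\<close> is a positive multiple of \<open>1 + \<zeta>\<close> at the current point \<open>\<zeta>\<close>.\<close>

lemma Re_increasing_from_minus_1:
  assumes cont: "continuous_on (cball 0 1) \<psi>" and hol: "\<psi> holomorphic_on ball 0 1"
    and pos: "\<And>z. z \<in> ball 0 1 \<Longrightarrow> Re ((1 + z) * deriv \<psi> z) > 0"
    and z: "cmod z \<le> 1" "z \<noteq> -1"
  shows "Re (\<psi> (-1)) < Re (\<psi> z)"
proof -
  define p where "p = (\<lambda>s::real. -1 + of_real s * (1 + z))"
  have in_ball: "p s \<in> ball 0 1" if "0 < s" "s < 1" for s
  proof -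
    have r: "Re (1 + z) > 0" using Re_pos_closed_disc z by blast
    have "(cmod z)\<^sup>2 \<le> 1" using z by (simp add: power_le_one)
    then have n: "(cmod (1 + z))\<^sup>2 \<le> 2 * Re (1 + z)"
      unfolding cmod_power2 by (simp add: power2_eq_square algebra_simps)
    have "(cmod (p s))\<^sup>2 = 1 - 2 * s * Re (1+z) + s\<^sup>2 * (cmod (1 + z))\<^sup>2"
      unfolding p_def cmod_power2 by (simp add: power2_eq_square algebra_simps)
    also have "\<dots> \<le> 1 - 2 * s * Re (1+z) + s\<^sup>2 * (2 * Re (1+z))"
      using n by (intro add_mono mult_left_mono) auto
    also have "\<dots> = 1 - 2 * s * (1 - s) * Re (1+z)" by (simp add: power2_eq_square algebra_simps)
    also have "\<dots> < 1" using r that by simp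
    finally have "cmod (p s) < 1" by (metis abs_norm_cancel abs_square_less_1)
    then show ?thesis by simp
  qed
  have p01: "p 0 = -1" "p 1 = z" by (simp_all add: p_def)
  have "Re (\<psi> (p 0) * 1) < Re (\<psi> (p 1) * 1)"
  proof (rule Re_increasing_along_path[OF cont hol _ _ _ in_ball])
    show "continuous_on {0..1} p" unfolding p_def by (intro continuous_intros)
    show "(p has_vector_derivative (1 + z)) (at s)" for s
      unfolding p_def by (auto intro!: derivative_eq_intros has_vector_derivative_real_field)
    fix s :: real assume s: "0 < s" "s < 1"
    have "1 + p s = of_real s * (1 + z)" by (simp add: p_def)
    then have "s * Re ((1 + z) * deriv \<psi> (p s)) > 0"
      using pos[OF in_ball[OF s]] by (simp add: mult.assoc)
    then show "Re ((1 + z) * deriv \<psi> (p s) * 1) > 0" using s by (simp add: zero_less_mult_iff)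
  qed (use p01 z in auto)
  then show ?thesis using p01 by simp
qed

section \<open>Projection along the rays from \<open>-1\<close>\<close>

text \<open>For \<open>|w| > 1\<close> and \<open>Re w > -1\<close> the quotient is the second intersection of the unit circle with the
  line through \<open>-1\<close> and \<open>w\<close>.\<close>

definition ray_proj :: "complex \<Rightarrow> complex" where
  "ray_proj w = (if cmod w \<le> 1 then w else if Re w > -1 then (w + 1) / (cnj w + 1) else -1)"

definition ray_ext :: "(complex \<Rightarrow> complex) \<Rightarrow> complex \<Rightarrow> complex" where
  "ray_ext u w = w + u (ray_proj w)"

lemma ray_proj_disc [simp]: "cmod w \<le> 1 \<Longrightarrow> ray_proj w = w"
  by (simp add: ray_proj_def)

lemma norm_ray_proj_outside: "cmod w > 1 \<Longrightarrow> cmod (ray_proj w) = 1"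
proof -
  have "cmod (cnj w + 1) = cmod (w + 1)" by (metis complex_cnj_add complex_cnj_one complex_mod_cnj)
  moreover have "Re w > -1 \<Longrightarrow> w + 1 \<noteq> 0" by (auto simp: complex_eq_iff)
  ultimately show "cmod w > 1 \<Longrightarrow> cmod (ray_proj w) = 1"
    by (simp add: ray_proj_def norm_divide)
qed

lemma norm_ray_proj_le: "cmod (ray_proj w) \<le> 1"
  using norm_ray_proj_outside[of w] by (cases "cmod w \<le> 1") auto

lemma ray_proj_left:
  assumes "Re w \<le> -1" shows "ray_proj w = -1"
proof (cases "cmod w \<le> 1")
  case True
  then have "w = -1" using Re_pos_closed_disc[of w] assms by force
  then show ?thesis by simp
qed (use assms in \<open>simp add: ray_proj_def\<close>)

text \<open>On the right half-plane \<open>Re w > -1\<close> the projection undoes the motion along the outward ray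
  that starts at a point of the closed disc and points away from \<open>-1\<close>.\<close>

lemma ray_proj_right:
  assumes "Re w > -1"
  obtains t where "t \<ge> 0" "w = ray_proj w + of_real t * (1 + ray_proj w)"
    "t = 0 \<or> cmod (ray_proj w) = 1" "ray_proj w \<noteq> -1"
proof (cases "cmod w \<le> 1")
  case True
  then show ?thesis using assms by (intro that[of 0]) auto
next
  case False
  define a where "a = w + 1"
  have a: "Re a > 0" "a \<noteq> 0" using assms by (auto simp: a_def complex_eq_iff)
  have P: "ray_proj w = a / cnj a" using False assms by (simp add: ray_proj_def a_def)
  have "1 < (cmod w)\<^sup>2" using False by (simp add: power_gt1)
  then have big: "2 * Re a < (cmod a)\<^sup>2"
    unfolding cmod_power2 by (simp add: a_def power2_eq_square algebra_simps)
  define t where "t = (cmod a)\<^sup>2 / (2 * Re a) - 1"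
  have P1: "1 + ray_proj w = of_real (2 * Re a) / cnj a"
    using a complex_add_cnj[of a] by (simp add: P field_simps)
  have "of_real ((cmod a)\<^sup>2) = a * cnj a" by (rule complex_norm_square)
  then have "of_real (1 + t) * (1 + ray_proj w) = a"
    using a unfolding P1 by (simp add: t_def of_real_divide)
  then have "w = ray_proj w + of_real t * (1 + ray_proj w)"
    by (simp add: a_def algebra_simps)
  moreover have "t \<ge> 0" using a big by (simp add: t_def field_simps)
  moreover have "ray_proj w \<noteq> -1" using P1 a by auto
  moreover have "cmod (ray_proj w) = 1" using False norm_ray_proj_outside by simp
  ultimately show ?thesis using that by blast
qed

text \<open>The rays that leave the boundary of the image have directions which, in the logarithmic
  coordinate, are outward normals of a convex domain; a function that increases in this coordinate
  keeps them disjoint.\<close>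

theorem inj_ray_ext:
  assumes cont: "continuous_on (cball 0 1) (\<lambda>z. z + u z)"
    and hol: "(\<lambda>z. z + u z) holomorphic_on ball 0 1"
    and pos: "\<And>z. z \<in> ball 0 1 \<Longrightarrow> Re ((1 + z) * deriv (\<lambda>z. z + u z) z) > 0"
  shows "inj (ray_ext u)"
proof -
  let ?\<psi> = "\<lambda>z. z + u z"
  have right: "Re (ray_ext u w) > Re (?\<psi> (-1))" if w: "Re w > -1" for w
  proof -
    obtain t where t: "t \<ge> 0" "w = ray_proj w + of_real t * (1 + ray_proj w)" "ray_proj w \<noteq> -1"
      using ray_proj_right[OF w] by metis
    have eq: "ray_ext u w = ?\<psi> (ray_proj w) + of_real t * (1 + ray_proj w)"
      using t(2) by (simp add: ray_ext_def algebra_simps)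
    have "Re (1 + ray_proj w) > 0" using Re_pos_closed_disc norm_ray_proj_le t by blast
    then have "Re (of_real t * (1 + ray_proj w)) \<ge> 0"
      using t(1) unfolding scaleR_conv_of_real[symmetric] by simp
    moreover have "Re (?\<psi> (-1)) < Re (?\<psi> (ray_proj w))"
      by (rule Re_increasing_from_minus_1[OF cont hol pos norm_ray_proj_le t(3)])
    ultimately show ?thesis unfolding eq by simp
  qed
  have left: "ray_ext u w = w + u (-1)" if "Re w \<le> -1" for w
    using ray_proj_left[OF that] by (simp add: ray_ext_def)
  have both: "v = w" if vw: "Re v > -1" "Re w > -1" "ray_ext u v = ray_ext u w" for v w
  proof -
    define y where "y = ray_proj v"
    define z where "z = ray_proj w"
    obtain s where s: "s \<ge> 0" "v = y + of_real s * (1 + y)" "s = 0 \<or> cmod y = 1" "y \<noteq> -1"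
      using ray_proj_right[OF vw(1)] y_def by metis
    obtain t where t: "t \<ge> 0" "w = z + of_real t * (1 + z)" "t = 0 \<or> cmod z = 1" "z \<noteq> -1"
      using ray_proj_right[OF vw(2)] z_def by metis
    have n: "cmod y \<le> 1" "cmod z \<le> 1" using norm_ray_proj_le by (auto simp: y_def z_def)
    have "?\<psi> y + of_real s * (1 + y) = ray_ext u v"
      unfolding ray_ext_def y_def[symmetric] by (subst s(2)) simp
    moreover have "?\<psi> z + of_real t * (1 + z) = ray_ext u w"
      unfolding ray_ext_def z_def[symmetric] by (subst t(2)) simp
    ultimately have eq: "?\<psi> y - ?\<psi> z = of_real t * (1 + z) - of_real s * (1 + y)"
      using vw(3) by (simp add: algebra_simps)
    have "y = z"
    proof (rule ccontr)
      assume "y \<noteq> z"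
      define V where "V = Ln (1 + y)"
      define W where "W = Ln (1 + z)"
      have V: "exp V = 1 + y" "\<bar>Im V\<bar> < pi/2" and W: "exp W = 1 + z" "\<bar>Im W\<bar> < pi/2"
        using Ln_disc n s t by (auto simp: V_def W_def)
      have pos': "Re ((?\<psi> y - ?\<psi> z) * cnj (V - W)) > 0"
        unfolding V_def W_def
        by (rule log_coordinate_increasing[OF cont hol pos]) (use n s t \<open>y \<noteq> z\<close> in auto)
      have 1: "t * Re (exp W * cnj (V - W)) \<le> 0"
        using log_disc_outer_normal[of V W] V W n t by (auto simp: mult_le_0_iff)
      have 2: "s * Re (exp V * cnj (W - V)) \<le> 0"
        using log_disc_outer_normal[of W V] V W n s by (auto simp: mult_le_0_iff)
      have "(?\<psi> y - ?\<psi> z) * cnj (V - W) = t *\<^sub>R (exp W * cnj (V - W)) + s *\<^sub>R (exp V * cnj (W - V))"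
        unfolding eq V W scaleR_conv_of_real by (simp add: algebra_simps)
      then have "Re ((?\<psi> y - ?\<psi> z) * cnj (V - W))
          = t * Re (exp W * cnj (V - W)) + s * Re (exp V * cnj (W - V))" by simp
      then show False using pos' 1 2 by linarith
    qed
    then have "of_real t * (1 + z) = of_real s * (1 + z)" using eq by simp
    moreover have "1 + z \<noteq> 0" using t(4) by (metis add_eq_0_iff)
    ultimately have "t = s" by simp
    then show ?thesis using s(2) t(2) \<open>y = z\<close> by simp
  qed
  show ?thesis
  proof (rule injI)
    fix v w assume eq: "ray_ext u v = ray_ext u w"
    show "v = w"
    proof (cases "Re v > -1"; cases "Re w > -1")
      assume "\<not> Re v > -1" "\<not> Re w > -1"
      then show ?thesis using eq left by simp
    next
      assume "Re v > -1" "\<not> Re w > -1"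
      then show ?thesis using right[of v] left[of w] eq by simp
    next
      assume "\<not> Re v > -1" "Re w > -1"
      then show ?thesis using right[of w] left[of v] eq by simp
    qed (use both eq in blast)
  qed
qed

lemma ray_ext_diff: "ray_ext u w - w = u (ray_proj w)"
  by (simp add: ray_ext_def)

lemma surj_bounded_perturbation:
  fixes f :: "complex \<Rightarrow> complex"
  assumes cont: "continuous_on UNIV f" and M: "\<And>z. cmod (f z - z) \<le> M"
  shows "surj f"
proof -
  have "\<exists>x. f x = y" for y
  proof -
    have "cmod (f 0 - 0) \<le> M" by (rule M)
    then have M1: "M + 1 > 0" using norm_ge_zero[of "f 0 - 0"] by linarith
    \<comment> \<open>a solution of \<open>f z = y\<close> is a fixed point of \<open>z \<mapsto> y - (f z - z)\<close>, which takes values near \<open>y\<close>\<close>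
    obtain z where "y - (f z - z) = z"
    proof (rule brouwer_ball[OF M1, of y "\<lambda>z. y - (f z - z)"])
      show "continuous_on (cball y (M + 1)) (\<lambda>z. y - (f z - z))"
        by (intro continuous_intros continuous_on_subset[OF cont]) auto
      show "(\<lambda>z. y - (f z - z)) \<in> cball y (M + 1) \<rightarrow> cball y (M + 1)"
      proof
        fix z
        have "dist y (y - (f z - z)) = cmod (f z - z)" by (simp add: dist_norm)
        then show "y - (f z - z) \<in> cball y (M + 1)" using M[of z] by simp
      qed
    qed auto
    then show ?thesis by (intro exI[of _ z]) (simp add: algebra_simps)
  qed
  then show ?thesis by (metis surjI)
qed

lemma ray_proj_outside:
  assumes "cmod w \<ge> 1" "Re w \<ge> -1" "w \<noteq> -1"
  shows "ray_proj w = (w + 1) / cnj (w + 1)" "cmod (1 + ray_proj w) \<le> cmod (w + 1)"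
proof -
  define a where "a = w + 1"
  have a: "a \<noteq> 0" "Re a \<ge> 0" using assms by (auto simp: a_def complex_eq_iff)
  show P: "ray_proj w = (w + 1) / cnj (w + 1)"
  proof (cases "cmod w \<le> 1")
    case True
    then have "cmod w = 1" using assms by simp
    then have "w * cnj w = 1" using complex_norm_square[of w] by simp
    then have "w * cnj (w + 1) = w + 1" by (simp add: algebra_simps)
    then have "w = (w + 1) / cnj (w + 1)" using a unfolding a_def
      by (metis complex_cnj_zero_iff nonzero_eq_divide_eq)
    then show ?thesis using True by simp
  next
    case False
    show ?thesis
    proof (cases "Re w > -1")
      case False
      then have "Re a = 0" using assms by (simp add: a_def)
      then have "a = - cnj a" by (simp add: complex_eq_iff)
      then have "a / cnj a = -1" using a by (metis complex_cnj_zero_iff divide_minus_left divide_self)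
      then show ?thesis using False ray_proj_left[of w] by (simp add: a_def)
    qed (use False in \<open>simp add: ray_proj_def\<close>)
  qed
  have "1 \<le> (cmod w)\<^sup>2" using assms by simp
  then have big: "2 * Re a \<le> (cmod a)\<^sup>2"
    unfolding cmod_power2 by (simp add: a_def power2_eq_square algebra_simps)
  have "1 + ray_proj w = of_real (2 * Re a) / cnj a"
    using a complex_add_cnj[of a] unfolding P a_def[symmetric] by (simp add: field_simps)
  then have "cmod (1 + ray_proj w) = 2 * Re a / cmod a"
    using a by (simp only: norm_divide norm_of_real complex_mod_cnj)
  also have "\<dots> \<le> cmod a" using big a by (simp add: divide_le_eq power2_eq_square)
  finally show "cmod (1 + ray_proj w) \<le> cmod (w + 1)" by (simp add: a_def)
qed

lemma unit_direction_diff: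
  fixes a b :: complex
  assumes "a \<noteq> 0" "b \<noteq> 0"
  shows "cmod (a / cnj a - b / cnj b) * max (cmod a) (cmod b) \<le> 2 * cmod (a - b)"
proof -
  have *: "cmod (x / cnj x - y / cnj y) * cmod x \<le> 2 * cmod (x - y)"
    if "x \<noteq> 0" "y \<noteq> 0" for x y :: complex
  proof -
    have "x / cnj x - y / cnj y = ((x - y) * cnj y - cnj (x - y) * y) / (cnj x * cnj y)"
      using that by (simp add: field_simps)
    then have "cmod (x / cnj x - y / cnj y) * (cmod x * cmod y)
        = cmod ((x - y) * cnj y - cnj (x - y) * y)"
      using that by (simp add: norm_divide norm_mult)
    also have "\<dots> \<le> cmod (x - y) * cmod y + cmod (x - y) * cmod y"
      by (rule order_trans[OF norm_triangle_ineq4]) (simp only: norm_mult complex_mod_cnj)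
    finally have "cmod (x / cnj x - y / cnj y) * cmod x * cmod y \<le> 2 * cmod (x - y) * cmod y"
      by (simp add: algebra_simps)
    then show ?thesis using that by simp
  qed
  show ?thesis
    using *[of a b] *[of b a] assms by (simp add: max_def norm_minus_commute)
qed

text \<open>Outside the disc the projection has Lipschitz constant of order \<open>1 / |w + 1|\<close>, which is
  unbounded near \<open>-1\<close>; the weight \<open>|1 + z|\<close> in the modulus of continuity compensates for this.\<close>

lemma ray_proj_lipschitz:
  fixes u :: "complex \<Rightarrow> complex"
  assumes C: "C \<ge> 0" and u: "\<And>a b. cmod a \<le> 1 \<Longrightarrow> cmod b \<le> 1 \<Longrightarrow>
      cmod (u a - u b) \<le> C * cmod (a - b) * max (cmod (1 + a)) (cmod (1 + b))"
  shows "cmod (u (ray_proj v) - u (ray_proj w)) \<le> 2 * C * cmod (v - w)"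
proof -
  define A where "A = (\<lambda>i::nat. if i = 0 then cball 0 1 else if i = 1 then {w. Re w \<le> -1}
      else {w. cmod w \<ge> 1 \<and> Re w \<ge> -1})"
  have closed: "closed (A i)" for i
  proof -
    have "{w. cmod w \<ge> 1 \<and> Re w \<ge> -1} = {w. cmod w \<ge> 1} \<inter> {w. Re w \<ge> -1}" by auto
    moreover have "closed {w::complex. cmod w \<ge> 1}"
      by (intro closed_Collect_le continuous_intros)
    ultimately show ?thesis
      by (simp add: A_def closed_halfspace_Re_le closed_halfspace_Re_ge closed_Int)
  qed
  have cover: "x \<in> (\<Union>i\<in>{0,1,2}. A i)" for x
  proof -
    have "x \<in> A 0 \<or> x \<in> A 1 \<or> x \<in> A 2" unfolding A_def by simp linarith
    then show ?thesis by blast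
  qed
  have disc: "cmod (u (ray_proj x) - u (ray_proj y)) \<le> 2 * C * cmod (x - y)"
    if "cmod x \<le> 1" "cmod y \<le> 1" for x y
  proof -
    have "cmod (1 + x) \<le> 2" "cmod (1 + y) \<le> 2"
      using that norm_triangle_ineq[of 1 x] norm_triangle_ineq[of 1 y] by auto
    then have "C * cmod (x - y) * max (cmod (1 + x)) (cmod (1 + y)) \<le> C * cmod (x - y) * 2"
      using C by (intro mult_left_mono) auto
    then show ?thesis using u[OF that] that by (simp add: mult_ac)
  qed
  have vertex: "cmod (u (-1) - u (ray_proj y)) \<le> 2 * C * cmod (-1 - y)"
    if "cmod y \<ge> 1" "Re y \<ge> -1" "y \<noteq> -1" for y
  proof -
    have "cmod (1 + ray_proj y) \<le> 2"
      using norm_triangle_ineq[of 1 "ray_proj y"] norm_ray_proj_le[of y] by auto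
    then have "cmod (1 + ray_proj y) * cmod (1 + ray_proj y) \<le> 2 * cmod (y + 1)"
      using ray_proj_outside(2)[OF that] by (intro mult_mono) auto
    then have "C * (cmod (1 + ray_proj y) * cmod (1 + ray_proj y)) \<le> C * (2 * cmod (y + 1))"
      using C by (intro mult_left_mono)
    moreover have "cmod (-1 - ray_proj y) = cmod (1 + ray_proj y)" "cmod (-1 - y) = cmod (y + 1)"
      by (metis minus_add_distrib norm_minus_cancel uminus_add_conv_diff add.commute diff_conv_add_uminus)+
    ultimately show ?thesis using u[of "-1" "ray_proj y"] norm_ray_proj_le[of y]
      by (simp add: mult_ac)
  qed
  have outside: "cmod (u (ray_proj x) - u (ray_proj y)) \<le> 2 * C * cmod (x - y)"
    if x: "cmod x \<ge> 1" "Re x \<ge> -1" and y: "cmod y \<ge> 1" "Re y \<ge> -1" for x y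
  proof (cases "x = -1 \<or> y = -1")
    case True
    then show ?thesis using vertex[OF x] vertex[OF y]
      by (cases "x = -1"; cases "y = -1") (auto simp: norm_minus_commute)
  next
    case False
    define X where "X = ray_proj x"
    define Y where "Y = ray_proj y"
    have nz: "x + 1 \<noteq> 0" "y + 1 \<noteq> 0" using False by (auto simp: complex_eq_iff)
    have "cmod (X - Y) * max (cmod (1 + X)) (cmod (1 + Y))
        \<le> cmod (X - Y) * max (cmod (x + 1)) (cmod (y + 1))"
      using ray_proj_outside(2)[OF x] ray_proj_outside(2)[OF y] False
      by (intro mult_left_mono) (auto simp: X_def Y_def)
    also have "\<dots> \<le> 2 * cmod (x - y)"
      using unit_direction_diff[OF nz] ray_proj_outside(1)[OF x] ray_proj_outside(1)[OF y] False
      by (simp add: X_def Y_def)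
    finally have "C * (cmod (X - Y) * max (cmod (1 + X)) (cmod (1 + Y))) \<le> C * (2 * cmod (x - y))"
      using C by (intro mult_left_mono)
    then show ?thesis using u[of X Y] norm_ray_proj_le by (simp add: X_def Y_def mult_ac)
  qed
  have pieces: "cmod (u (ray_proj x) - u (ray_proj y)) \<le> 2 * C * cmod (x - y)"
    if "x \<in> A i" "y \<in> A i" for x y i
    using that disc outside ray_proj_left C by (auto simp: A_def split: if_splits)
  \<comment> \<open>the three closed pieces cover the segment from \<open>v\<close> to \<open>w\<close>, so the bounds on the pieces add up\<close>
  define p where "p = (\<lambda>t::real. v + of_real t * (w - v))"
  define M where "M = 2 * C * cmod (v - w)"
  have p: "continuous_on UNIV p" by (auto simp: p_def intro!: continuous_intros)
  have "M-lipschitz_on {0..1} (\<lambda>t. u (ray_proj (p t)))"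
  proof (rule lipschitz_on_closed_Union[where U = "\<lambda>i. p -` A i" and I = "{0,1,2}"])
    fix i
    show "closed (p -` A i)" using closed p by (intro closed_vimage) auto
    show "M-lipschitz_on (p -` A i) (\<lambda>t. u (ray_proj (p t)))"
    proof (rule lipschitz_onI)
      fix s t assume st: "s \<in> p -` A i" "t \<in> p -` A i"
      have "p s - p t = of_real (s - t) * (w - v)" by (simp add: p_def algebra_simps)
      then have "cmod (p s - p t) = \<bar>s - t\<bar> * cmod (v - w)"
        by (simp only: norm_mult norm_of_real norm_minus_commute)
      then show "dist (u (ray_proj (p s))) (u (ray_proj (p t))) \<le> M * dist s t"
        using pieces[of "p s" i "p t"] st by (simp add: dist_norm M_def mult_ac)
    qed (use C in \<open>simp add: M_def\<close>)
  qed (use C cover in \<open>auto simp: M_def\<close>)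
  then have "dist (u (ray_proj (p 0))) (u (ray_proj (p 1))) \<le> M * dist (0::real) 1"
    by (rule lipschitz_onD) auto
  then show ?thesis by (simp add: p_def M_def dist_norm)
qed

lemma ray_ext_lipschitz:
  fixes u :: "complex \<Rightarrow> complex"
  assumes C: "C \<ge> 0" and u: "\<And>a b. cmod a \<le> 1 \<Longrightarrow> cmod b \<le> 1 \<Longrightarrow>
      cmod (u a - u b) \<le> C * cmod (a - b) * max (cmod (1 + a)) (cmod (1 + b))"
  shows "(1 + 2 * C)-lipschitz_on UNIV (ray_ext u)"
proof (rule lipschitz_onI)
  fix v w
  have eq: "ray_ext u v - ray_ext u w = (v - w) + (u (ray_proj v) - u (ray_proj w))"
    by (simp add: ray_ext_def)
  have "cmod (u (ray_proj v) - u (ray_proj w)) \<le> 2 * C * cmod (v - w)"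
    by (rule ray_proj_lipschitz[OF C]) (rule u)
  then have "cmod (ray_ext u v - ray_ext u w) \<le> cmod (v - w) + 2 * C * cmod (v - w)"
    unfolding eq by (rule order_trans[OF norm_triangle_ineq add_left_mono])
  then show "dist (ray_ext u v) (ray_ext u w) \<le> (1 + 2 * C) * dist v w"
    by (simp add: dist_norm algebra_simps)
qed (use C in auto)

section \<open>Distributional derivatives of limits of Lipschitz maps\<close>

text \<open>The classical values \<open>p\<close> and \<open>q\<close> of the derivatives with respect to \<open>z\<close> and its conjugate.\<close>

definition has_wirtinger :: "(complex \<Rightarrow> complex) \<Rightarrow> complex \<Rightarrow> complex \<Rightarrow> complex \<Rightarrow> bool" where
  "has_wirtinger f p q z \<longleftrightarrow> (f has_derivative (\<lambda>h. p * h + q * cnj h)) (at z)"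

lemma has_wirtinger_mult:
  assumes "has_wirtinger f p q z" "has_wirtinger g r s z"
  shows "has_wirtinger (\<lambda>z. f z * g z) (p * g z + f z * r) (q * g z + f z * s) z"
proof -
  have "(\<lambda>h. f z * (r * h + s * cnj h) + (p * h + q * cnj h) * g z)
      = (\<lambda>h. (p * g z + f z * r) * h + (q * g z + f z * s) * cnj h)"
    by (simp add: fun_eq_iff algebra_simps)
  then show ?thesis
    using has_derivative_mult[OF assms[unfolded has_wirtinger_def]] unfolding has_wirtinger_def by simp
qed

lemma has_wirtinger_difference_quotient:
  assumes "has_wirtinger f p q z" and e: "e \<noteq> 0"
    and T: "T \<longlonglongrightarrow> 0" "\<And>n. T n > 0"
  shows "(\<lambda>n. (f (z + of_real (T n) * e) - f z) / of_real (T n)) \<longlonglongrightarrow> p * e + q * cnj e"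
proof -
  define D where "D = (\<lambda>h. p * h + q * cnj h)"
  have "((\<lambda>h. norm (f (z + h) - f z - D h) / norm h) \<longlongrightarrow> 0) (at 0)"
    using assms(1) unfolding has_wirtinger_def has_derivative_at D_def by blast
  moreover have "filterlim (\<lambda>n. of_real (T n) * e) (at 0) sequentially"
  proof (rule filterlim_atI)
    show "(\<lambda>n. of_real (T n) * e) \<longlonglongrightarrow> 0"
      using tendsto_mult_left[OF tendsto_of_real[OF T(1)], of e] by (simp add: mult.commute)
    show "\<forall>\<^sub>F n in sequentially. of_real (T n) * e \<noteq> 0"
      using T(2) e by (intro always_eventually) (metis less_irrefl mult_eq_0_iff of_real_eq_0_iff)
  qed
  ultimately have "(\<lambda>n. norm (f (z + of_real (T n) * e) - f z - D (of_real (T n) * e))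
      / norm (of_real (T n) * e)) \<longlonglongrightarrow> 0"
    by (rule filterlim_compose)
  then have "(\<lambda>n. norm e * (norm (f (z + of_real (T n) * e) - f z - D (of_real (T n) * e))
      / norm (of_real (T n) * e))) \<longlonglongrightarrow> 0"
    using tendsto_mult_right_zero by blast
  moreover have "norm e * (norm (f (z + of_real (T n) * e) - f z - D (of_real (T n) * e))
      / norm (of_real (T n) * e))
    = norm ((f (z + of_real (T n) * e) - f z) / of_real (T n) - D e)" for n
  proof -
    have D: "D (of_real (T n) * e) = of_real (T n) * D e" by (simp add: D_def algebra_simps)
    have "(f (z + of_real (T n) * e) - f z) / of_real (T n) - D e
       = (f (z + of_real (T n) * e) - f z - D (of_real (T n) * e)) / of_real (T n)"
      using T(2)[of n] unfolding D by (simp add: field_simps)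
    then show ?thesis using e T(2)[of n] by (simp add: norm_divide norm_mult)
  qed
  ultimately have "(\<lambda>n. (f (z + of_real (T n) * e) - f z) / of_real (T n) - D e) \<longlonglongrightarrow> 0"
    by (simp add: tendsto_norm_zero_iff)
  then show ?thesis by (simp add: D_def LIM_zero_iff)
qed

lemma has_wirtinger_bound:
  assumes w: "has_wirtinger f p q z" and d: "d > 0"
    and lip: "\<And>x. dist x z \<le> d \<Longrightarrow> cmod (f x - f z) \<le> C * cmod (x - z)"
  shows "cmod p \<le> C" "cmod q \<le> C"
proof -
  have *: "cmod (p * e + q * cnj e) \<le> C" if e: "cmod e = 1" for e
  proof -
    define T where "T = (\<lambda>n. d / real (Suc n))"
    have T: "T \<longlonglongrightarrow> 0" "\<And>n. T n > 0" "\<And>n. T n \<le> d"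
      using d unfolding T_def using LIMSEQ_Suc[OF lim_const_over_n[of d]] by (simp, simp, simp add: field_simps)
    have "e \<noteq> 0" using e by auto
    from has_wirtinger_difference_quotient[OF w this T(1,2)]
    show ?thesis
    proof (rule Lim_norm_ubound[rotated])
      show "\<forall>\<^sub>F n in sequentially. cmod ((f (z + of_real (T n) * e) - f z) / of_real (T n)) \<le> C"
      proof (intro always_eventually allI)
        fix n
        have "cmod (f (z + of_real (T n) * e) - f z) \<le> C * cmod (z + of_real (T n) * e - z)"
          using T e by (intro lip) (auto simp: dist_norm norm_mult less_imp_le)
        then show "cmod ((f (z + of_real (T n) * e) - f z) / of_real (T n)) \<le> C"
          using T(2)[of n] e by (simp add: norm_divide norm_mult field_simps)
      qed
    qed auto
  qed
  have 1: "cmod (p + q) \<le> C" using *[of 1] by simp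
  have "p * \<i> + q * cnj \<i> = \<i> * (p - q)" by (simp add: algebra_simps)
  then have 2: "cmod (p - q) \<le> C" using *[of \<i>] by (simp add: norm_mult)
  have "2 * cmod p = cmod ((p + q) + (p - q))" by (simp add: norm_mult flip: mult_2)
  then show "cmod p \<le> C" using norm_triangle_ineq[of "p + q" "p - q"] 1 2 by linarith
  have "2 * cmod q = cmod ((p + q) - (p - q))" by (simp add: norm_mult flip: mult_2)
  then show "cmod q \<le> C" using norm_triangle_ineq4[of "p + q" "p - q"] 1 2 by linarith
qed

lemma test_functionE:
  assumes "test_function_on U \<phi>"
  obtains K where "compact K" "K \<subseteq> U"
    "\<And>z. has_wirtinger \<phi> (wirtinger_dz \<phi> z) (wirtinger_dzbar \<phi> z) z"
    "continuous_on UNIV \<phi>" "continuous_on UNIV (wirtinger_dz \<phi>)" "continuous_on UNIV (wirtinger_dzbar \<phi>)"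
    "\<And>z. z \<notin> K \<Longrightarrow> \<phi> z = 0 \<and> wirtinger_dz \<phi> z = 0 \<and> wirtinger_dzbar \<phi> z = 0"
proof
  let ?K = "closure {z. \<phi> z \<noteq> 0}"
  have C: "Ck_plane n \<phi>" for n using assms by (simp add: test_function_on_def)
  have c: "continuous_on UNIV (partial_x \<phi>)" "continuous_on UNIV (partial_y \<phi>)"
    and d: "\<And>z. \<phi> differentiable (at z)" using C[of "Suc 0"] by auto
  show "compact ?K" "?K \<subseteq> U" using assms by (simp_all add: test_function_on_def)
  show "continuous_on UNIV \<phi>" using C[of 0] by simp
  show "continuous_on UNIV (wirtinger_dz \<phi>)" "continuous_on UNIV (wirtinger_dzbar \<phi>)"
    unfolding wirtinger_dz_def[abs_def] wirtinger_dzbar_def[abs_def] by (intro continuous_intros c; simp)+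
  show "has_wirtinger \<phi> (wirtinger_dz \<phi> z) (wirtinger_dzbar \<phi> z) z" for z
  proof -
    have D: "(\<phi> has_derivative frechet_derivative \<phi> (at z)) (at z)"
      using d frechet_derivative_works by blast
    then interpret bounded_linear "frechet_derivative \<phi> (at z)" by (rule has_derivative_bounded_linear)
    have "frechet_derivative \<phi> (at z) h = wirtinger_dz \<phi> z * h + wirtinger_dzbar \<phi> z * cnj h" for h
    proof -
      have "h = Re h *\<^sub>R 1 + Im h *\<^sub>R \<i>" by (simp add: complex_eq_iff)
      then have "frechet_derivative \<phi> (at z) h = frechet_derivative \<phi> (at z) (Re h *\<^sub>R 1 + Im h *\<^sub>R \<i>)"
        by (rule arg_cong)
      also have "\<dots> = of_real (Re h) * partial_x \<phi> z + of_real (Im h) * partial_y \<phi> z"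
        by (simp only: add scaleR) (simp add: partial_x_def partial_y_def scaleR_conv_of_real)
      also have "\<dots> = wirtinger_dz \<phi> z * h + wirtinger_dzbar \<phi> z * cnj h"
      proof -
        have 1: "wirtinger_dz \<phi> z * h + wirtinger_dzbar \<phi> z * cnj h
            = partial_x \<phi> z * ((h + cnj h) / 2) - \<i> * partial_y \<phi> z * ((h - cnj h) / 2)"
          by (simp add: wirtinger_dz_def wirtinger_dzbar_def field_simps)
        have 2: "(h + cnj h) / 2 = of_real (Re h)" "(h - cnj h) / 2 = \<i> * of_real (Im h)"
          by (simp_all add: complex_eq_iff)
        show ?thesis unfolding 1 2 by (simp add: algebra_simps)
      qed
      finally show ?thesis .
    qed
    then have "frechet_derivative \<phi> (at z) = (\<lambda>h. wirtinger_dz \<phi> z * h + wirtinger_dzbar \<phi> z * cnj h)"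
      by (rule ext)
    then show ?thesis using D unfolding has_wirtinger_def by simp
  qed
  show "\<phi> z = 0 \<and> wirtinger_dz \<phi> z = 0 \<and> wirtinger_dzbar \<phi> z = 0" if "z \<notin> ?K" for z
  proof -
    have zero: "\<phi> x = 0" if "x \<notin> ?K" for x
      using that subsetD[OF closure_subset, of x "{z. \<phi> z \<noteq> 0}"] by fast
    have "(\<phi> has_derivative (\<lambda>_. 0)) (at z)"
    proof (rule has_derivative_transform_within_open[where f = "\<lambda>_. 0" and s = "- ?K"])
      show "\<And>x. x \<in> - ?K \<Longrightarrow> 0 = \<phi> x" by (rule zero[symmetric]) (rule ComplD)
    qed (use that in auto)
    then have "frechet_derivative \<phi> (at z) = (\<lambda>_. 0)" by (metis frechet_derivative_at)
    moreover have "\<phi> z = 0" using that by (rule zero)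
    ultimately show ?thesis
      by (simp add: wirtinger_dz_def wirtinger_dzbar_def partial_x_def partial_y_def)
  qed
qed

lemma borel_measurable_AE_LIMSEQ:
  fixes s :: "nat \<Rightarrow> complex \<Rightarrow> complex"
  assumes s: "\<And>n. s n \<in> borel_measurable lebesgue" and lim: "AE z in lebesgue. (\<lambda>n. s n z) \<longlonglongrightarrow> a z"
  shows "a \<in> borel_measurable lebesgue"
proof (rule measurableI)
  fix B :: "complex set" assume B: "B \<in> sets borel"
  let ?L = "\<lambda>z. lim (\<lambda>n. s n z)"
  have L: "?L \<in> borel_measurable lebesgue" by (intro borel_measurable_lim_metric s)
  have "AE z in lebesgue. z \<in> ?L -` B \<inter> space lebesgue \<longleftrightarrow> z \<in> a -` B \<inter> space lebesgue"
    using lim by eventually_elim (auto simp: limI)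
  then show "a -` B \<inter> space lebesgue \<in> sets lebesgue"
    by (rule completion.in_sets_AE) (use measurable_sets[OF L B] in auto)
qed auto

lemma integral_lebesgue_shift:
  fixes g :: "complex \<Rightarrow> complex"
  assumes "continuous_on UNIV g"
  shows "(LINT z|lebesgue. g (z + a)) = integral\<^sup>L lebesgue g"
proof -
  have m: "g \<in> borel_measurable borel" using assms by (rule borel_measurable_continuous_onI)
  have m': "(\<lambda>z. g (a + z)) \<in> borel_measurable borel"
    by (intro borel_measurable_continuous_onI continuous_on_compose2[OF assms] continuous_intros) auto
  have "integral\<^sup>L lborel g = integral\<^sup>L (distr lborel borel ((+) a)) g" by (simp add: lborel_distr_plus)
  also have "\<dots> = (LINT z|lborel. g (a + z))"
    by (rule integral_distr) (use m in auto)
  finally show ?thesis using m m' by (simp add: integral_completion add.commute)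
qed

text \<open>Integration by parts for a compactly supported Lipschitz function: the difference quotients
  have integral zero because Lebesgue measure is translation invariant.\<close>

lemma integral_directional_derivative_zero:
  fixes g a :: "complex \<Rightarrow> complex"
  assumes cont: "continuous_on UNIV g" and supp: "\<And>z. cmod z > R \<Longrightarrow> g z = 0"
    and e: "cmod e = 1" and d: "d > 0"
    and lip: "\<And>x y. dist x y \<le> d \<Longrightarrow> cmod (g x - g y) \<le> C * cmod (x - y)"
    and deriv: "AE z in lebesgue. \<exists>p q. has_wirtinger g p q z \<and> a z = p * e + q * cnj e"
  shows "integrable lebesgue a" "integral\<^sup>L lebesgue a = 0"
proof -
  define T where "T = (\<lambda>n. d / real (Suc n))"
  have T: "T \<longlonglongrightarrow> 0" "\<And>n. T n > 0" "\<And>n. T n \<le> d"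
    using d unfolding T_def using LIMSEQ_Suc[OF lim_const_over_n[of d]] by (simp, simp, simp add: field_simps)
  have e0: "e \<noteq> 0" using e by auto
  define s where "s = (\<lambda>n z. (g (z + of_real (T n) * e) - g z) / of_real (T n))"
  have cs: "continuous_on UNIV (\<lambda>z. g (z + c))" for c
    by (intro continuous_on_compose2[OF cont] continuous_intros) auto
  have contB: "h \<in> borel_measurable lebesgue" if "continuous_on UNIV h" for h :: "complex \<Rightarrow> complex"
    using borel_measurable_continuous_onI[OF that] by (simp add: measurable_completion)
  have Tne: "complex_of_real (T n) \<noteq> 0" for n using T(2)[of n] by simp
  have ms: "s n \<in> borel_measurable lebesgue" for n
    unfolding s_def by (intro contB continuous_intros cs cont) (use Tne in auto)
  have lim: "AE z in lebesgue. (\<lambda>n. s n z) \<longlonglongrightarrow> a z"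
    using deriv
  proof eventually_elim
    case (elim z)
    then obtain p q where pq: "has_wirtinger g p q z" "a z = p * e + q * cnj e" by blast
    show ?case unfolding s_def pq(2) by (rule has_wirtinger_difference_quotient[OF pq(1) e0 T(1,2)])
  qed
  have ma: "a \<in> borel_measurable lebesgue" by (rule borel_measurable_AE_LIMSEQ[OF ms lim])
  define w where "w = (\<lambda>z::complex. \<bar>C\<bar> * indicat_real (cball 0 (\<bar>R\<bar> + d)) z)"
  have iw: "integrable lebesgue w"
    unfolding w_def by (intro integrable_mult_right integrable_real_indicator) (use emeasure_lborel_cball_finite[of "0::complex" "\<bar>R\<bar> + d"] in auto)
  have bd: "AE z in lebesgue. cmod (s n z) \<le> w z" for n
  proof (intro AE_I2)
    fix z :: complex
    show "cmod (s n z) \<le> w z"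
    proof (cases "cmod z \<le> \<bar>R\<bar> + d")
      case True
      have "cmod (g (z + of_real (T n) * e) - g z) \<le> C * cmod (z + of_real (T n) * e - z)"
        using T(2,3)[of n] e by (intro lip) (auto simp: dist_norm norm_mult)
      also have "\<dots> = C * T n" using T(2)[of n] e by (simp add: norm_mult)
      also have "\<dots> \<le> \<bar>C\<bar> * T n" using T(2)[of n] by (intro mult_right_mono) auto
      finally show ?thesis using T(2)[of n] True by (simp add: s_def w_def norm_divide divide_le_eq)
    next
      case False
      have "cmod z \<le> cmod (z + of_real (T n) * e) + cmod (of_real (T n) * e)"
        using norm_triangle_ineq4[of "z + of_real (T n) * e" "of_real (T n) * e"] by simp
      then have "cmod (z + of_real (T n) * e) > \<bar>R\<bar>"
        using False T(2,3)[of n] e by (simp add: norm_mult)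
      then have "g (z + of_real (T n) * e) = 0" "g z = 0"
        using supp False d by auto
      then show ?thesis by (simp add: s_def w_def)
    qed
  qed
  show "integrable lebesgue a"
    by (rule integrable_dominated_convergence[OF ma ms iw lim bd])
  have gi: "integrable lebesgue (\<lambda>z. g (z + c))" for c
  proof -
    have "integrable lborel (\<lambda>z. indicator (cball 0 (\<bar>R\<bar> + cmod c)) z *\<^sub>R g (z + c))"
      by (intro borel_integrable_compact continuous_on_subset[OF cs]) auto
    moreover have "indicator (cball 0 (\<bar>R\<bar> + cmod c)) z *\<^sub>R g (z + c) = g (z + c)" for z
    proof (cases "cmod z \<le> \<bar>R\<bar> + cmod c")
      case False
      then have "cmod (z + c) > R" using norm_diff_ineq[of z c] by linarith
      then show ?thesis using supp by simp
    qed auto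
    ultimately have "integrable lborel (\<lambda>z. g (z + c))" by simp
    then show ?thesis
      by (subst integrable_completion) (use borel_measurable_continuous_onI[OF cs] in auto)
  qed
  have "integral\<^sup>L lebesgue (s n) = 0" for n
  proof -
    have "(LINT z|lebesgue. g (z + of_real (T n) * e) - g z)
        = (LINT z|lebesgue. g (z + of_real (T n) * e)) - integral\<^sup>L lebesgue g"
      using gi[of "of_real (T n) * e"] gi[of 0] by (intro Bochner_Integration.integral_diff) auto
    also have "\<dots> = 0" by (simp add: integral_lebesgue_shift[OF cont])
    finally show ?thesis by (simp add: s_def)
  qed
  moreover have "(\<lambda>n. integral\<^sup>L lebesgue (s n)) \<longlonglongrightarrow> integral\<^sup>L lebesgue a"
    by (rule integral_dominated_convergence[OF ma ms iw lim bd])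
  ultimately show "integral\<^sup>L lebesgue a = 0" by (simp add: LIMSEQ_const_iff)
qed

text \<open>Derivatives that exist almost everywhere are almost everywhere limits of difference quotients of a
  continuous function; the two directions \<open>1\<close> and \<open>\<i>\<close> determine \<open>p\<close> and \<open>q\<close>.\<close>

lemma measurable_wirtinger:
  assumes K: "compact K" and d: "d > 0" and L: "\<And>x y. x \<in> K \<Longrightarrow> dist x y \<le> d \<Longrightarrow> y \<in> L"
    and cont: "continuous_on L f"
    and der: "AE z in lebesgue. z \<in> K \<longrightarrow> has_wirtinger f (p z) (q z) z"
  shows "(\<lambda>z. indicator K z *\<^sub>R p z) \<in> borel_measurable lebesgue"
    and "(\<lambda>z. indicator K z *\<^sub>R q z) \<in> borel_measurable lebesgue"
proof -
  define T where "T = (\<lambda>n. d / real (Suc n))"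
  have T: "T \<longlonglongrightarrow> 0" "\<And>n. T n > 0" "\<And>n. T n \<le> d"
    using d unfolding T_def using LIMSEQ_Suc[OF lim_const_over_n[of d]] by (simp, simp, simp add: field_simps)
  have dir: "(\<lambda>z. indicator K z *\<^sub>R (p z * e + q z * cnj e)) \<in> borel_measurable lebesgue" if e: "cmod e = 1" for e
  proof (rule borel_measurable_AE_LIMSEQ)
    fix n
    have sub: "(\<lambda>z. z + of_real (T n) * e) ` K \<subseteq> L"
      using L T(2,3)[of n] e by (auto simp: dist_norm norm_mult)
    have KL: "K \<subseteq> L" using L d by fastforce
    have "continuous_on K (\<lambda>z. (f (z + of_real (T n) * e) - f z) / of_real (T n))"
      using T(2)[of n]
      by (intro continuous_intros continuous_on_compose2[OF cont _ sub] continuous_on_subset[OF cont KL]) auto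
    then show "(\<lambda>z. indicator K z *\<^sub>R ((f (z + of_real (T n) * e) - f z) / of_real (T n)))
        \<in> borel_measurable lebesgue"
      using borel_measurable_continuous_on_indicator[of K] K
      by (intro measurable_completion) (simp add: borel_compact)
  next
    show "AE z in lebesgue. (\<lambda>n. indicator K z *\<^sub>R ((f (z + of_real (T n) * e) - f z) / of_real (T n)))
        \<longlonglongrightarrow> indicator K z *\<^sub>R (p z * e + q z * cnj e)"
      using der
    proof eventually_elim
      case (elim z)
      have "e \<noteq> 0" using e by auto
      then show ?case
        using elim has_wirtinger_difference_quotient[of f "p z" "q z" z e T] T
        by (cases "z \<in> K") auto
    qed
  qed
  have s: "(\<lambda>z. indicator K z *\<^sub>R (p z + q z)) \<in> borel_measurable lebesgue"
    using dir[of 1] by simp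
  have "(\<lambda>z. indicator K z *\<^sub>R (p z * \<i> + q z * cnj \<i>)) \<in> borel_measurable lebesgue"
    by (rule dir) simp
  then have t: "(\<lambda>z. - \<i> * (indicator K z *\<^sub>R (p z * \<i> + q z * cnj \<i>))) \<in> borel_measurable lebesgue"
    by (intro borel_measurable_times borel_measurable_const)
  have "(\<lambda>z. (1/2) * (indicator K z *\<^sub>R (p z + q z) + (- \<i> * (indicator K z *\<^sub>R (p z * \<i> + q z * cnj \<i>)))))
      \<in> borel_measurable lebesgue"
    by (intro borel_measurable_times borel_measurable_const borel_measurable_add s t)
  moreover have "(\<lambda>z. (1/2) * (indicator K z *\<^sub>R (p z + q z) + (- \<i> * (indicator K z *\<^sub>R (p z * \<i> + q z * cnj \<i>)))))
      = (\<lambda>z. indicator K z *\<^sub>R p z)"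
    by (rule ext) (auto simp: indicator_def algebra_simps)
  ultimately show "(\<lambda>z. indicator K z *\<^sub>R p z) \<in> borel_measurable lebesgue" by simp
  have "(\<lambda>z. (1/2) * (indicator K z *\<^sub>R (p z + q z) - (- \<i> * (indicator K z *\<^sub>R (p z * \<i> + q z * cnj \<i>)))))
      \<in> borel_measurable lebesgue"
    by (intro borel_measurable_times borel_measurable_const borel_measurable_diff s t)
  moreover have "(\<lambda>z. (1/2) * (indicator K z *\<^sub>R (p z + q z) - (- \<i> * (indicator K z *\<^sub>R (p z * \<i> + q z * cnj \<i>)))))
      = (\<lambda>z. indicator K z *\<^sub>R q z)"
    by (rule ext) (auto simp: indicator_def algebra_simps)
  ultimately show "(\<lambda>z. indicator K z *\<^sub>R q z) \<in> borel_measurable lebesgue" by simp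
qed

lemma integrable_lebesgue_indicator_continuous:
  fixes f :: "complex \<Rightarrow> complex"
  assumes "compact K" "continuous_on K f"
  shows "integrable lebesgue (\<lambda>z. indicator K z *\<^sub>R f z)"
  using borel_integrable_compact[OF assms] borel_measurable_continuous_on_indicator[of K f] assms
  by (subst integrable_completion) (auto simp: borel_compact)

text \<open>The product of \<open>f\<close> with a test function extends by zero to a function that is Lipschitz at small
  distances, because \<open>f\<close> is Lipschitz on a neighbourhood of the support; its derivatives in the
  directions \<open>1\<close> and \<open>\<i>\<close> have integral zero.\<close>

lemma wirtinger_integration_by_parts:
  assumes K: "compact K" and d: "d > 0" and L: "compact L" "\<And>x y. x \<in> K \<Longrightarrow> dist x y \<le> d \<Longrightarrow> y \<in> L"
    and lip: "\<And>x y. x \<in> L \<Longrightarrow> y \<in> L \<Longrightarrow> cmod (f x - f y) \<le> C * cmod (x - y)"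
    and der: "AE z in lebesgue. z \<in> K \<longrightarrow> has_wirtinger f (p z) (q z) z"
    and \<phi>: "\<And>z. has_wirtinger \<phi> (r z) (s z) z"
    and c: "continuous_on UNIV \<phi>" "continuous_on UNIV r" "continuous_on UNIV s"
    and zero: "\<And>z. z \<notin> K \<Longrightarrow> \<phi> z = 0 \<and> r z = 0 \<and> s z = 0"
  shows "(LINT z|lebesgue. f z * r z) = - (LINT z|lebesgue. p z * \<phi> z)"
    and "(LINT z|lebesgue. f z * s z) = - (LINT z|lebesgue. q z * \<phi> z)"
proof -
  have KL: "K \<subseteq> L" using L d by fastforce
  have contf: "continuous_on L f"
    by (rule lipschitz_on_continuous_on[of "\<bar>C\<bar>"], rule lipschitz_onI)
      (use lip in \<open>auto simp: dist_norm intro: order_trans[OF _ mult_right_mono[of C "\<bar>C\<bar>"]]\<close>)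
  obtain M where M: "M > 0" "\<And>x. x \<in> L \<Longrightarrow> cmod (f x) \<le> M"
    using compact_continuous_image[OF contf L(1)] compact_imp_bounded bounded_pos by (metis image_eqI)
  have bdd: "\<exists>B>0. \<forall>z. cmod (h z) \<le> B" if "continuous_on UNIV h" "\<And>z. z \<notin> K \<Longrightarrow> h z = 0"
    for h :: "complex \<Rightarrow> complex"
  proof -
    have "compact (h ` K)" using that K by (meson compact_continuous_image continuous_on_subset subset_UNIV)
    then obtain B where "B > 0" "\<And>x. x \<in> K \<Longrightarrow> cmod (h x) \<le> B"
      using compact_imp_bounded bounded_pos by (metis image_eqI)
    then show ?thesis using that(2) by (metis less_imp_le norm_zero)
  qed
  obtain B0 where B0: "B0 > 0" "\<And>z. cmod (\<phi> z) \<le> B0" using bdd[OF c(1)] zero by blast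
  obtain B1 where B1: "B1 > 0" "\<And>z. cmod (r z) \<le> B1" using bdd[OF c(2)] zero by blast
  obtain B2 where B2: "B2 > 0" "\<And>z. cmod (s z) \<le> B2" using bdd[OF c(3)] zero by blast
  have lip\<phi>: "cmod (\<phi> x - \<phi> y) \<le> (B1 + B2) * cmod (x - y)" for x y
  proof (rule differentiable_bound[of UNIV])
    show "(\<phi> has_derivative (\<lambda>h. r z * h + s z * cnj h)) (at z within UNIV)" for z
      using \<phi>[of z] by (simp add: has_wirtinger_def)
    show "onorm (\<lambda>h. r z * h + s z * cnj h) \<le> B1 + B2" for z
    proof (rule onorm_le)
      fix h
      have "cmod (r z * h + s z * cnj h) \<le> cmod (r z) * cmod h + cmod (s z) * cmod h"
        by (metis norm_triangle_ineq norm_mult complex_mod_cnj)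
      also have "\<dots> \<le> B1 * cmod h + B2 * cmod h" using B1 B2 by (intro add_mono mult_right_mono) auto
      finally show "cmod (r z * h + s z * cnj h) \<le> (B1 + B2) * cmod h" by (simp add: algebra_simps)
    qed
  qed auto
  define g where "g = (\<lambda>z. f z * \<phi> z)"
  define D where "D = M * (B1 + B2) + B0 * \<bar>C\<bar>"
  have D: "D \<ge> 0" using M B0 B1 B2 by (simp add: D_def)
  have lipg: "cmod (g x - g y) \<le> D * cmod (x - y)" if "dist x y \<le> d" for x y
  proof (cases "x \<in> K \<or> y \<in> K")
    case True
    then have xy: "x \<in> L" "y \<in> L" using L(2) that d by (auto simp: dist_commute intro: KL[THEN subsetD])
    have "g x - g y = f x * (\<phi> x - \<phi> y) + \<phi> y * (f x - f y)" by (simp add: g_def algebra_simps)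
    then have "cmod (g x - g y) \<le> cmod (f x) * cmod (\<phi> x - \<phi> y) + cmod (\<phi> y) * cmod (f x - f y)"
      by (metis norm_triangle_ineq norm_mult)
    also have "\<dots> \<le> M * ((B1 + B2) * cmod (x - y)) + B0 * (\<bar>C\<bar> * cmod (x - y))"
      using M B0 xy lip\<phi> order_trans[OF lip[OF xy] mult_right_mono[of C "\<bar>C\<bar>"]]
      by (intro add_mono mult_mono) auto
    finally show ?thesis by (simp add: D_def algebra_simps)
  next
    case False
    then show ?thesis using zero D by (simp add: g_def)
  qed
  have contg: "continuous_on UNIV g"
  proof (rule continuous_at_imp_continuous_on, rule ballI)
    fix x
    have "\<forall>\<^sub>F y in at x. cmod (g y - g x) \<le> D * cmod (y - x)"
      unfolding eventually_at_le using d lipg by (intro exI[of _ d]) auto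
    moreover have "((\<lambda>y. D * cmod (y - x)) \<longlongrightarrow> 0) (at x)"
      by (auto intro!: tendsto_eq_intros)
    ultimately have "((\<lambda>y. g y - g x) \<longlongrightarrow> 0) (at x)"
      by (rule Lim_null_comparison)
    then show "isCont g x" by (simp add: isCont_def LIM_zero_iff)
  qed
  obtain R where R: "\<And>z. z \<in> K \<Longrightarrow> cmod z \<le> R"
    using K compact_imp_bounded bounded_iff by metis
  define A where "A = (\<lambda>z. p z * \<phi> z + f z * r z)"
  define B where "B = (\<lambda>z. q z * \<phi> z + f z * s z)"
  have dg: "AE z in lebesgue. has_wirtinger g (A z) (B z) z"
    using der
  proof eventually_elim
    case (elim z)
    show ?case
    proof (cases "z \<in> K")
      case True
      then show ?thesis using has_wirtinger_mult[OF _ \<phi>, of f "p z" "q z" z] elim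
        by (simp add: A_def B_def g_def)
    next
      case False
      have "(g has_derivative (\<lambda>_. 0)) (at z)"
      proof (rule has_derivative_transform_within_open[where f = "\<lambda>_. 0" and s = "- K"])
        show "open (- K)" using K compact_imp_closed by blast
        show "\<And>x. x \<in> - K \<Longrightarrow> 0 = g x" using zero by (simp add: g_def)
      qed (use False in auto)
      then show ?thesis using zero[OF False] by (simp add: A_def B_def has_wirtinger_def)
    qed
  qed
  have dir: "integrable lebesgue (\<lambda>z. A z * e + B z * cnj e)"
       "(LINT z|lebesgue. A z * e + B z * cnj e) = 0" if e: "cmod e = 1" for e
  proof -
    have sg: "g z = 0" if "cmod z > R" for z using R[of z] zero[of z] that by (auto simp: g_def)
    have "AE z in lebesgue. \<exists>p q. has_wirtinger g p q z \<and> A z * e + B z * cnj e = p * e + q * cnj e"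
      using dg by eventually_elim blast
    from integral_directional_derivative_zero[OF contg sg e d lipg this]
    show "integrable lebesgue (\<lambda>z. A z * e + B z * cnj e)"
       "(LINT z|lebesgue. A z * e + B z * cnj e) = 0" by blast+
  qed
  have i1: "integrable lebesgue (\<lambda>z. A z + B z)" "(LINT z|lebesgue. A z + B z) = 0"
    using dir[of 1] by simp_all
  have eq: "A z * \<i> + B z * cnj \<i> = \<i> * (A z - B z)" for z by (simp add: algebra_simps)
  have i2: "integrable lebesgue (\<lambda>z. A z - B z)" "(LINT z|lebesgue. A z - B z) = 0"
    using dir[of \<i>] integrable_mult_right[of "-\<i>" lebesgue "\<lambda>z. \<i> * (A z - B z)"] unfolding eq by simp_all
  have sum: "integrable lebesgue (\<lambda>z. (A z + B z) + (A z - B z))"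
      "(LINT z|lebesgue. (A z + B z) + (A z - B z)) = 0"
    using i1(2) i2(2) Bochner_Integration.integral_add[OF i1(1) i2(1)] Bochner_Integration.integrable_add[OF i1(1) i2(1)]
    by simp_all
  have diff: "integrable lebesgue (\<lambda>z. (A z + B z) - (A z - B z))"
      "(LINT z|lebesgue. (A z + B z) - (A z - B z)) = 0"
    using i1(2) i2(2) Bochner_Integration.integral_diff[OF i1(1) i2(1)]
      Bochner_Integration.integrable_diff[OF i1(1) i2(1)]
    by simp_all
  have half: "integrable lebesgue (\<lambda>z. (1/2) * h z)" "(LINT z|lebesgue. (1/2) * h z) = 0"
    if "integrable lebesgue h" "integral\<^sup>L lebesgue h = 0" for h :: "complex \<Rightarrow> complex"
    using that by simp_all
  have A: "A = (\<lambda>z. (1/2) * ((A z + B z) + (A z - B z)))"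
    and B: "B = (\<lambda>z. (1/2) * ((A z + B z) - (A z - B z)))"
    by (simp_all add: fun_eq_iff)
  have iA: "integrable lebesgue A" "integral\<^sup>L lebesgue A = 0"
    using half[OF sum] unfolding A[symmetric] by simp_all
  have iB: "integrable lebesgue B" "integral\<^sup>L lebesgue B = 0"
    using half[OF diff] unfolding B[symmetric] by simp_all
  have prod: "integrable lebesgue (\<lambda>z. f z * h z)" if "continuous_on UNIV h" "\<And>z. z \<notin> K \<Longrightarrow> h z = 0" for h
  proof -
    have "integrable lebesgue (\<lambda>z. indicator K z *\<^sub>R (f z * h z))"
      by (intro integrable_lebesgue_indicator_continuous K continuous_intros
          continuous_on_subset[OF contf KL] continuous_on_subset[OF that(1)]) auto
    moreover have "(\<lambda>z. indicator K z *\<^sub>R (f z * h z)) = (\<lambda>z. f z * h z)"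
      using that(2) by (auto simp: indicator_def fun_eq_iff)
    ultimately show ?thesis by simp
  qed
  have ir: "integrable lebesgue (\<lambda>z. f z * r z)" and is': "integrable lebesgue (\<lambda>z. f z * s z)"
    using prod[OF c(2)] prod[OF c(3)] zero by auto
  have "(LINT z|lebesgue. p z * \<phi> z) = (LINT z|lebesgue. A z - f z * r z)"
    by (simp add: A_def)
  also have "\<dots> = - (LINT z|lebesgue. f z * r z)"
    using iA ir by (subst Bochner_Integration.integral_diff) auto
  finally show "(LINT z|lebesgue. f z * r z) = - (LINT z|lebesgue. p z * \<phi> z)" by simp
  have "(LINT z|lebesgue. q z * \<phi> z) = (LINT z|lebesgue. B z - f z * s z)"
    by (simp add: B_def)
  also have "\<dots> = - (LINT z|lebesgue. f z * s z)"
    using iB is' by (subst Bochner_Integration.integral_diff) auto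
  finally show "(LINT z|lebesgue. f z * s z) = - (LINT z|lebesgue. q z * \<phi> z)" by simp
qed

lemma integral_limit_on_compact:
  fixes a :: "nat \<Rightarrow> complex \<Rightarrow> complex"
  assumes K: "compact K" and h: "continuous_on UNIV h"
    and meas: "\<And>n. (\<lambda>z. indicator K z *\<^sub>R a n z) \<in> borel_measurable lebesgue"
    and bd: "\<And>n. AE z in lebesgue. z \<in> K \<longrightarrow> cmod (a n z) \<le> C"
    and lim: "AE z in lebesgue. z \<in> K \<longrightarrow> (\<lambda>n. a n z) \<longlonglongrightarrow> A z"
  shows "integrable lebesgue (\<lambda>z. indicator K z *\<^sub>R (A z * h z))"
    and "(\<lambda>n. (LINT z|lebesgue. indicator K z *\<^sub>R (a n z * h z)))
      \<longlonglongrightarrow> (LINT z|lebesgue. indicator K z *\<^sub>R (A z * h z))"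
proof -
  have "compact (h ` K)" using h K by (meson compact_continuous_image continuous_on_subset subset_UNIV)
  then obtain B where B: "B > 0" "\<And>x. x \<in> K \<Longrightarrow> cmod (h x) \<le> B"
    using compact_imp_bounded bounded_pos by (metis image_eqI)
  have hm: "h \<in> borel_measurable lebesgue"
    using borel_measurable_continuous_onI[OF h] by (simp add: measurable_completion)
  have m: "(\<lambda>z. indicator K z *\<^sub>R (a n z * h z)) \<in> borel_measurable lebesgue" for n
    using borel_measurable_times[OF meas[of n] hm] by simp
  have lim': "AE z in lebesgue. (\<lambda>n. indicator K z *\<^sub>R (a n z * h z)) \<longlonglongrightarrow> indicator K z *\<^sub>R (A z * h z)"
    using lim by eventually_elim (auto simp: indicator_def intro!: tendsto_intros)
  have w: "integrable lebesgue (\<lambda>z. (\<bar>C\<bar> * B) * indicat_real K z)"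
    using K emeasure_compact_finite[OF K]
    by (intro integrable_mult_right integrable_real_indicator) (auto simp: borel_compact)
  have bd': "AE z in lebesgue. norm (indicator K z *\<^sub>R (a n z * h z)) \<le> (\<bar>C\<bar> * B) * indicat_real K z" for n
    using bd[of n]
  proof eventually_elim
    case (elim z)
    have "cmod (a n z) * cmod (h z) \<le> \<bar>C\<bar> * B" if "z \<in> K"
      using elim that B by (intro mult_mono) auto
    then show ?case by (auto simp: indicator_def norm_mult)
  qed
  have mA: "(\<lambda>z. indicator K z *\<^sub>R (A z * h z)) \<in> borel_measurable lebesgue"
    by (rule borel_measurable_AE_LIMSEQ[OF m lim'])
  show "integrable lebesgue (\<lambda>z. indicator K z *\<^sub>R (A z * h z))"
    by (rule integrable_dominated_convergence[OF mA m w lim' bd'])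
  show "(\<lambda>n. (LINT z|lebesgue. indicator K z *\<^sub>R (a n z * h z)))
      \<longlonglongrightarrow> (LINT z|lebesgue. indicator K z *\<^sub>R (A z * h z))"
    by (rule integral_dominated_convergence[OF mA m w lim' bd'])
qed

text \<open>Weak derivatives are stable under locally equi-Lipschitz convergence as soon as the pointwise
  derivatives of the approximants converge almost everywhere.  This is how boundary values of
  derivatives, which exist only almost everywhere, become distributional derivatives.\<close>

theorem distr_derivatives_of_limit:
  assumes U: "open U"
    and loc: "\<And>K. compact K \<Longrightarrow> K \<subseteq> U \<Longrightarrow> \<exists>C N. \<forall>n\<ge>N.
        (\<forall>x\<in>K. \<forall>y\<in>K. cmod (f n x - f n y) \<le> C * cmod (x - y)) \<and>
        (AE z in lebesgue. z \<in> K \<longrightarrow> has_wirtinger (f n) (p n z) (q n z) z)"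
    and lim: "\<And>z. z \<in> U \<Longrightarrow> (\<lambda>n. f n z) \<longlonglongrightarrow> F z"
    and conv: "AE z in lebesgue. z \<in> U \<longrightarrow> (\<lambda>n. p n z) \<longlonglongrightarrow> P z \<and> (\<lambda>n. q n z) \<longlonglongrightarrow> Q z"
  shows "has_distr_dz U F P" "has_distr_dzbar U F Q" "continuous_on U F"
proof -
  have core: "continuous_on K F \<and> set_integrable lebesgue K F \<and> set_integrable lebesgue K P \<and> set_integrable lebesgue K Q \<and>
      (\<forall>\<phi> r s. (\<forall>z. has_wirtinger \<phi> (r z) (s z) z) \<longrightarrow>
        continuous_on UNIV \<phi> \<longrightarrow> continuous_on UNIV r \<longrightarrow> continuous_on UNIV s \<longrightarrow>
        (\<forall>z. z \<notin> K \<longrightarrow> \<phi> z = 0 \<and> r z = 0 \<and> s z = 0) \<longrightarrow>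
        (LINT z|lebesgue. indicator K z *\<^sub>R (F z * r z))
          = - (LINT z|lebesgue. indicator K z *\<^sub>R (P z * \<phi> z)) \<and>
        (LINT z|lebesgue. indicator K z *\<^sub>R (F z * s z))
          = - (LINT z|lebesgue. indicator K z *\<^sub>R (Q z * \<phi> z)))"
    if K: "compact K" "K \<subseteq> U" for K
  proof -
    obtain d where d: "d > 0" "(\<Union>x\<in>K. cball x d) \<subseteq> U"
      using compact_subset_open_imp_cball_epsilon_subset[OF K(1) U K(2)] by blast
    define L where "L = {x + y |x y. x \<in> K \<and> y \<in> cball 0 d}"
    have L: "compact L" unfolding L_def by (intro compact_sums K) auto
    have Lnear: "y \<in> L" if "x \<in> K" "dist x y \<le> d" for x y
      unfolding L_def using that
      by (intro CollectI exI[of _ x] exI[of _ "y - x"]) (auto simp: dist_norm norm_minus_commute)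
    have KL: "K \<subseteq> L" using Lnear d(1) by fastforce
    have LU: "L \<subseteq> U" using d(2) by (fastforce simp: L_def dist_norm)
    obtain C N where CN: "\<And>n. n \<ge> N \<Longrightarrow> (\<forall>x\<in>L. \<forall>y\<in>L. cmod (f n x - f n y) \<le> C * cmod (x - y)) \<and>
        (AE z in lebesgue. z \<in> L \<longrightarrow> has_wirtinger (f n) (p n z) (q n z) z)"
      using loc[OF L LU] by blast
    define g where "g = (\<lambda>n. f (n + N))"
    define a where "a = (\<lambda>n. p (n + N))"
    define b where "b = (\<lambda>n. q (n + N))"
    have lip: "cmod (g n x - g n y) \<le> C * cmod (x - y)" if "x \<in> L" "y \<in> L" for n x y
      using CN[of "n + N"] that by (simp add: g_def)
    have lipC: "cmod (g n x - g n y) \<le> \<bar>C\<bar> * cmod (x - y)" if "x \<in> L" "y \<in> L" for n x y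
      by (rule order_trans[OF lip[OF that] mult_right_mono]) auto
    have der: "AE z in lebesgue. z \<in> K \<longrightarrow> has_wirtinger (g n) (a n z) (b n z) z" for n
    proof -
      have "AE z in lebesgue. z \<in> L \<longrightarrow> has_wirtinger (f (n + N)) (p (n + N) z) (q (n + N) z) z"
        using CN[of "n + N"] by simp
      then show ?thesis unfolding g_def a_def b_def by eventually_elim (use KL in blast)
    qed
    have gF: "(\<lambda>n. g n z) \<longlonglongrightarrow> F z" if "z \<in> L" for z
      unfolding g_def using lim that LU by (intro LIMSEQ_ignore_initial_segment) auto
    have conv': "AE z in lebesgue. z \<in> K \<longrightarrow> (\<lambda>n. a n z) \<longlonglongrightarrow> P z"
         "AE z in lebesgue. z \<in> K \<longrightarrow> (\<lambda>n. b n z) \<longlonglongrightarrow> Q z"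
      unfolding a_def b_def
      by (use conv in eventually_elim, use K(2) in \<open>auto intro!: LIMSEQ_ignore_initial_segment\<close>)+
    have contg: "continuous_on L (g n)" for n
      by (rule lipschitz_on_continuous_on[of "\<bar>C\<bar>"], rule lipschitz_onI)
        (use lipC in \<open>auto simp: dist_norm\<close>)
    have lipF: "cmod (F x - F y) \<le> \<bar>C\<bar> * cmod (x - y)" if "x \<in> L" "y \<in> L" for x y
      by (rule Lim_norm_ubound[OF _ tendsto_diff[OF gF[OF that(1)] gF[OF that(2)]]])
        (use lipC[OF that] in auto)
    have contF: "continuous_on L F"
      by (rule lipschitz_on_continuous_on[of "\<bar>C\<bar>"], rule lipschitz_onI)
        (use lipF in \<open>auto simp: dist_norm\<close>)
    have bound: "\<exists>M. \<forall>n. \<forall>x\<in>K. cmod (g n x) \<le> M"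
    proof (cases "K = {}")
      case False
      then obtain x0 where x0: "x0 \<in> K" by blast
      obtain R where R: "\<And>x. x \<in> K \<Longrightarrow> cmod x \<le> R" using K compact_imp_bounded bounded_iff by metis
      obtain M where M: "\<And>n. cmod (g n x0) \<le> M"
        using convergent_imp_Bseq[of "\<lambda>n. g n x0"] gF[of x0] x0 KL
        by (auto simp: convergent_def Bseq_def)
      have "cmod (g n x) \<le> M + \<bar>C\<bar> * (2 * R)" if x: "x \<in> K" for n x
      proof -
        have "cmod (x - x0) \<le> 2 * R"
          using norm_triangle_ineq4[of x x0] R[OF x] R[OF x0] by linarith
        then have "cmod (g n x - g n x0) \<le> \<bar>C\<bar> * (2 * R)"
          using lipC[of x x0 n] x x0 KL by (meson abs_ge_zero mult_left_mono order_trans subsetD)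
        then show ?thesis using M[of n] norm_triangle_sub[of "g n x" "g n x0"] by linarith
      qed
      then show ?thesis by blast
    qed auto
    then obtain M where M: "\<And>n x. x \<in> K \<Longrightarrow> cmod (g n x) \<le> M" by blast
    have pb: "AE z in lebesgue. z \<in> K \<longrightarrow> cmod (a n z) \<le> C \<and> cmod (b n z) \<le> C" for n
      using der[of n]
    proof eventually_elim
      case (elim z)
      show ?case
      proof
        assume z: "z \<in> K"
        have "cmod (g n x - g n z) \<le> C * cmod (x - z)" if "dist x z \<le> d" for x
          using that z KL Lnear by (intro lip) (auto simp: dist_commute)
        then show "cmod (a n z) \<le> C \<and> cmod (b n z) \<le> C"
          using has_wirtinger_bound[of "g n" "a n z" "b n z" z d C] elim z d(1) by blast
      qed
    qed
    have ab: "AE z in lebesgue. z \<in> K \<longrightarrow> cmod (a n z) \<le> C"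
         "AE z in lebesgue. z \<in> K \<longrightarrow> cmod (b n z) \<le> C" for n
      by (use pb[of n] in eventually_elim, blast)+
    have ma: "(\<lambda>z. indicator K z *\<^sub>R a n z) \<in> borel_measurable lebesgue"
       and mb: "(\<lambda>z. indicator K z *\<^sub>R b n z) \<in> borel_measurable lebesgue" for n
      by (rule measurable_wirtinger[OF K(1) d(1) _ contg der], fact Lnear)+
    have mg: "(\<lambda>z. indicator K z *\<^sub>R g n z) \<in> borel_measurable lebesgue" for n
      using integrable_lebesgue_indicator_continuous[OF K(1) continuous_on_subset[OF contg KL]]
      by (rule borel_measurable_integrable)
    have gb: "AE z in lebesgue. z \<in> K \<longrightarrow> cmod (g n z) \<le> M"
         "AE z in lebesgue. z \<in> K \<longrightarrow> (\<lambda>n. g n z) \<longlonglongrightarrow> F z" for n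
      by (intro AE_I2 impI M gF subsetD[OF KL]; assumption)+
    note limP = integral_limit_on_compact[OF K(1) _ ma ab(1) conv'(1)]
    note limQ = integral_limit_on_compact[OF K(1) _ mb ab(2) conv'(2)]
    note limF = integral_limit_on_compact[OF K(1) _ mg gb]
    have "(LINT z|lebesgue. indicator K z *\<^sub>R (F z * r z))
          = - (LINT z|lebesgue. indicator K z *\<^sub>R (P z * \<phi> z)) \<and>
        (LINT z|lebesgue. indicator K z *\<^sub>R (F z * s z))
          = - (LINT z|lebesgue. indicator K z *\<^sub>R (Q z * \<phi> z))"
      if \<phi>: "\<And>z. has_wirtinger \<phi> (r z) (s z) z"
        and c: "continuous_on UNIV \<phi>" "continuous_on UNIV r" "continuous_on UNIV s"
        and zero: "\<And>z. z \<notin> K \<Longrightarrow> \<phi> z = 0 \<and> r z = 0 \<and> s z = 0" for \<phi> r s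
    proof -
      have ind: "(\<lambda>z. indicator K z *\<^sub>R (u z * \<phi> z)) = (\<lambda>z. u z * \<phi> z)"
         "(\<lambda>z. indicator K z *\<^sub>R (u z * r z)) = (\<lambda>z. u z * r z)"
         "(\<lambda>z. indicator K z *\<^sub>R (u z * s z)) = (\<lambda>z. u z * s z)" for u :: "complex \<Rightarrow> complex"
        by (auto simp: indicator_def fun_eq_iff zero)
      have parts: "(LINT z|lebesgue. g n z * r z) = - (LINT z|lebesgue. a n z * \<phi> z)"
        "(LINT z|lebesgue. g n z * s z) = - (LINT z|lebesgue. b n z * \<phi> z)" for n
        by (rule wirtinger_integration_by_parts[where K = K and d = d and L = L and C = C];
            fact K d L Lnear lip der \<phi> c zero)+
      have "(\<lambda>n. (LINT z|lebesgue. indicator K z *\<^sub>R (g n z * r z)))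
          \<longlonglongrightarrow> - (LINT z|lebesgue. indicator K z *\<^sub>R (P z * \<phi> z))"
        unfolding ind parts(1) using tendsto_minus[OF limP(2)[OF c(1)]] unfolding ind .
      then have 1: "(LINT z|lebesgue. indicator K z *\<^sub>R (F z * r z))
          = - (LINT z|lebesgue. indicator K z *\<^sub>R (P z * \<phi> z))"
        using LIMSEQ_unique[OF limF(2)[OF c(2)]] by blast
      have "(\<lambda>n. (LINT z|lebesgue. indicator K z *\<^sub>R (g n z * s z)))
          \<longlonglongrightarrow> - (LINT z|lebesgue. indicator K z *\<^sub>R (Q z * \<phi> z))"
        unfolding ind parts(2) using tendsto_minus[OF limQ(2)[OF c(1)]] unfolding ind .
      then have 2: "(LINT z|lebesgue. indicator K z *\<^sub>R (F z * s z))
          = - (LINT z|lebesgue. indicator K z *\<^sub>R (Q z * \<phi> z))"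
        using LIMSEQ_unique[OF limF(2)[OF c(3)]] by blast
      show ?thesis using 1 2 by blast
    qed
    moreover have "set_integrable lebesgue K P" "set_integrable lebesgue K Q" "set_integrable lebesgue K F"
      using limP(1)[of "\<lambda>_. 1"] limQ(1)[of "\<lambda>_. 1"] limF(1)[of "\<lambda>_. 1"]
      by (simp_all add: set_integrable_def)
    moreover have "continuous_on K F" using contF KL by (rule continuous_on_subset)
    ultimately show ?thesis by blast
  qed
  have "isCont F z" if "z \<in> U" for z
  proof -
    obtain e where e: "e > 0" "cball z e \<subseteq> U" using U \<open>z \<in> U\<close> open_contains_cball by blast
    have "continuous_on (cball z e) F" by (rule conjunct1[OF core]) (use e in auto)
    then show ?thesis by (rule continuous_on_interior) (use e in auto)
  qed
  then show "continuous_on U F" using U by (simp add: continuous_on_eq_continuous_at)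
  have li: "locally_integrable_on U F" "locally_integrable_on U P" "locally_integrable_on U Q"
    using core unfolding locally_integrable_on_def by blast+
  have test: "(LINT z:U|lebesgue. F z * wirtinger_dz \<phi> z) = - (LINT z:U|lebesgue. P z * \<phi> z) \<and>
       (LINT z:U|lebesgue. F z * wirtinger_dzbar \<phi> z) = - (LINT z:U|lebesgue. Q z * \<phi> z)"
    if tf: "test_function_on U \<phi>" for \<phi>
  proof -
    obtain K where K: "compact K" "K \<subseteq> U"
      and \<phi>: "\<And>z. has_wirtinger \<phi> (wirtinger_dz \<phi> z) (wirtinger_dzbar \<phi> z) z"
        "continuous_on UNIV \<phi>" "continuous_on UNIV (wirtinger_dz \<phi>)" "continuous_on UNIV (wirtinger_dzbar \<phi>)"
      and zero: "\<And>z. z \<notin> K \<Longrightarrow> \<phi> z = 0 \<and> wirtinger_dz \<phi> z = 0 \<and> wirtinger_dzbar \<phi> z = 0"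
      by (rule test_functionE[OF tf], rule that)
    have ind: "(LINT z:U|lebesgue. u z * v z) = (LINT z|lebesgue. indicator K z *\<^sub>R (u z * v z))"
      if "\<And>z. z \<notin> K \<Longrightarrow> v z = 0" for u v :: "complex \<Rightarrow> complex"
      unfolding set_lebesgue_integral_def
      by (rule arg_cong[where f = "integral\<^sup>L lebesgue"])
        (use that K(2) in \<open>auto simp: indicator_def fun_eq_iff\<close>)
    have i: "(LINT z:U|lebesgue. u z * \<phi> z) = (LINT z|lebesgue. indicator K z *\<^sub>R (u z * \<phi> z))"
      "(LINT z:U|lebesgue. u z * wirtinger_dz \<phi> z) = (LINT z|lebesgue. indicator K z *\<^sub>R (u z * wirtinger_dz \<phi> z))"
      "(LINT z:U|lebesgue. u z * wirtinger_dzbar \<phi> z) = (LINT z|lebesgue. indicator K z *\<^sub>R (u z * wirtinger_dzbar \<phi> z))"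
      for u :: "complex \<Rightarrow> complex"
      using zero by (intro ind; blast)+
    show ?thesis unfolding i using core[OF K] \<phi> zero by blast
  qed
  show "has_distr_dz U F P" "has_distr_dzbar U F Q"
    unfolding has_distr_dz_def has_distr_dzbar_def using li test by blast+
qed

section \<open>Local degree of injective maps\<close>

text \<open>As the disc moves through a set on which \<open>f\<close> is injective, the image of its boundary never meets the
  image of its centre, so the motion is a homotopy of loops in the punctured plane.\<close>

lemma winding_number_moving_circle:
  fixes f :: "complex \<Rightarrow> complex" and p :: "real \<Rightarrow> complex" and \<rho> :: "real \<Rightarrow> real"
  assumes f: "continuous_on U f" "inj_on f U"
    and p: "continuous_on {0..1} p" and \<rho>: "continuous_on {0..1} \<rho>"
    and pos: "\<And>s. s \<in> {0..1} \<Longrightarrow> \<rho> s > 0" and sub: "\<And>s. s \<in> {0..1} \<Longrightarrow> cball (p s) (\<rho> s) \<subseteq> U"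
  shows "winding_number (f \<circ> circlepath (p 0) (\<rho> 0)) (f (p 0))
       = winding_number (f \<circ> circlepath (p 1) (\<rho> 1)) (f (p 1))"
proof -
  define E where "E = (\<lambda>t::real. exp (2 * of_real pi * \<i> * of_real t))"
  have E1: "cmod (E t) = 1" for t by (simp add: E_def norm_exp_eq_Re)
  have E01: "E 0 = 1" "E 1 = 1" by (simp_all add: E_def)
  define c where "c = (\<lambda>y. p (fst y) + of_real (\<rho> (fst y)) * E (snd y))"
  define h where "h = (\<lambda>y. f (c y) - f (p (fst y)))"
  have cU: "c (s, t) \<in> U" "p s \<in> U" and cne: "c (s, t) \<noteq> p s" if "s \<in> {0..1}" for s t
  proof -
    have "c (s, t) \<in> cball (p s) (\<rho> s)" "p s \<in> cball (p s) (\<rho> s)"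
      using pos[OF that] by (auto simp: c_def dist_norm norm_mult E1)
    then show "c (s, t) \<in> U" "p s \<in> U" using sub[OF that] by blast+
    have "E t \<noteq> 0" by (simp add: E_def)
    then show "c (s, t) \<noteq> p s" using pos[OF that] by (simp add: c_def)
  qed
  have conts: "continuous_on ({0..1} \<times> {0..1::real}) (\<lambda>y. p (fst y))"
      "continuous_on ({0..1} \<times> {0..1::real}) (\<lambda>y. \<rho> (fst y))"
    by (auto intro!: continuous_on_compose2[OF p] continuous_on_compose2[OF \<rho>] continuous_intros)
  have "continuous_on ({0..1} \<times> {0..1::real}) c"
    unfolding c_def E_def by (intro continuous_intros conts)
  then have conth: "continuous_on ({0..1} \<times> {0..1::real}) h"
    unfolding h_def by (intro continuous_intros continuous_on_compose2[OF f(1)] conts) (use cU in auto)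
  have hne: "h (s, t) \<noteq> 0" if "s \<in> {0..1}" for s t
    using inj_onD[OF f(2) _ cU[OF that]] cne[OF that] by (auto simp: h_def)
  have "homotopic_loops (-{0}) (\<lambda>t. h (0, t)) (\<lambda>t. h (1, t))"
    unfolding homotopic_loops
  proof (rule exI[of _ h], intro conjI ballI)
    show "h \<in> {0..1} \<times> {0..1} \<rightarrow> - {0}" using hne by auto
    show "pathfinish (h \<circ> Pair t) = pathstart (h \<circ> Pair t)" for t
      by (simp add: pathfinish_def pathstart_def h_def c_def E01)
  qed (simp_all add: conth)
  then have "winding_number (\<lambda>t. h (0, t)) 0 = winding_number (\<lambda>t. h (1, t)) 0"
    by (rule winding_number_homotopic_loops)
  moreover have "winding_number (f \<circ> circlepath (p s) (\<rho> s)) (f (p s)) = winding_number (\<lambda>t. h (s, t)) 0" for s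
    by (subst winding_number_offset) (simp add: h_def c_def E_def circlepath)
  ultimately show ?thesis by simp
qed

lemma winding_number_injective_constant:
  fixes f :: "complex \<Rightarrow> complex"
  assumes U: "open U" "connected U" and f: "continuous_on U f" "inj_on f U"
    and y: "0 < r" "cball y r \<subseteq> U" and z: "0 < s" "cball z s \<subseteq> U"
  shows "winding_number (f \<circ> circlepath y r) (f y) = winding_number (f \<circ> circlepath z s) (f z)"
proof -
  let ?w = "\<lambda>y r. winding_number (f \<circ> circlepath y r) (f y)"
  have "y \<in> U" "z \<in> U" using y z by auto
  then obtain p where p: "path p" "path_image p \<subseteq> U" "pathstart p = y" "pathfinish p = z"
    using connected_open_path_connected[OF U] unfolding path_connected_def by blast
  then obtain d where d: "d > 0" "(\<Union>x\<in>path_image p. cball x d) \<subseteq> U"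
    using compact_subset_open_imp_cball_epsilon_subset[OF compact_path_image[OF p(1)] U(1)] by blast
  have shrink: "?w a b = ?w a c" if "0 < c" "c \<le> b" "cball a b \<subseteq> U" for a b c
  proof -
    have le: "(1 - t) * b + t * c \<le> b" if "t \<in> {0..1}" for t
      using mult_left_mono[OF \<open>c \<le> b\<close>, of t] that by (simp add: algebra_simps)
    have pos: "(1 - t) * b + t * c > 0" if t: "t \<in> {0..1}" for t
    proof -
      have "c \<le> (1 - t) * b + t * c"
        using mult_left_mono[OF \<open>c \<le> b\<close>, of "1 - t"] t by (simp add: algebra_simps)
      then show ?thesis using \<open>0 < c\<close> by linarith
    qed
    have "cball a ((1 - t) * b + t * c) \<subseteq> U" if "t \<in> {0..1}" for t
      using le[OF that] subset_cball[of "(1 - t) * b + t * c" b a] \<open>cball a b \<subseteq> U\<close> by blast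
    from winding_number_moving_circle[OF f, of "\<lambda>_. a" "\<lambda>t. (1 - t) * b + t * c", OF _ _ pos this]
    show ?thesis by (simp add: continuous_intros)
  qed
  define e where "e = min d (min r s)"
  have e: "0 < e" "e \<le> d" "e \<le> r" "e \<le> s" using d y z by (auto simp: e_def)
  have "cball (p t) e \<subseteq> U" if "t \<in> {0..1}" for t
  proof -
    have "cball (p t) e \<subseteq> cball (p t) d" using e by (intro subset_cball)
    then show ?thesis using d(2) that unfolding path_image_def by blast
  qed
  from winding_number_moving_circle[OF f, of p "\<lambda>_. e", OF _ _ _ this]
  have "?w (p 0) e = ?w (p 1) e" using p(1) e(1) by (simp add: path_def)
  then have "?w y e = ?w z e" using p by (simp add: pathstart_def pathfinish_def)
  then show ?thesis using shrink[OF e(1,3) y(2)] shrink[OF e(1,4) z(2)] by simp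
qed

lemma winding_number_scaled_circle:
  assumes "c \<noteq> 0" "r > 0"
  shows "winding_number (\<lambda>t. c * circlepath 0 r t) 0 = 1"
proof -
  define h where "h = (\<lambda>y. exp (of_real (1 - fst y) * Ln c) * circlepath 0 r (snd y))"
  have "homotopic_loops (-{0}) (\<lambda>t. c * circlepath 0 r t) (circlepath 0 r)"
    unfolding homotopic_loops
  proof (rule exI[of _ h], intro conjI ballI)
    show "continuous_on ({0..1} \<times> {0..1}) h"
      unfolding h_def circlepath by (intro continuous_intros)
  qed (use assms in \<open>auto simp: h_def circlepath pathfinish_def pathstart_def\<close>)
  then have "winding_number (\<lambda>t. c * circlepath 0 r t) 0 = winding_number (circlepath 0 r) 0"
    by (rule winding_number_homotopic_loops)
  then show ?thesis using assms by (simp add: winding_number_circlepath_centre)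
qed

text \<open>On a small circle \<open>f\<close> is so close to its linear part \<open>h \<mapsto> c h\<close> that the straight homotopy between
  the two image curves avoids the image of the centre.\<close>

lemma winding_number_at_conformal_point:
  assumes f: "continuous_on U f" "open U" "z \<in> U" and der: "(f has_field_derivative c) (at z)" "c \<noteq> 0"
  obtains r where "r > 0" "cball z r \<subseteq> U" "winding_number (f \<circ> circlepath z r) (f z) = 1"
proof -
  obtain R where R: "R > 0" "cball z R \<subseteq> U" using f open_contains_cball by blast
  have "((\<lambda>w. (f w - f z) / (w - z)) \<longlongrightarrow> c) (at z)"
    using der by (simp add: has_field_derivative_iff)
  then have "\<forall>\<^sub>F w in at z. dist ((f w - f z) / (w - z)) c < cmod c"
    using der(2) by (intro tendstoD) auto
  then obtain d where d: "d > 0" "\<And>w. w \<noteq> z \<Longrightarrow> dist w z < d \<Longrightarrow> dist ((f w - f z) / (w - z)) c < cmod c"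
    unfolding eventually_at by blast
  define r where "r = min R (d / 2)"
  have r: "r > 0" "r \<le> R" "r < d" using R d by (auto simp: r_def)
  have sub: "cball z r \<subseteq> U" using R(2) subset_cball[OF r(2), of z] by blast
  define g where "g = (\<lambda>t. c * circlepath 0 r t)"
  define h where "h = (\<lambda>t. f (circlepath z r t) - f z)"
  have im: "circlepath z r t \<in> cball z r" "circlepath z r t = z + circlepath 0 r t"
    "cmod (circlepath 0 r t) = r" for t
    using r(1) by (auto simp: circlepath dist_norm norm_mult norm_exp_eq_Re)
  have "winding_number h 0 = winding_number g 0"
  proof (rule winding_number_nearby_loops_eq)
    have "path (circlepath 0 r)" by simp
    then show "path g" unfolding g_def path_def by (intro continuous_intros)
    have "path (circlepath z r)" by simp
    then show "path h" unfolding h_def path_def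
      by (intro continuous_intros continuous_on_compose2[OF f(1)]) (use im sub in auto)
    show "pathfinish g = pathstart g" "pathfinish h = pathstart h"
      by (simp_all add: g_def h_def circlepath pathfinish_def pathstart_def)
    fix t :: real assume "t \<in> {0..1}"
    define x where "x = circlepath 0 r t"
    have x: "x \<noteq> 0" "cmod x = r" using im(3)[of t] r(1) by (auto simp: x_def)
    have "dist ((f (z + x) - f z) / x) c < cmod c" using d(2)[of "z + x"] x r(3) by (simp add: dist_norm)
    moreover have "(f (z + x) - f z) / x - c = (f (z + x) - f z - c * x) / x" using x by (simp add: field_simps)
    ultimately have "cmod (f (z + x) - f z - c * x) < cmod (c * x)"
      using x r(1) by (simp add: dist_norm norm_divide norm_mult divide_less_eq)
    then show "cmod (h t - g t) < cmod (g t - 0)" by (simp add: h_def g_def im(2)[of t] x_def)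
  qed
  also have "\<dots> = 1" unfolding g_def by (rule winding_number_scaled_circle[OF der(2) r(1)])
  finally have "winding_number (f \<circ> circlepath z r) (f z) = 1"
    by (subst winding_number_offset) (simp add: h_def o_def)
  then show ?thesis using that r(1) sub by blast
qed

theorem orientation_preserving_if_conformal_somewhere:
  fixes f :: "complex \<Rightarrow> complex"
  assumes U: "open U" "connected U" and f: "continuous_on U f" "inj_on f U"
    and z: "z \<in> U" "(f has_field_derivative c) (at z)" "c \<noteq> 0"
  shows "orientation_preserving_on U f"
proof -
  obtain r where r: "r > 0" "cball z r \<subseteq> U" "winding_number (f \<circ> circlepath z r) (f z) = 1"
    using winding_number_at_conformal_point[OF f(1) U(1) z] by blast
  show ?thesis
    unfolding orientation_preserving_on_def
  proof (intro allI impI)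
    fix y s assume "0 < s \<and> cball y s \<subseteq> U"
    then show "winding_number (f \<circ> circlepath y s) (f y) = 1"
      using winding_number_injective_constant[OF U f _ _ r(1,2), of s y] r(3) by simp
  qed
qed

section \<open>Homeomorphisms of the plane extended to the sphere\<close>

lemma continuous_map_sphere:
  fixes f :: "complex \<Rightarrow> complex"
  assumes cont: "continuous_on UNIV f" and proper: "\<And>C. compact C \<Longrightarrow> compact (f -` C)"
  shows "continuous_map riemann_sphere riemann_sphere (map_option f)"
  unfolding continuous_map
proof (intro conjI allI impI)
  fix V :: "complex option set" assume "openin riemann_sphere V"
  then consider W where "open W" "V = Some ` W" | C where "compact C" "V = insert None (Some ` (- C))"
    unfolding openin_Alexandroff_compactification by (auto simp: Compl_eq_Diff_UNIV)
  then show "openin riemann_sphere {x \<in> topspace riemann_sphere. map_option f x \<in> V}"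
  proof cases
    case 1
    then have "{x \<in> topspace riemann_sphere. map_option f x \<in> V} = Some ` (f -` W)"
      by (auto simp: image_iff elim!: option.exhaust)
    moreover have "open (f -` W)" using 1 cont by (intro open_vimage)
    ultimately show ?thesis by (auto simp: openin_Alexandroff_compactification)
  next
    case 2
    have "{x \<in> topspace riemann_sphere. map_option f x \<in> V} = insert None (Some ` (- (f -` C)))"
      using 2 by auto
    moreover have "compact (f -` C)" using 2 proper by blast
    ultimately show ?thesis
      unfolding openin_Alexandroff_compactification
      by (intro disjI2 exI[of _ "f -` C"]) (auto simp: compact_imp_closed)
  qed
qed auto

lemma homeomorphic_map_sphere:
  fixes f :: "complex \<Rightarrow> complex"
  assumes f: "continuous_on UNIV f" "bij f"
  shows "homeomorphic_map riemann_sphere riemann_sphere (map_option f)"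
proof -
  let ?g = "inv f"
  have fg: "f (?g x) = x" "?g (f x) = x" for x
    using f(2) by (simp_all add: bij_def surj_f_inv_f)
  have "continuous_on (f ` UNIV) ?g"
    by (rule continuous_on_inverse_open) (use f fg in \<open>auto simp: bij_def\<close>)
  then have g: "continuous_on UNIV ?g" using f(2) by (simp add: bij_def)
  have im: "f -` C = ?g ` C" "?g -` C = f ` C" for C by (auto simp: fg image_iff) (metis fg)+
  have "continuous_map riemann_sphere riemann_sphere (map_option f)"
    "continuous_map riemann_sphere riemann_sphere (map_option ?g)"
    by (auto intro!: continuous_map_sphere compact_continuous_image continuous_on_subset[OF f(1)]
        continuous_on_subset[OF g] simp: im)
  then have "homeomorphic_maps riemann_sphere riemann_sphere (map_option f) (map_option ?g)"
    unfolding homeomorphic_maps_def by (auto simp: fg)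
  then show ?thesis by (rule homeomorphic_maps_imp_map)
qed

section \<open>Radial limits of bounded holomorphic functions along a sequence of radii\<close>

abbreviation circle_measure :: "real measure" where
  "circle_measure \<equiv> lebesgue_on {0..2*pi}"

lemma integrable_circle:
  fixes f :: "real \<Rightarrow> 'a::euclidean_space"
  assumes "continuous_on UNIV f" shows "integrable circle_measure f"
  by (intro continuous_imp_integrable_real continuous_on_subset[OF assms]) auto

lemma integral_cis_multiple:
  fixes k :: int
  shows "(LINT t|circle_measure. cis (of_int k * t)) = (if k = 0 then 2 * pi else 0)"
proof -
  have "(LINT t|circle_measure. cis (of_int k * t)) = integral {0..2*pi} (\<lambda>t. cis (of_int k * t))"
    by (intro lebesgue_integral_eq_integral integrable_circle) (auto intro!: continuous_intros)
  also have "((\<lambda>t. cis (of_int k * t)) has_integral (if k = 0 then 2 * pi else 0)) {0..2*pi}"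
  proof (cases "k = 0")
    case True
    then show ?thesis using has_integral_const_real[of "1::complex" 0 "2*pi"]
      by (simp add: scaleR_conv_of_real)
  next
    case False
    define F where "F = (\<lambda>t::real. - \<i> / of_int k * cis (of_int k * t))"
    have "((\<lambda>t. cis (of_int k * t)) has_integral (F (2*pi) - F 0)) {0..2*pi}"
    proof (rule fundamental_theorem_of_calculus)
      fix t :: real
      have "((\<lambda>z. - \<i> / of_int k * exp (\<i> * of_int k * z)) has_field_derivative exp (\<i> * of_int k * of_real t))
          (at (of_real t))"
        using False by (auto intro!: derivative_eq_intros)
      then have "((\<lambda>x. - \<i> / of_int k * exp (\<i> * of_int k * of_real x)) has_vector_derivative
          exp (\<i> * of_int k * of_real t)) (at t within {0..2*pi})"
        by (rule has_vector_derivative_real_field)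
      moreover have "exp (\<i> * of_int k * of_real x) = cis (of_int k * x)" for x
        by (simp add: cis_conv_exp mult.assoc)
      ultimately show "(F has_vector_derivative cis (of_int k * t)) (at t within {0..2*pi})"
        by (simp add: F_def)
    qed simp
    moreover have "cis (of_int k * (2*pi)) = 1"
      using cis_multiple_2pi[of "of_int k"] by (simp add: mult_ac)
    ultimately show ?thesis using False by (simp add: F_def)
  qed
  then have "integral {0..2*pi} (\<lambda>t. cis (of_int k * t)) = (if k = 0 then 2 * pi else 0)"
    by (rule integral_unique)
  finally show ?thesis .
qed

lemma Parseval_polynomial:
  fixes c :: "nat \<Rightarrow> complex"
  shows "(LINT t|circle_measure. (cmod (\<Sum>m<N. c m * cis t ^ m))\<^sup>2)
    = 2 * pi * (\<Sum>m<N. (cmod (c m))\<^sup>2)"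
proof -
  define S where "S = (\<lambda>t. \<Sum>m<N. c m * cis t ^ m)"
  have sq: "of_real ((cmod (S t))\<^sup>2) = (\<Sum>m<N. \<Sum>l<N. c m * cnj (c l) * cis (of_int (int m - int l) * t))" for t
  proof -
    have "of_real ((cmod (S t))\<^sup>2) = S t * cnj (S t)" by (rule complex_norm_square)
    also have "\<dots> = (\<Sum>m<N. \<Sum>l<N. (c m * cis t ^ m) * cnj (c l * cis t ^ l))"
      by (simp add: S_def sum_product)
    also have "\<dots> = (\<Sum>m<N. \<Sum>l<N. c m * cnj (c l) * cis (of_int (int m - int l) * t))"
      by (intro sum.cong refl)
        (simp add: Complex.DeMoivre cis_cnj cis_mult algebra_simps)
    finally show ?thesis .
  qed
  have int: "integrable circle_measure (\<lambda>t. a * cis (of_int k * t))" for a and k :: int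
    by (intro integrable_circle continuous_intros)
  have "complex_of_real ((LINT t|circle_measure. (cmod (S t))\<^sup>2))
      = (LINT t|circle_measure. of_real ((cmod (S t))\<^sup>2))"
    by (rule integral_complex_of_real[symmetric])
  also have "\<dots> = (\<Sum>m<N. (LINT t|circle_measure. (\<Sum>l<N. c m * cnj (c l) * cis (of_int (int m - int l) * t))))"
    unfolding sq by (rule Bochner_Integration.integral_sum) (intro Bochner_Integration.integrable_sum int)
  also have "\<dots> = (\<Sum>m<N. \<Sum>l<N. (LINT t|circle_measure. c m * cnj (c l) * cis (of_int (int m - int l) * t)))"
    by (intro sum.cong refl Bochner_Integration.integral_sum int)
  also have "\<dots> = (\<Sum>m<N. \<Sum>l<N. c m * cnj (c l) * (if int m - int l = 0 then 2 * pi else 0))"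
    by (simp only: integral_mult_right_zero integral_cis_multiple)
  also have "\<dots> = (\<Sum>m<N. \<Sum>l<N. if m = l then c m * cnj (c m) * (2 * pi) else 0)"
    by (intro sum.cong refl) auto
  also have "\<dots> = (\<Sum>m<N. c m * cnj (c m) * (2 * pi))" by simp
  also have "\<dots> = of_real (2 * pi * (\<Sum>m<N. (cmod (c m))\<^sup>2))"
    by (simp add: complex_norm_square[symmetric] sum_distrib_left mult_ac del: of_real_power
        flip: of_real_mult of_real_sum)
  finally show ?thesis unfolding S_def by (simp only: of_real_eq_iff)
qed

lemma power_diff_square_le:
  fixes r s :: real
  assumes "0 \<le> r" "r \<le> s"
  shows "(s ^ m - r ^ m)\<^sup>2 \<le> (s ^ m)\<^sup>2 - (r ^ m)\<^sup>2"
proof -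
  have "0 \<le> r ^ m" "r ^ m \<le> s ^ m" using assms by (auto intro: power_mono)
  then have "r ^ m * r ^ m \<le> r ^ m * s ^ m" by (intro mult_left_mono)
  then show ?thesis by (simp add: power2_eq_square algebra_simps)
qed

text \<open>By Parseval the mean squares over circles increase with the radius, and their increments
  dominate the mean square distance between the function on two circles.\<close>

lemma mean_square_distance_le:
  assumes hol: "f holomorphic_on ball 0 1" and rs: "0 \<le> r" "r \<le> s" "s < 1"
  shows "(LINT t|circle_measure. (cmod (f (of_real s * cis t) - f (of_real r * cis t)))\<^sup>2)
    \<le> (LINT t|circle_measure. (cmod (f (of_real s * cis t)))\<^sup>2)
      - (LINT t|circle_measure. (cmod (f (of_real r * cis t)))\<^sup>2)"
proof -
  define a where "a = (\<lambda>m. (deriv ^^ m) f 0 / fact m)"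
  have sums: "(\<lambda>m. a m * z ^ m) sums f z" if "cmod z < 1" for z
    using holomorphic_power_series[OF hol, of z] that by (simp add: a_def)
  define B where "B = (\<Sum>m. cmod (a m * of_real s ^ m))"
  have summ: "summable (\<lambda>m. cmod (a m * of_real s ^ m))"
  proof -
    obtain \<rho> where \<rho>: "s < \<rho>" "\<rho> < 1" using dense rs by blast
    then have "summable (\<lambda>m. a m * of_real \<rho> ^ m)"
      using sums[of "of_real \<rho>"] rs by (intro sums_summable[of _ "f (of_real \<rho>)"]) auto
    then show ?thesis using rs \<rho> by (intro powser_insidea[of a "of_real \<rho>"]) auto
  qed
  define P where "P = (\<lambda>N z. \<Sum>m<N. a m * z ^ m)"
  have Pb: "cmod (P N (of_real x * cis t)) \<le> B" if "0 \<le> x" "x \<le> s" for N x t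
  proof -
    have "cmod (P N (of_real x * cis t)) \<le> (\<Sum>m<N. cmod (a m * (of_real x * cis t) ^ m))"
      unfolding P_def by (rule norm_sum)
    also have "\<dots> \<le> (\<Sum>m<N. cmod (a m * of_real s ^ m))"
      using that by (intro sum_mono) (auto simp: norm_mult norm_power intro!: mult_left_mono power_mono)
    also have "\<dots> \<le> B" unfolding B_def by (intro sum_le_suminf summ) auto
    finally show ?thesis .
  qed
  have Pl: "(\<lambda>N. P N (of_real x * cis t)) \<longlonglongrightarrow> f (of_real x * cis t)" if "0 \<le> x" "x \<le> s" for x t
    using sums[of "of_real x * cis t"] that rs unfolding P_def sums_def by (simp add: norm_mult)
  have B0: "B \<ge> 0" unfolding B_def by (intro suminf_nonneg summ) auto
  have lim: "(\<lambda>N. (LINT t|circle_measure. (cmod (x N t))\<^sup>2)) \<longlonglongrightarrow> (LINT t|circle_measure. (cmod (y t))\<^sup>2)"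
    if x: "\<And>N. continuous_on UNIV (x N)" "\<And>N t. cmod (x N t) \<le> 2 * B" and y: "continuous_on UNIV y"
      and xy: "\<And>t. (\<lambda>N. x N t) \<longlonglongrightarrow> y t" for x :: "nat \<Rightarrow> real \<Rightarrow> complex" and y
  proof (rule integral_dominated_convergence[where w = "\<lambda>_. (2 * B)\<^sup>2"])
    show "(\<lambda>t. (cmod (y t))\<^sup>2) \<in> borel_measurable circle_measure"
      "\<And>N. (\<lambda>t. (cmod (x N t))\<^sup>2) \<in> borel_measurable circle_measure"
      by (intro borel_measurable_integrable integrable_circle continuous_intros x y)+
    show "integrable circle_measure (\<lambda>_. (2 * B)\<^sup>2)" by (intro integrable_circle continuous_intros)
    show "AE t in circle_measure. (\<lambda>N. (cmod (x N t))\<^sup>2) \<longlonglongrightarrow> (cmod (y t))\<^sup>2"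
      by (intro AE_I2 tendsto_intros xy)
    show "AE t in circle_measure. norm ((cmod (x N t))\<^sup>2) \<le> (2 * B)\<^sup>2" for N
    proof (rule AE_I2)
      fix t show "norm ((cmod (x N t))\<^sup>2) \<le> (2 * B)\<^sup>2"
        using power_mono[OF x(2)[of N t] norm_ge_zero, of 2] by simp
    qed
  qed
  have contP: "continuous_on UNIV (\<lambda>t. P N (of_real x * cis t))" for N x
    unfolding P_def by (intro continuous_intros)
  have contf: "continuous_on UNIV (\<lambda>t. f (of_real x * cis t))" if "0 \<le> x" "x \<le> s" for x
    using that rs
    by (intro continuous_on_compose2[OF holomorphic_on_imp_continuous_on[OF hol]] continuous_intros)
      (auto simp: norm_mult)
  have Pb2: "cmod (P N (of_real x * cis t)) \<le> 2 * B" if "0 \<le> x" "x \<le> s" for N x t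
    using Pb[OF that, of N t] B0 by linarith
  have Pd: "cmod (P N (of_real s * cis t) - P N (of_real r * cis t)) \<le> 2 * B" for N t
    using norm_triangle_ineq4[of "P N (of_real s * cis t)" "P N (of_real r * cis t)"]
      Pb[of s N t] Pb[of r N t] rs by linarith
  have s': "0 \<le> s" "s \<le> s" and r': "0 \<le> r" "r \<le> s" using rs by auto
  have l1: "(\<lambda>N. (LINT t|circle_measure. (cmod (P N (of_real s * cis t) - P N (of_real r * cis t)))\<^sup>2))
     \<longlonglongrightarrow> (LINT t|circle_measure. (cmod (f (of_real s * cis t) - f (of_real r * cis t)))\<^sup>2)"
    by (rule lim) (intro continuous_intros contP contf s' r' Pd tendsto_intros Pl)+
  have l2: "(\<lambda>N. (LINT t|circle_measure. (cmod (P N (of_real s * cis t)))\<^sup>2))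
     \<longlonglongrightarrow> (LINT t|circle_measure. (cmod (f (of_real s * cis t)))\<^sup>2)"
    by (rule lim) (intro contP contf s' Pb2 Pl)+
  have l3: "(\<lambda>N. (LINT t|circle_measure. (cmod (P N (of_real r * cis t)))\<^sup>2))
     \<longlonglongrightarrow> (LINT t|circle_measure. (cmod (f (of_real r * cis t)))\<^sup>2)"
    by (rule lim) (intro contP contf r' Pb2 Pl)+
  have poly: "(LINT t|circle_measure. (cmod (P N (of_real s * cis t) - P N (of_real r * cis t)))\<^sup>2)
    \<le> (LINT t|circle_measure. (cmod (P N (of_real s * cis t)))\<^sup>2)
      - (LINT t|circle_measure. (cmod (P N (of_real r * cis t)))\<^sup>2)" for N
  proof -
    have 1: "P N (of_real x * cis t) = (\<Sum>m<N. (a m * of_real (x ^ m)) * cis t ^ m)" for x t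
      by (simp add: P_def power_mult_distrib mult.assoc)
    have 2: "P N (of_real s * cis t) - P N (of_real r * cis t) = (\<Sum>m<N. (a m * of_real (s ^ m - r ^ m)) * cis t ^ m)" for t
      unfolding 1 by (simp add: sum_subtractf[symmetric] algebra_simps)
    have "(\<Sum>m<N. (cmod (a m * of_real (s ^ m - r ^ m)))\<^sup>2)
        \<le> (\<Sum>m<N. (cmod (a m * of_real (s ^ m)))\<^sup>2 - (cmod (a m * of_real (r ^ m)))\<^sup>2)"
    proof (rule sum_mono)
      fix m
      have "(cmod (a m))\<^sup>2 * (s ^ m - r ^ m)\<^sup>2 \<le> (cmod (a m))\<^sup>2 * ((s ^ m)\<^sup>2 - (r ^ m)\<^sup>2)"
        by (intro mult_left_mono power_diff_square_le rs) auto
      then show "(cmod (a m * of_real (s ^ m - r ^ m)))\<^sup>2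
          \<le> (cmod (a m * of_real (s ^ m)))\<^sup>2 - (cmod (a m * of_real (r ^ m)))\<^sup>2"
        by (simp only: norm_mult norm_of_real power_mult_distrib power2_abs right_diff_distrib)
    qed
    then have "2 * pi * (\<Sum>m<N. (cmod (a m * of_real (s ^ m - r ^ m)))\<^sup>2)
        \<le> 2 * pi * (\<Sum>m<N. (cmod (a m * of_real (s ^ m)))\<^sup>2) - 2 * pi * (\<Sum>m<N. (cmod (a m * of_real (r ^ m)))\<^sup>2)"
      unfolding right_diff_distrib[symmetric] sum_subtractf[symmetric] by (intro mult_left_mono) auto
    then show ?thesis unfolding 2 unfolding 1 Parseval_polynomial .
  qed
  show ?thesis by (rule LIMSEQ_le[OF l1 tendsto_diff[OF l2 l3]]) (use poly in blast)
qed

lemma radii_with_small_increments: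
  fixes J :: "real \<Rightarrow> real"
  assumes mono: "\<And>r s. 0 \<le> r \<Longrightarrow> r \<le> s \<Longrightarrow> s < 1 \<Longrightarrow> J r \<le> J s" and bd: "\<And>r. 0 \<le> r \<Longrightarrow> r < 1 \<Longrightarrow> J r \<le> C"
  obtains r :: "nat \<Rightarrow> real" where "\<And>n. 0 < r n \<and> r n < 1" "r \<longlonglongrightarrow> 1"
    "\<And>n. \<bar>J (r (Suc n)) - J (r n)\<bar> \<le> (1/8) ^ n"
proof -
  define S where "S = Sup (J ` {0..<1})"
  have bdd: "bdd_above (J ` {0..<1})" by (rule bdd_aboveI[of _ C]) (use bd in auto)
  have "\<exists>R\<in>{0..<1}. S - (1/8) ^ n < J R" for n
    using less_cSupE[of "S - (1/8) ^ n" "J ` {0..<1}"] by (force simp: S_def)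
  then obtain R where R: "\<And>n. R n \<in> {0..<1}" "\<And>n. S - (1/8) ^ n < J (R n)" by metis
  define r where "r = (\<lambda>n. max (R n) (1 - 1 / real (Suc (Suc n))))"
  have r: "0 < r n" "r n < 1" for n
  proof -
    have "1 / real (Suc (Suc n)) < 1" by simp
    then show "0 < r n" by (simp add: r_def less_max_iff_disj)
    show "r n < 1" using R(1)[of n] by (simp add: r_def)
  qed
  have lower: "S - (1/8) ^ n < J (r n)" for n
    using mono[of "R n" "r n"] R(1)[of n] R(2)[of n] r[of n] by (force simp: r_def)
  have upper: "J (r n) \<le> S" for n
    unfolding S_def by (intro cSup_upper bdd) (use r[of n] in auto)
  have "(\<lambda>n. 1 - 1 / real (Suc (Suc n))) \<longlonglongrightarrow> 1 - 0"
    by (intro tendsto_intros LIMSEQ_Suc[of "\<lambda>n. 1 / real (Suc n)"] LIMSEQ_Suc lim_1_over_n)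
  then have l: "(\<lambda>n. 1 - 1 / real (Suc (Suc n))) \<longlonglongrightarrow> 1" by simp
  have lim: "r \<longlonglongrightarrow> 1"
  proof (rule tendsto_sandwich[OF _ _ l tendsto_const])
    show "\<forall>\<^sub>F n in sequentially. 1 - 1 / real (Suc (Suc n)) \<le> r n" by (simp add: r_def)
    show "\<forall>\<^sub>F n in sequentially. r n \<le> 1" using r(2) by (simp add: less_imp_le)
  qed
  have "\<bar>J (r (Suc n)) - J (r n)\<bar> \<le> (1/8) ^ n" for n
  proof -
    have "(1/8::real) ^ Suc n \<le> (1/8) ^ n" by simp
    then show ?thesis using lower[of n] lower[of "Suc n"] upper[of n] upper[of "Suc n"] by linarith
  qed
  then show ?thesis using that r lim by blast
qed

lemma convergent_if_increments_summable:
  fixes x :: "nat \<Rightarrow> complex"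
  assumes "summable (\<lambda>n. 4 ^ n * (cmod (x (Suc n) - x n))\<^sup>2)"
  shows "convergent x"
proof -
  have "\<forall>\<^sub>F n in sequentially. 4 ^ n * (cmod (x (Suc n) - x n))\<^sup>2 < 1"
    using order_tendstoD(2)[OF summable_LIMSEQ_zero[OF assms], of 1] by simp
  then have "\<forall>\<^sub>F n in sequentially. norm (x (Suc n) - x n) \<le> (1/2) ^ n"
  proof eventually_elim
    case (elim n)
    have "(2 ^ n * cmod (x (Suc n) - x n))\<^sup>2 < 1"
      using elim by (simp add: power_mult_distrib power_mult[symmetric] mult.commute[of n] power_mult)
    then have "2 ^ n * cmod (x (Suc n) - x n) < 1"
      by (simp add: power2_less_1_iff)
    then show ?case by (simp add: field_simps)
  qed
  then have "summable (\<lambda>n. x (Suc n) - x n)"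
    by (rule summable_comparison_test_ev) simp
  then have "convergent (\<lambda>n. x n - x 0)"
    by (simp add: summable_iff_convergent sum_lessThan_telescope)
  then obtain L where "(\<lambda>n. x n - x 0) \<longlonglongrightarrow> L" by (auto simp: convergent_def)
  from tendsto_add[OF this tendsto_const[of "x 0"]] show ?thesis by (auto intro: convergentI)
qed

text \<open>The mean squares \<open>J\<close> are bounded and increasing in the radius, so radii can be chosen along which
  \<open>J\<close> moves by at most \<open>8\<close> to the power \<open>-n\<close> in step \<open>n\<close>. Then the squared increments of \<open>f\<close>, weighted by \<open>4\<close>
  to the power \<open>n\<close>, have a summable sequence of integrals; their sum is finite almost everywhere, where
  the increments themselves are eventually below \<open>2\<close> to the power \<open>-n\<close>.\<close>

lemma radial_limit_ae_circle:
  assumes hol: "f holomorphic_on ball 0 1" and bd: "\<And>z. z \<in> ball 0 1 \<Longrightarrow> cmod (f z) \<le> C"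
  obtains r :: "nat \<Rightarrow> real" where "\<And>n. 0 < r n \<and> r n < 1" "r \<longlonglongrightarrow> 1"
    "AE t in circle_measure. convergent (\<lambda>n. f (of_real (r n) * cis t))"
proof -
  define J where "J = (\<lambda>r. (LINT t|circle_measure. (cmod (f (of_real r * cis t)))\<^sup>2))"
  have cont: "continuous_on UNIV (\<lambda>t. f (of_real r * cis t))" if "0 \<le> r" "r < 1" for r
    using that
    by (intro continuous_on_compose2[OF holomorphic_on_imp_continuous_on[OF hol]] continuous_intros)
      (auto simp: norm_mult)
  have J: "(LINT t|circle_measure. (cmod (f (of_real s * cis t) - f (of_real r * cis t)))\<^sup>2) \<le> J s - J r"
    if "0 \<le> r" "r \<le> s" "s < 1" for r s
    unfolding J_def by (rule mean_square_distance_le[OF hol that])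
  have nn: "0 \<le> (LINT t|circle_measure. (cmod (f (of_real s * cis t) - f (of_real r * cis t)))\<^sup>2)" for r s
    by (rule Bochner_Integration.integral_nonneg) simp
  have mono: "J r \<le> J s" if "0 \<le> r" "r \<le> s" "s < 1" for r s
    using J[OF that] nn[of s r] by linarith
  have Jb: "J r \<le> (LINT _|circle_measure. C\<^sup>2)" if "0 \<le> r" "r < 1" for r
    unfolding J_def
  proof (rule Bochner_Integration.integral_mono)
    show "integrable circle_measure (\<lambda>t. (cmod (f (of_real r * cis t)))\<^sup>2)"
      by (intro integrable_circle continuous_intros cont that)
    show "integrable circle_measure (\<lambda>_. C\<^sup>2)" by (intro integrable_circle continuous_intros)
    show "(cmod (f (of_real r * cis t)))\<^sup>2 \<le> C\<^sup>2" for t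
      using that by (intro power_mono bd) (auto simp: norm_mult)
  qed
  obtain r where r: "\<And>n. 0 < r n \<and> r n < 1" "r \<longlonglongrightarrow> 1" "\<And>n. \<bar>J (r (Suc n)) - J (r n)\<bar> \<le> (1/8) ^ n"
  proof (rule radii_with_small_increments[of J])
    show "\<And>r s. 0 \<le> r \<Longrightarrow> r \<le> s \<Longrightarrow> s < 1 \<Longrightarrow> J r \<le> J s" by (rule mono)
    show "\<And>r. 0 \<le> r \<Longrightarrow> r < 1 \<Longrightarrow> J r \<le> (LINT _|circle_measure. C\<^sup>2)" by (rule Jb)
  qed (rule that)
  define x where "x = (\<lambda>n t. f (of_real (r n) * cis t))"
  define d where "d = (\<lambda>n t. 4 ^ n * (cmod (x (Suc n) t - x n t))\<^sup>2)"
  have contx: "continuous_on UNIV (x n)" for n unfolding x_def using r(1)[of n] by (intro cont) auto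
  have contd: "continuous_on UNIV (d n)" for n unfolding d_def by (intro continuous_intros contx)
  have intx: "(LINT t|circle_measure. (cmod (x (Suc n) t - x n t))\<^sup>2) \<le> (1/8) ^ n" for n
  proof (cases "r n \<le> r (Suc n)")
    case True
    then show ?thesis using J[of "r n" "r (Suc n)"] r(1)[of n] r(1)[of "Suc n"] r(3)[of n] by (simp add: x_def)
  next
    case False
    then show ?thesis using J[of "r (Suc n)" "r n"] r(1)[of n] r(1)[of "Suc n"] r(3)[of n]
      by (simp add: x_def norm_minus_commute)
  qed
  have intd: "integral\<^sup>N circle_measure (\<lambda>t. ennreal (d n t)) \<le> ennreal ((1/2) ^ n)" for n
  proof -
    have "integral\<^sup>L circle_measure (d n) = 4 ^ n * (LINT t|circle_measure. (cmod (x (Suc n) t - x n t))\<^sup>2)"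
      unfolding d_def by simp
    also have "\<dots> \<le> 4 ^ n * (1/8) ^ n" by (intro mult_left_mono intx) simp
    also have "\<dots> = (1/2) ^ n" by (simp flip: power_mult_distrib)
    finally have "integral\<^sup>L circle_measure (d n) \<le> (1/2) ^ n" .
    moreover have "integral\<^sup>N circle_measure (\<lambda>t. ennreal (d n t)) = ennreal (integral\<^sup>L circle_measure (d n))"
      by (intro nn_integral_eq_integral integrable_circle contd) (simp add: d_def)
    ultimately show ?thesis by (simp add: ennreal_leI)
  qed
  have md: "(\<lambda>t. ennreal (d n t)) \<in> borel_measurable circle_measure" for n
    using borel_measurable_integrable[OF integrable_circle[OF contd[of n]]] by simp
  have "integral\<^sup>N circle_measure (\<lambda>t. \<Sum>n. ennreal (d n t)) = (\<Sum>n. integral\<^sup>N circle_measure (\<lambda>t. ennreal (d n t)))"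
    by (rule nn_integral_suminf[OF md])
  also have "\<dots> \<le> (\<Sum>n. ennreal ((1/2) ^ n))" by (intro suminf_le intd) auto
  also have "\<dots> = ennreal (\<Sum>n. (1/2) ^ n)" by (intro suminf_ennreal2) auto
  also have "\<dots> < \<infinity>" by simp
  finally have "AE t in circle_measure. (\<Sum>n. ennreal (d n t)) \<noteq> \<infinity>"
    using borel_measurable_integrable[OF integrable_circle[OF contd]]
    by (intro nn_integral_PInf_AE) (measurable, auto)
  then have "AE t in circle_measure. convergent (\<lambda>n. x n t)"
  proof eventually_elim
    case (elim t)
    have "summable (\<lambda>n. d n t)"
      by (rule summable_suminf_not_top) (use elim in \<open>auto simp: d_def\<close>)
    then show ?case unfolding d_def by (rule convergent_if_increments_summable)
  qed
  then show ?thesis using that r unfolding x_def by blast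
qed

text \<open>Every point with direction \<open>t/2\<close> modulo \<open>pi\<close> has \<open>z / cnj z = cis t\<close>, so a null set of angles
  \<open>t\<close> corresponds to a null union of lines through the origin.\<close>

lemma AE_double_angle:
  assumes "AE t in circle_measure. P (cis t)"
  shows "AE z in lebesgue. P (z / cnj z)"
proof -
  have "AE t in lebesgue. t \<in> {0..2*pi} \<longrightarrow> P (cis t)"
    using assms by (subst (asm) AE_restrict_space_iff) auto
  then have "AE t in lborel. t \<in> {0..2*pi} \<longrightarrow> P (cis t)" by (simp add: AE_completion_iff)
  then obtain N where N: "N \<in> null_sets lborel" "{t. \<not> (t \<in> {0..2*pi} \<longrightarrow> P (cis t))} \<subseteq> N"
    by (auto elim!: AE_E simp: null_sets_def)
  have "N \<times> (UNIV :: real set) \<in> null_sets (lborel \<Otimes>\<^sub>M lborel)"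
    by (rule lborel.times_in_null_sets1) (use N in auto)
  then have "N \<times> (UNIV :: real set) \<in> null_sets lborel" by (simp add: lborel_prod)
  then have neg: "negligible (N \<times> (UNIV :: real set))"
    by (simp add: negligible_iff_null_sets null_sets_completionI)
  define \<Phi> where "\<Phi> = (\<lambda>y::real \<times> real. of_real (snd y) * exp (\<i> * of_real (fst y) / 2))"
  have "\<Phi> differentiable_on (N \<times> UNIV)"
    unfolding differentiable_on_def differentiable_def
  proof (intro ballI exI)
    fix y :: "real \<times> real"
    have 1: "((\<lambda>y. of_real (snd y)) has_derivative (\<lambda>h. complex_of_real (snd h))) (at y within N \<times> UNIV)"
      "((\<lambda>y. \<i> * of_real (fst y) / 2) has_derivative (\<lambda>h. \<i> * complex_of_real (fst h) / 2)) (at y within N \<times> UNIV)"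
      by (auto intro!: derivative_eq_intros)
    show "(\<Phi> has_derivative (\<lambda>h. of_real (snd y) * (exp (\<i> * of_real (fst y) / 2) * (\<i> * complex_of_real (fst h) / 2))
        + of_real (snd h) * exp (\<i> * of_real (fst y) / 2))) (at y within N \<times> UNIV)"
      unfolding \<Phi>_def
      by (intro has_derivative_mult 1 has_derivative_compose[OF 1(2) DERIV_exp[unfolded has_field_derivative_def]])
  qed
  then have "negligible (\<Phi> ` (N \<times> UNIV))"
    by (intro negligible_differentiable_image_negligible[OF _ neg]) auto
  then have null: "insert 0 (\<Phi> ` (N \<times> UNIV)) \<in> null_sets lebesgue"
    by (simp add: negligible_iff_null_sets[symmetric])
  show ?thesis
  proof (rule AE_I'[OF null], clarify)
    fix z assume z: "\<not> P (z / cnj z)" "z \<notin> \<Phi> ` (N \<times> UNIV)"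
    show "z = 0"
    proof (rule ccontr)
      assume "z \<noteq> 0"
      define t where "t = Arg2pi (z / cnj z)"
      have "cmod (z / cnj z) = 1" using \<open>z \<noteq> 0\<close> by (simp add: norm_divide)
      then have t: "cis t = z / cnj z" "t \<in> {0..2*pi}"
        using complex_norm_eq_1_exp[of "z / cnj z"] Arg2pi[of "z / cnj z"]
        by (auto simp: t_def cis_conv_exp)
      define e where "e = exp (\<i> * of_real t / 2)"
      have e: "e * e = cis t" "cmod e = 1" "e \<noteq> 0" by (simp_all add: e_def cis_conv_exp flip: exp_add)
      have ce: "e * cnj e = 1" using complex_norm_square[of e] e(2) by simp
      have zt: "e * e * cnj z = z" using t(1) \<open>z \<noteq> 0\<close> unfolding e(1) by simp
      have "z * cnj e = cnj z * e * (e * cnj e)" by (subst (1) zt[symmetric]) (simp only: mult_ac)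
      then have "z * cnj e = cnj z * e" unfolding ce by simp
      then have "cnj (z / e) = z / e" using e(3) by (simp add: field_simps)
      then have "z / e \<in> \<real>" by (simp add: Reals_cnj_iff)
      then have "of_real (Re (z / e)) = z / e" by (rule of_real_Re)
      then have "z = of_real (Re (z / e)) * e" using e(3) by simp
      then have "z = \<Phi> (t, Re (z / e))" by (simp add: \<Phi>_def e_def)
      moreover have "t \<in> N" using N(2) t z(1) by auto
      ultimately show False using z(2) by blast
    qed
  qed
qed

section \<open>From approximation in the plane to quasiconformality on the sphere\<close>

lemma has_wirtinger_postcompose:
  assumes "has_wirtinger f p q z" "(g has_field_derivative c) (at (f z))"
  shows "has_wirtinger (\<lambda>z. g (f z)) (c * p) (c * q) z"
proof -
  have "((\<lambda>z. g (f z)) has_derivative (\<lambda>h. c * (p * h + q * cnj h))) (at z)"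
    using assms unfolding has_wirtinger_def has_field_derivative_def
    by (rule has_derivative_compose)
  then show ?thesis unfolding has_wirtinger_def by (simp add: algebra_simps)
qed

lemma has_wirtinger_precompose:
  assumes "has_wirtinger f p q (g z)" "(g has_field_derivative c) (at z)"
  shows "has_wirtinger (\<lambda>z. f (g z)) (p * c) (q * cnj c) z"
proof -
  have "((\<lambda>z. f (g z)) has_derivative (\<lambda>h. p * (c * h) + q * cnj (c * h))) (at z)"
    using assms(2,1) unfolding has_wirtinger_def has_field_derivative_def
    by (rule has_derivative_compose)
  then show ?thesis unfolding has_wirtinger_def by (simp add: algebra_simps)
qed

lemma has_wirtinger_transform:
  assumes "has_wirtinger f p q z" "open S" "z \<in> S" "\<And>x. x \<in> S \<Longrightarrow> f x = g x"
  shows "has_wirtinger g p q z"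
  using assms(1) unfolding has_wirtinger_def
  by (rule has_derivative_transform_within_open[OF _ assms(2,3)]) (rule assms(4))

lemma has_field_derivative_reciprocal: "z \<noteq> 0 \<Longrightarrow> ((\<lambda>z. 1 / z) has_field_derivative - (1 / z\<^sup>2)) (at (z::complex))"
  by (auto intro!: derivative_eq_intros simp: power2_eq_square field_simps)

lemma AE_pullback:
  fixes g h :: "complex \<Rightarrow> complex"
  assumes AE: "AE z in lebesgue. P z" and S: "negligible S" and h: "h differentiable_on T"
    and g: "\<And>z. z \<notin> S \<Longrightarrow> g z \<in> T \<and> h (g z) = z"
  shows "AE z in lebesgue. P (g z)"
proof -
  obtain N where N: "N \<in> null_sets lebesgue" "{z. \<not> P z} \<subseteq> N"
  proof (rule AE_E[OF AE])
    fix N assume "{z \<in> space lebesgue. \<not> P z} \<subseteq> N" "emeasure lebesgue N = 0" "N \<in> sets lebesgue"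
    then show ?thesis by (intro that[of N] null_setsI) auto
  qed
  have "negligible (N \<inter> T)"
    using N(1) negligible_subset[of N "N \<inter> T"] by (simp add: negligible_iff_null_sets)
  then have "negligible (h ` (N \<inter> T))"
    by (rule negligible_differentiable_image_negligible[OF order_refl])
      (rule differentiable_on_subset[OF h Int_lower2])
  then have null: "S \<union> h ` (N \<inter> T) \<in> null_sets lebesgue"
    using S by (simp add: negligible_iff_null_sets[symmetric])
  show ?thesis
  proof (rule AE_I'[OF null], rule subsetI)
    fix z assume "z \<in> {z \<in> space lebesgue. \<not> P (g z)}"
    then have "g z \<in> N" using N(2) by auto
    then show "z \<in> S \<union> h ` (N \<inter> T)" using g[of z] by (cases "z \<in> S") (auto intro: rev_image_eqI)
  qed
qed

lemma AE_reciprocal: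
  assumes "AE z in lebesgue. P z"
  shows "AE z in lebesgue. P (1 / z :: complex)"
proof (rule AE_pullback[OF assms, where S = "{0}" and T = "- {0}" and h = "\<lambda>z. 1 / z"])
  show "(\<lambda>z::complex. 1 / z) differentiable_on - {0}"
    unfolding differentiable_on_def
  proof
    fix z :: complex assume "z \<in> - {0}"
    then have "((\<lambda>z. 1 / z) has_derivative (*) (- (1 / z\<^sup>2))) (at z)"
      using has_field_derivative_reciprocal[of z] unfolding has_field_derivative_def by blast
    then show "(\<lambda>z. 1 / z) differentiable (at z within - {0})"
      using differentiableI differentiable_at_withinI by blast
  qed
qed auto

lemma AE_shift:
  assumes "AE z in lebesgue. P (z :: complex)"
  shows "AE z in lebesgue. P (z + a)"
  by (rule AE_pullback[OF assms, where S = "{}" and T = UNIV and h = "\<lambda>z. z - a"]) auto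

lemma chart_inf_props:
  "range chart_inf = UNIV - {Some 0}" "inj chart_inf" "chart_inf z = None \<longleftrightarrow> z = 0"
  "z \<noteq> 0 \<Longrightarrow> chart_inf z = Some (1 / z)" "w \<noteq> 0 \<Longrightarrow> inv chart_inf (Some w) = 1 / w" "inv chart_inf None = 0"
proof -
  show inj: "inj chart_inf" by (rule injI) (auto simp: chart_inf_def split: if_splits)
  have 1: "chart_inf 0 = None" "w \<noteq> 0 \<Longrightarrow> chart_inf (1 / w) = Some w" for w by (auto simp: chart_inf_def)
  show "inv chart_inf None = 0" using inv_f_f[OF inj, of 0] by (simp add: 1)
  show "w \<noteq> 0 \<Longrightarrow> inv chart_inf (Some w) = 1 / w" using inv_f_f[OF inj, of "1 / w"] by (simp add: 1)
  show "range chart_inf = UNIV - {Some 0}"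
  proof (intro equalityI subsetI)
    fix x :: "complex option" assume "x \<in> UNIV - {Some 0}"
    show "x \<in> range chart_inf"
    proof (cases x)
      case None
      then show ?thesis using rangeI[of chart_inf 0] 1(1) by simp
    next
      case (Some w)
      then have "w \<noteq> 0" using \<open>x \<in> UNIV - {Some 0}\<close> by auto
      from 1(2)[OF this] show ?thesis unfolding Some by (metis rangeI)
    qed
  qed (auto simp: chart_inf_def split: if_splits)
qed (auto simp: chart_inf_def)

lemma inv_Some [simp]: "inv Some (Some x) = x"
  by (rule inv_f_f) simp

lemma chart_doms:
  fixes f :: "complex \<Rightarrow> complex"
  shows "chart_dom Some Some (map_option f) = UNIV"
    and "chart_dom Some chart_inf (map_option f) = {z. f z \<noteq> 0}"
    and "chart_dom chart_inf Some (map_option f) = {z. z \<noteq> 0}"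
    and "chart_dom chart_inf chart_inf (map_option f) = {z. z = 0 \<or> f (1 / z) \<noteq> 0}"
proof -
  have "x \<in> range Some \<longleftrightarrow> x \<noteq> None" for x :: "complex option" by (cases x) auto
  then show "chart_dom Some Some (map_option f) = UNIV"
    and "chart_dom Some chart_inf (map_option f) = {z. f z \<noteq> 0}"
    and "chart_dom chart_inf Some (map_option f) = {z. z \<noteq> 0}"
    and "chart_dom chart_inf chart_inf (map_option f) = {z. z = 0 \<or> f (1 / z) \<noteq> 0}"
    unfolding chart_dom_def chart_inf_props(1) by (auto simp: chart_inf_def)
qed

lemma chart_exprs:
  fixes f :: "complex \<Rightarrow> complex"
  shows "chart_expr Some Some (map_option f) z = f z"
    and "f z \<noteq> 0 \<Longrightarrow> chart_expr Some chart_inf (map_option f) z = 1 / f z"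
    and "z \<noteq> 0 \<Longrightarrow> chart_expr chart_inf Some (map_option f) z = f (1 / z)"
    and "z = 0 \<or> f (1 / z) \<noteq> 0 \<Longrightarrow>
      chart_expr chart_inf chart_inf (map_option f) z = (if z = 0 then 0 else 1 / f (1 / z))"
  by (auto simp: chart_expr_def chart_inf_props chart_inf_def)

lemma chart_dom_open_connected:
  fixes f :: "complex \<Rightarrow> complex"
  assumes cont: "continuous_on UNIV f" and bij: "bij f"
    and ab: "a \<in> sphere_charts" "b \<in> sphere_charts"
  shows "open (chart_dom a b (map_option f))" "connected (chart_dom a b (map_option f))"
proof -
  have "inj f" "surj f" using bij by (auto simp: bij_def)
  obtain w where w: "f w = 0" using surjD[OF \<open>surj f\<close>, of 0] by auto
  have fz: "f z = 0 \<longleftrightarrow> z = w" for z using inj_eq[OF \<open>inj f\<close>, of z w] w by simp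
  have dom: "chart_dom a b (map_option f) = UNIV \<or> (\<exists>c. chart_dom a b (map_option f) = - {c})"
  proof -
    have e1: "{z. f z \<noteq> 0} = - {w}" using fz by auto
    have e2: "{z. z = 0 \<or> f (1 / z) \<noteq> 0} = (if w = 0 then UNIV else - {1 / w})"
      unfolding fz by (auto simp: field_simps)
    have e3: "{z::complex. z \<noteq> 0} = - {0}" by auto
    consider "a = Some" "b = Some" | "a = Some" "b = chart_inf" | "a = chart_inf" "b = Some"
      | "a = chart_inf" "b = chart_inf" using ab unfolding sphere_charts_def by blast
    then show ?thesis
    proof cases
      case 1
      then show ?thesis by (simp only: chart_doms) blast
    next
      case 2
      then show ?thesis by (simp only: chart_doms e1) blast
    next
      case 3
      then show ?thesis by (simp only: chart_doms e3) blast
    next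
      case 4
      then show ?thesis by (simp only: chart_doms e2 split: if_split) blast
    qed
  qed
  have "open S \<and> connected S" if S: "S = UNIV \<or> (\<exists>c. S = - {c})" for S :: "complex set"
    using S
  proof (elim disjE exE)
    fix c assume c: "S = - {c}"
    have "open (- {c})" "connected (- {c})"
      by (rule open_Compl, simp, rule connected_punctured_universe, simp)
    then show ?thesis unfolding c by blast
  qed (simp add: connected_UNIV)
  from this[OF dom] show "open (chart_dom a b (map_option f))" "connected (chart_dom a b (map_option f))"
    by blast+
qed

lemma reciprocal_diff_le:
  fixes a b :: complex
  assumes "\<delta> > 0" "cmod a \<ge> \<delta>" "cmod b \<ge> \<delta>"
  shows "cmod (1 / a - 1 / b) \<le> cmod (a - b) / \<delta>\<^sup>2"
proof -
  have ne: "a \<noteq> 0" "b \<noteq> 0" using assms by auto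
  have "1 / a - 1 / b = (b - a) / (a * b)" using ne by (simp add: field_simps)
  then have "cmod (1 / a - 1 / b) = cmod (a - b) / (cmod a * cmod b)"
    by (simp add: norm_divide norm_mult norm_minus_commute)
  also have "\<dots> \<le> cmod (a - b) / \<delta>\<^sup>2"
    unfolding power2_eq_square using assms ne
    by (intro divide_left_mono mult_mono mult_pos_pos) auto
  finally show ?thesis .
qed

lemma compact_nonzero_bounded_below:
  fixes m :: "complex \<Rightarrow> complex"
  assumes "compact K" "continuous_on K m" "\<And>z. z \<in> K \<Longrightarrow> m z \<noteq> 0"
  obtains \<delta> where "\<delta> > 0" "\<And>z. z \<in> K \<Longrightarrow> 2 * \<delta> \<le> cmod (m z)"
proof (cases "K = {}")
  case False
  obtain x where x: "x \<in> K" "\<And>z. z \<in> K \<Longrightarrow> cmod (m x) \<le> cmod (m z)"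
    using continuous_attains_inf[OF assms(1) False continuous_on_norm[OF assms(2)]] by blast
  show ?thesis by (rule that[of "cmod (m x) / 2"]) (use x assms(3) in auto)
qed (use that[of 1] in auto)

abbreviation weak_Beltrami :: "real \<Rightarrow> complex set \<Rightarrow> (complex \<Rightarrow> complex) \<Rightarrow> bool" where
  "weak_Beltrami k U g \<equiv> \<exists>p q. has_distr_dz U g p \<and> has_distr_dzbar U g q \<and>
     (AE z in lebesgue. z \<in> U \<longrightarrow> cmod (q z) \<le> k * cmod (p z))"

text \<open>Data from which quasiconformality on the sphere follows. The maps \<open>F n\<close> approximate \<open>f\<close> and have
  derivatives \<open>p n\<close>, \<open>q n\<close> that converge almost everywhere to \<open>P\<close>, \<open>Q\<close>. Boundedness of \<open>f z - z\<close>
  controls the charts at infinity, and the half-plane on which \<open>f\<close> is a translation supplies a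
  conformal point in each chart.\<close>

locale plane_qc_approximation =
  fixes f :: "complex \<Rightarrow> complex" and F p q :: "nat \<Rightarrow> complex \<Rightarrow> complex" and P Q :: "complex \<Rightarrow> complex"
    and D M k :: real and c :: complex
  assumes lip: "\<And>n x y. cmod (F n x - F n y) \<le> D * cmod (x - y)"
    and unif: "\<And>e. e > 0 \<Longrightarrow> \<forall>\<^sub>F n in sequentially. \<forall>z. cmod (F n z - f z) \<le> e"
    and near_id: "\<And>z. cmod (f z - z) \<le> M"
    and der: "\<And>n. AE z in lebesgue. has_wirtinger (F n) (p n z) (q n z) z"
    and conv: "AE z in lebesgue. (\<lambda>n. p n z) \<longlonglongrightarrow> P z \<and> (\<lambda>n. q n z) \<longlonglongrightarrow> Q z"
    and bound: "AE z in lebesgue. cmod (Q z) \<le> k * cmod (P z)"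
    and bij: "bij f"
    and left: "\<And>w. Re w < -1 \<Longrightarrow> f w = w + c"
begin

lemma lim: "(\<lambda>n. F n z) \<longlonglongrightarrow> f z"
proof (rule LIMSEQ_I)
  fix e :: real assume "e > 0"
  then have "\<forall>\<^sub>F n in sequentially. \<forall>z. cmod (F n z - f z) \<le> e / 2" by (intro unif) simp
  then have "\<forall>\<^sub>F n in sequentially. cmod (F n z - f z) < e"
  proof eventually_elim
    case (elim n)
    from elim[rule_format, of z] \<open>e > 0\<close> show ?case by linarith
  qed
  then show "\<exists>N. \<forall>n\<ge>N. cmod (F n z - f z) < e" by (simp add: eventually_sequentially)
qed

lemma D_nonneg: "D \<ge> 0"
  using order_trans[OF norm_ge_zero lip[of 0 1 0]] by simp

lemma lip_f: "cmod (f x - f y) \<le> D * cmod (x - y)"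
  by (rule Lim_norm_ubound[OF _ tendsto_diff[OF lim lim]]) (use lip in auto)

lemma cont_f: "continuous_on S f"
proof -
  have "D-lipschitz_on S f" using lip_f D_nonneg by (intro lipschitz_onI) (auto simp: dist_norm)
  then show ?thesis by (rule lipschitz_on_continuous_on)
qed

lemma weak_derivative_plane:
  "has_distr_dz UNIV f P" "has_distr_dzbar UNIV f Q" "continuous_on UNIV f"
proof -
  have loc: "\<exists>C N. \<forall>n\<ge>N. (\<forall>x\<in>K. \<forall>y\<in>K. cmod (F n x - F n y) \<le> C * cmod (x - y)) \<and>
        (AE z in lebesgue. z \<in> K \<longrightarrow> has_wirtinger (F n) (p n z) (q n z) z)" for K
    by (intro exI[of _ D] exI[of _ 0] allI impI conjI ballI lip eventually_mono[OF der]) simp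
  have cv: "AE z in lebesgue. z \<in> UNIV \<longrightarrow> (\<lambda>n. p n z) \<longlonglongrightarrow> P z \<and> (\<lambda>n. q n z) \<longlonglongrightarrow> Q z"
    using conv by simp
  show "has_distr_dz UNIV f P" "has_distr_dzbar UNIV f Q" "continuous_on UNIV f"
    using distr_derivatives_of_limit[OF open_UNIV loc lim cv] by simp_all
qed

lemma weak_derivative_target_inf:
  defines "U \<equiv> {z. f z \<noteq> 0}"
  assumes g: "\<And>z. z \<in> U \<Longrightarrow> g z = 1 / f z"
  shows "weak_Beltrami k U g" "continuous_on U g"
proof -
  have U: "open U" unfolding U_def by (intro open_Collect_neq cont_f continuous_intros)
  define coef where "coef = (\<lambda>w. - (1 / (w::complex)\<^sup>2))"
  have loc: "\<exists>C N. \<forall>n\<ge>N. (\<forall>x\<in>K. \<forall>y\<in>K. cmod (1 / F n x - 1 / F n y) \<le> C * cmod (x - y)) \<and>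
        (AE z in lebesgue. z \<in> K \<longrightarrow> has_wirtinger (\<lambda>z. 1 / F n z) (coef (F n z) * p n z) (coef (F n z) * q n z) z)"
    if K: "compact K" "K \<subseteq> U" for K
  proof -
    obtain \<delta> where \<delta>: "\<delta> > 0" "\<And>z. z \<in> K \<Longrightarrow> 2 * \<delta> \<le> cmod (f z)"
      by (rule compact_nonzero_bounded_below[OF K(1) cont_f]) (use K(2) in \<open>auto simp: U_def\<close>)
    obtain N where N: "\<And>n z. n \<ge> N \<Longrightarrow> cmod (F n z - f z) \<le> \<delta>"
      using unif[OF \<delta>(1)] by (auto simp: eventually_sequentially)
    have big: "\<delta> \<le> cmod (F n z)" if "n \<ge> N" "z \<in> K" for n z
      using N[OF that(1), of z] \<delta>(2)[OF that(2)] norm_triangle_sub[of "f z" "F n z"]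
      by (simp add: norm_minus_commute)
    have "cmod (1 / F n x - 1 / F n y) \<le> D / \<delta>\<^sup>2 * cmod (x - y)" if "n \<ge> N" "x \<in> K" "y \<in> K" for n x y
      using reciprocal_diff_le[OF \<delta>(1) big[OF that(1,2)] big[OF that(1,3)]]
        divide_right_mono[OF lip[of n x y], of "\<delta>\<^sup>2"] by simp
    moreover have "AE z in lebesgue. z \<in> K \<longrightarrow>
        has_wirtinger (\<lambda>z. 1 / F n z) (coef (F n z) * p n z) (coef (F n z) * q n z) z" if n: "n \<ge> N" for n
      using der[of n]
    proof eventually_elim
      case (elim z)
      show ?case
      proof
        assume "z \<in> K"
        then have "F n z \<noteq> 0" using big[OF n] \<delta>(1) by fastforce
        then show "has_wirtinger (\<lambda>z. 1 / F n z) (coef (F n z) * p n z) (coef (F n z) * q n z) z"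
          using has_wirtinger_postcompose[where g = "\<lambda>z. 1 / z", OF elim has_field_derivative_reciprocal] by (simp add: coef_def)
      qed
    qed
    ultimately show ?thesis by blast
  qed
  have l: "(\<lambda>n. 1 / F n z) \<longlonglongrightarrow> g z" if "z \<in> U" for z
    using that lim[of z] unfolding g[OF that] by (intro tendsto_intros) (auto simp: U_def)
  have cv: "AE z in lebesgue. z \<in> U \<longrightarrow> (\<lambda>n. coef (F n z) * p n z) \<longlonglongrightarrow> coef (f z) * P z \<and>
      (\<lambda>n. coef (F n z) * q n z) \<longlonglongrightarrow> coef (f z) * Q z"
    using conv
  proof eventually_elim
    case (elim z)
    then show ?case using lim[of z] unfolding coef_def by (auto simp: U_def intro!: tendsto_intros)
  qed
  note w = distr_derivatives_of_limit[OF U loc l cv, simplified]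
  have "AE z in lebesgue. z \<in> U \<longrightarrow> cmod (coef (f z) * Q z) \<le> k * cmod (coef (f z) * P z)"
    using bound
  proof eventually_elim
    case (elim z)
    show ?case using mult_left_mono[OF elim norm_ge_zero, of "coef (f z)"] by (simp add: norm_mult mult_ac)
  qed
  then show "weak_Beltrami k U g" "continuous_on U g"
    using w by blast+
qed

lemma weak_derivative_source_inf:
  defines "U \<equiv> {z::complex. z \<noteq> 0}"
  assumes g: "\<And>z. z \<in> U \<Longrightarrow> g z = f (1 / z)"
  shows "weak_Beltrami k U g" "continuous_on U g"
proof -
  have U: "open U" unfolding U_def by (intro open_Collect_neq continuous_intros)
  define coef where "coef = (\<lambda>w. - (1 / (w::complex)\<^sup>2))"
  have loc: "\<exists>C N. \<forall>n\<ge>N. (\<forall>x\<in>K. \<forall>y\<in>K. cmod (F n (1 / x) - F n (1 / y)) \<le> C * cmod (x - y)) \<and>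
        (AE z in lebesgue. z \<in> K \<longrightarrow> has_wirtinger (\<lambda>z. F n (1 / z)) (p n (1 / z) * coef z) (q n (1 / z) * cnj (coef z)) z)"
    if K: "compact K" "K \<subseteq> U" for K
  proof -
    obtain \<delta> where \<delta>: "\<delta> > 0" "\<And>z. z \<in> K \<Longrightarrow> 2 * \<delta> \<le> cmod z"
      by (rule compact_nonzero_bounded_below[OF K(1) continuous_on_id]) (use K(2) in \<open>auto simp: U_def\<close>)
    have "cmod (F n (1 / x) - F n (1 / y)) \<le> D / \<delta>\<^sup>2 * cmod (x - y)" if "x \<in> K" "y \<in> K" for n x y
    proof -
      have "\<delta> \<le> cmod x" "\<delta> \<le> cmod y" using \<delta>(1) \<delta>(2)[OF that(1)] \<delta>(2)[OF that(2)] by linarith+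
      then have "D * cmod (1 / x - 1 / y) \<le> D * (cmod (x - y) / \<delta>\<^sup>2)"
        using \<delta>(1) by (intro mult_left_mono reciprocal_diff_le D_nonneg)
      then show ?thesis using lip[of n "1 / x" "1 / y"] by simp
    qed
    moreover have "AE z in lebesgue. z \<in> K \<longrightarrow>
        has_wirtinger (\<lambda>z. F n (1 / z)) (p n (1 / z) * coef z) (q n (1 / z) * cnj (coef z)) z" for n
      using AE_reciprocal[OF der[of n]]
    proof eventually_elim
      case (elim z)
      show ?case
      proof
        assume "z \<in> K"
        then have "z \<noteq> 0" using K(2) by (auto simp: U_def)
        then show "has_wirtinger (\<lambda>z. F n (1 / z)) (p n (1 / z) * coef z) (q n (1 / z) * cnj (coef z)) z"
          unfolding coef_def by (intro has_wirtinger_precompose[where g = "\<lambda>z. 1 / z", OF elim] has_field_derivative_reciprocal)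
      qed
    qed
    ultimately show ?thesis by blast
  qed
  have l: "(\<lambda>n. F n (1 / z)) \<longlonglongrightarrow> g z" if "z \<in> U" for z
    using lim[of "1 / z"] unfolding g[OF that] .
  have cv: "AE z in lebesgue. z \<in> U \<longrightarrow> (\<lambda>n. p n (1 / z) * coef z) \<longlonglongrightarrow> P (1 / z) * coef z \<and>
      (\<lambda>n. q n (1 / z) * cnj (coef z)) \<longlonglongrightarrow> Q (1 / z) * cnj (coef z)"
    using AE_reciprocal[OF conv] by eventually_elim (auto intro!: tendsto_intros)
  note w = distr_derivatives_of_limit[OF U loc l cv, simplified]
  have "AE z in lebesgue. z \<in> U \<longrightarrow> cmod (Q (1 / z) * cnj (coef z)) \<le> k * cmod (P (1 / z) * coef z)"
    using AE_reciprocal[OF bound]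
  proof eventually_elim
    case (elim z)
    show ?case using mult_left_mono[OF elim norm_ge_zero, of "coef z"] by (simp add: norm_mult mult_ac)
  qed
  then show "weak_Beltrami k U g" "continuous_on U g"
    using w by blast+
qed
end

context plane_qc_approximation
begin

text \<open>Near the pair of points at infinity the quantity \<open>z f(1/z)\<close> stays close to \<open>1\<close>, which makes
  \<open>1/f(1/z)\<close> Lipschitz there uniformly along the approximation.\<close>

lemma weak_derivative_both_inf:
  defines "U \<equiv> {z. z = 0 \<or> f (1 / z) \<noteq> 0}"
  assumes U: "open U" and g: "\<And>z. z \<in> U \<Longrightarrow> g z = (if z = 0 then 0 else 1 / f (1 / z))"
  shows "weak_Beltrami k U g" "continuous_on U g"
proof -
  define coef where "coef = (\<lambda>w. - (1 / (w::complex)\<^sup>2))"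
  define G where "G = (\<lambda>n z. if z = 0 then 0 else 1 / F n (1 / z))"
  define pG where "pG = (\<lambda>n z. coef (F n (1 / z)) * (p n (1 / z) * coef z))"
  define qG where "qG = (\<lambda>n z. coef (F n (1 / z)) * (q n (1 / z) * cnj (coef z)))"
  define m where "m = (\<lambda>z. if z = 0 then 1 else z * f (1 / z))"
  have m_cont: "isCont m z" for z
  proof (cases "z = 0")
    case True
    have "((\<lambda>z. m z - 1) \<longlongrightarrow> 0) (at 0)"
    proof (rule Lim_null_comparison)
      show "\<forall>\<^sub>F z in at 0. cmod (m z - 1) \<le> M * cmod z"
        unfolding eventually_at
      proof (intro exI[of _ 1] conjI ballI impI)
        fix z :: complex assume "z \<noteq> 0 \<and> dist z 0 < 1"
        then have "m z - 1 = z * (f (1 / z) - 1 / z)" by (simp add: m_def algebra_simps)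
        then show "cmod (m z - 1) \<le> M * cmod z"
          using mult_left_mono[OF near_id[of "1 / z"] norm_ge_zero[of z]] by (simp add: norm_mult mult.commute)
      qed simp
      show "((\<lambda>z. M * cmod z) \<longlongrightarrow> 0) (at 0)" by (auto intro!: tendsto_eq_intros)
    qed
    then show ?thesis using True by (simp add: isCont_def LIM_zero_iff m_def)
  next
    case False
    have "continuous_on (- {0}) (\<lambda>z. z * f (1 / z))"
      by (intro continuous_on_mult continuous_on_id continuous_on_compose2[OF cont_f[of UNIV]]
          continuous_on_divide continuous_on_const) auto
    then have "isCont (\<lambda>z. z * f (1 / z)) z"
      using False by (simp add: continuous_on_eq_continuous_at open_Compl)
    moreover have "\<forall>\<^sub>F w in nhds z. m w = w * f (1 / w)"
      using t1_space_nhds[OF False] by (rule eventually_mono) (simp add: m_def)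
    ultimately show ?thesis by (simp add: isCont_cong)
  qed
  have loc: "\<exists>C N. \<forall>n\<ge>N. (\<forall>x\<in>K. \<forall>y\<in>K. cmod (G n x - G n y) \<le> C * cmod (x - y)) \<and>
        (AE z in lebesgue. z \<in> K \<longrightarrow> has_wirtinger (G n) (pG n z) (qG n z) z)"
    if K: "compact K" "K \<subseteq> U" for K
  proof -
    have "continuous_on K m" using m_cont by (simp add: continuous_at_imp_continuous_on)
    then obtain \<delta> where \<delta>: "\<delta> > 0" "\<And>z. z \<in> K \<Longrightarrow> 2 * \<delta> \<le> cmod (m z)"
      by (rule compact_nonzero_bounded_below[OF K(1)]) (use K(2) in \<open>auto simp: U_def m_def\<close>)
    obtain R where R: "R > 0" "\<And>z. z \<in> K \<Longrightarrow> cmod z \<le> R"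
      using compact_imp_bounded[OF K(1)] bounded_pos by blast
    obtain N where N: "\<And>n z. n \<ge> N \<Longrightarrow> cmod (F n z - f z) \<le> \<delta> / R"
      using unif[of "\<delta> / R"] \<delta>(1) R(1) by (auto simp: eventually_sequentially)
    have big: "\<delta> \<le> cmod (z * F n (1 / z))" if "n \<ge> N" "z \<in> K" "z \<noteq> 0" for n z
    proof -
      have "cmod (z * f (1 / z) - z * F n (1 / z)) = cmod z * cmod (F n (1 / z) - f (1 / z))"
        by (simp add: norm_mult norm_minus_commute flip: right_diff_distrib)
      also have "\<dots> \<le> R * (\<delta> / R)" using R N[OF that(1)] that by (intro mult_mono) auto
      also have "\<dots> = \<delta>" using R by simp
      finally show ?thesis
        using \<delta>(2)[OF that(2)] that(3) norm_triangle_sub[of "z * f (1 / z)" "z * F n (1 / z)"]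
        by (simp add: m_def)
    qed
    have nz: "F n (1 / z) \<noteq> 0" if "n \<ge> N" "z \<in> K" "z \<noteq> 0" for n z
      using big[OF that] \<delta>(1) by fastforce
    define C where "C = D / \<delta>\<^sup>2 + 1 / \<delta>"
    have C: "D / \<delta>\<^sup>2 \<le> C" "1 / \<delta> \<le> C" using D_nonneg \<delta>(1) by (auto simp: C_def)
    have at0: "cmod (G n x) \<le> C * cmod x" if n: "n \<ge> N" "x \<in> K" for n x
    proof (cases "x = 0")
      case False
      have "cmod x * 1 / cmod (x * F n (1 / x)) \<le> cmod x * 1 / \<delta>"
        using big[OF n False] \<delta>(1) False nz[OF n False]
        by (intro divide_left_mono) (auto intro!: mult_pos_pos)
      then have "cmod (G n x) \<le> 1 / \<delta> * cmod x"
        using False nz[OF n False] by (simp add: G_def norm_divide norm_mult)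
      also have "\<dots> \<le> C * cmod x" by (intro mult_right_mono C) simp
      finally show ?thesis .
    qed (simp add: G_def)
    have "cmod (G n x - G n y) \<le> C * cmod (x - y)" if n: "n \<ge> N" "x \<in> K" "y \<in> K" for n x y
    proof (cases "x = 0 \<or> y = 0")
      case True
      then show ?thesis using at0[OF n(1,2)] at0[OF n(1,3)] by (auto simp: G_def)
    next
      case False
      then have xy: "x \<noteq> 0" "y \<noteq> 0" by auto
      define a where "a = F n (1 / x)"
      define b where "b = F n (1 / y)"
      have ab: "a \<noteq> 0" "b \<noteq> 0" using nz n xy by (auto simp: a_def b_def)
      have "cmod (G n x - G n y) = cmod (a - b) * (cmod x * cmod y) / (cmod (x * a) * cmod (y * b))"
      proof -
        have "G n x - G n y = (b - a) / (a * b)" using xy ab by (simp add: G_def a_def b_def field_simps)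
        then show ?thesis using xy by (simp add: norm_divide norm_mult norm_minus_commute)
      qed
      also have "\<dots> \<le> cmod (a - b) * (cmod x * cmod y) / (\<delta> * \<delta>)"
        using big[OF n(1,2) xy(1)] big[OF n(1,3) xy(2)] \<delta>(1) xy ab unfolding a_def[symmetric] b_def[symmetric]
        by (intro divide_left_mono mult_mono mult_pos_pos mult_nonneg_nonneg) auto
      also have "cmod (a - b) * (cmod x * cmod y) \<le> D * cmod (1 / x - 1 / y) * (cmod x * cmod y)"
        unfolding a_def b_def by (intro mult_right_mono lip) simp
      also have "\<dots> = D * cmod (x - y)"
      proof -
        have "1 / x - 1 / y = (y - x) / (x * y)" using xy by (simp add: field_simps)
        then show ?thesis using xy by (simp add: norm_divide norm_mult norm_minus_commute)
      qed
      finally have "cmod (G n x - G n y) \<le> D / \<delta>\<^sup>2 * cmod (x - y)"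
        using \<delta>(1) by (simp add: divide_right_mono power2_eq_square)
      also have "\<dots> \<le> C * cmod (x - y)" by (intro mult_right_mono C) simp
      finally show ?thesis .
    qed
    moreover have "AE z in lebesgue. z \<in> K \<longrightarrow> has_wirtinger (G n) (pG n z) (qG n z) z" if n: "n \<ge> N" for n
    proof -
      have "AE z in lebesgue. z \<noteq> (0::complex)"
        by (rule AE_I'[of "{0}"]) (auto simp flip: negligible_iff_null_sets)
      with AE_reciprocal[OF der[of n]] show ?thesis
      proof eventually_elim
        case (elim z)
        show ?case
        proof
          assume z: "z \<in> K"
          have 1: "has_wirtinger (\<lambda>z. F n (1 / z)) (p n (1 / z) * coef z) (q n (1 / z) * cnj (coef z)) z"
            unfolding coef_def
            by (intro has_wirtinger_precompose[where g = "\<lambda>z. 1 / z", OF elim(1)] has_field_derivative_reciprocal elim(2))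
          have "has_wirtinger (\<lambda>z. 1 / F n (1 / z)) (pG n z) (qG n z) z"
            unfolding pG_def qG_def coef_def[of]
            using has_wirtinger_postcompose[where g = "\<lambda>z. 1 / z", OF 1 has_field_derivative_reciprocal[OF nz[OF n z elim(2)]]]
            by (simp add: coef_def)
          then show "has_wirtinger (G n) (pG n z) (qG n z) z"
            by (rule has_wirtinger_transform[where S = "- {0}"]) (use elim(2) in \<open>auto simp: G_def\<close>)
        qed
      qed
    qed
    ultimately show ?thesis by blast
  qed
  have l: "(\<lambda>n. G n z) \<longlonglongrightarrow> g z" if "z \<in> U" for z
    using that lim[of "1 / z"] unfolding g[OF that] G_def
    by (cases "z = 0") (auto simp: U_def intro!: tendsto_intros)
  have cv: "AE z in lebesgue. z \<in> U \<longrightarrow> (\<lambda>n. pG n z) \<longlonglongrightarrow> coef (f (1 / z)) * (P (1 / z) * coef z) \<and>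
      (\<lambda>n. qG n z) \<longlonglongrightarrow> coef (f (1 / z)) * (Q (1 / z) * cnj (coef z))"
    using AE_reciprocal[OF conv]
  proof eventually_elim
    case (elim z)
    show ?case
    proof (cases "z = 0")
      case True
      then show ?thesis by (simp add: pG_def qG_def coef_def)
    next
      case False
      then show ?thesis using elim lim[of "1 / z"] unfolding pG_def qG_def coef_def
        by (auto simp: U_def intro!: tendsto_intros)
    qed
  qed
  note w = distr_derivatives_of_limit[OF U loc l cv, simplified]
  have "AE z in lebesgue. z \<in> U \<longrightarrow> cmod (coef (f (1 / z)) * (Q (1 / z) * cnj (coef z)))
      \<le> k * cmod (coef (f (1 / z)) * (P (1 / z) * coef z))"
    using AE_reciprocal[OF bound]
  proof eventually_elim
    case (elim z)
    show ?case using mult_left_mono[OF elim norm_ge_zero, of "coef (f (1 / z)) * coef z"]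
      by (simp add: norm_mult mult_ac)
  qed
  then show "weak_Beltrami k U g" "continuous_on U g"
    using w by blast+
qed

lemma weak_derivative_chart:
  assumes ab: "a \<in> sphere_charts" "b \<in> sphere_charts"
  defines "U \<equiv> chart_dom a b (map_option f)" and "g \<equiv> chart_expr a b (map_option f)"
  shows "weak_Beltrami k U g" "continuous_on U g"
proof -
  have o: "open U" unfolding U_def by (rule chart_dom_open_connected[OF cont_f bij ab])
  consider "a = Some" "b = Some" | "a = Some" "b = chart_inf" | "a = chart_inf" "b = Some"
      | "a = chart_inf" "b = chart_inf" using ab unfolding sphere_charts_def by blast
  then have "weak_Beltrami k U g \<and> continuous_on U g"
  proof cases
    case 1
    have U: "U = UNIV" unfolding U_def 1 by (rule chart_doms)
    have g: "g = f" unfolding g_def 1 by (rule ext) (rule chart_exprs)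
    have "AE z in lebesgue. z \<in> UNIV \<longrightarrow> cmod (Q z) \<le> k * cmod (P z)" using bound by simp
    then show ?thesis unfolding U g using weak_derivative_plane by blast
  next
    case 2
    have U: "U = {z. f z \<noteq> 0}" unfolding U_def 2 by (rule chart_doms)
    have g: "g z = 1 / f z" if "z \<in> {z. f z \<noteq> 0}" for z unfolding g_def 2 using that by (simp add: chart_exprs)
    show ?thesis unfolding U using weak_derivative_target_inf[of g, OF g] by blast
  next
    case 3
    have U: "U = {z. z \<noteq> 0}" unfolding U_def 3 by (rule chart_doms)
    have g: "g z = f (1 / z)" if "z \<in> {z. z \<noteq> 0}" for z unfolding g_def 3 using that by (simp add: chart_exprs)
    show ?thesis unfolding U using weak_derivative_source_inf[of g, OF g] by blast
  next
    case 4
    have U: "U = {z. z = 0 \<or> f (1 / z) \<noteq> 0}" unfolding U_def 4 by (rule chart_doms)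
    have g: "g z = (if z = 0 then 0 else 1 / f (1 / z))" if "z \<in> {z. z = 0 \<or> f (1 / z) \<noteq> 0}" for z
      unfolding g_def 4 using that by (intro chart_exprs) simp
    show ?thesis unfolding U using weak_derivative_both_inf[of g, OF o[unfolded U] g] by blast
  qed
  then show "weak_Beltrami k U g" "continuous_on U g"
    by blast+
qed

lemma conformal_point_chart:
  assumes ab: "a \<in> sphere_charts" "b \<in> sphere_charts"
  obtains z d where "z \<in> chart_dom a b (map_option f)" "d \<noteq> 0"
    "(chart_expr a b (map_option f) has_field_derivative d) (at z)"
proof -
  let ?U = "chart_dom a b (map_option f)" and ?g = "chart_expr a b (map_option f)"
  have o: "open ?U" by (rule chart_dom_open_connected[OF cont_f bij ab])
  \<comment> \<open>at most one of the points \<open>-2\<close> and \<open>-3\<close> is sent to \<open>0\<close>, where the target chart \<open>1/z\<close> is undefined\<close>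
  obtain w :: complex where w: "Re w < -1" "w + c \<noteq> 0"
  proof (cases "c = 2")
    case True then show ?thesis by (intro that[of "-3"]) auto
  next
    case False then show ?thesis by (intro that[of "-2"]) auto
  qed
  have w0: "w \<noteq> 0" using w by auto
  have S: "open {z. Re z < -1}" by (rule open_halfspace_Re_lt)
  define T where "T = {z. Re z < - (cmod z)\<^sup>2}"
  have T: "open T" unfolding T_def by (intro open_Collect_less continuous_intros)
  have TI: "z \<noteq> 0 \<and> Re (1 / z) < -1" if "z \<in> T" for z
  proof -
    have ne: "z \<noteq> 0" using that by (auto simp: T_def)
    then have pos: "(cmod z)\<^sup>2 > 0" by simp
    have "Re (1 / z) = Re z / (cmod z)\<^sup>2" by (simp add: Re_divide cmod_power2)
    then show ?thesis using that ne pos by (simp add: T_def divide_less_eq)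
  qed
  have wT: "1 / w \<in> T"
  proof -
    have pos: "(cmod w)\<^sup>2 > 0" using w0 by simp
    have "Re (1 / w) = Re w / (cmod w)\<^sup>2" by (simp add: Re_divide cmod_power2)
    then show ?thesis using divide_strict_right_mono[OF w(1) pos] by (simp add: T_def norm_divide power_divide)
  qed
  have fw: "f w = w + c" "f w \<noteq> 0" using left[OF w(1)] w(2) by auto
  have transfer: thesis if "open V" "z \<in> V" "z \<in> ?U" "(h has_field_derivative d) (at z)" "d \<noteq> 0"
    "\<And>x. x \<in> V \<Longrightarrow> x \<in> ?U \<Longrightarrow> h x = ?g x" for V z h d
  proof -
    have "(?g has_field_derivative d) (at z)"
      by (rule has_field_derivative_transform_within_open[OF that(4), of "V \<inter> ?U"]) (use that o in auto)
    then show thesis using that(3,5) by (intro \<open>\<And>z d. \<lbrakk>z \<in> ?U; d \<noteq> 0; (?g has_field_derivative d) (at z)\<rbrakk> \<Longrightarrow> thesis\<close>)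
  qed
  consider "a = Some" "b = Some" | "a = Some" "b = chart_inf" | "a = chart_inf" "b = Some"
      | "a = chart_inf" "b = chart_inf" using ab unfolding sphere_charts_def by blast
  then show thesis
  proof cases
    case 1
    show thesis
    proof (rule transfer[OF S, of w])
      show "((\<lambda>z. z + c) has_field_derivative 1) (at w)" by (auto intro!: derivative_eq_intros)
    qed (use w left in \<open>auto simp: 1 chart_doms chart_exprs\<close>)
  next
    case 2
    show thesis
    proof (rule transfer[OF S, of w])
      show "((\<lambda>z. 1 / (z + c)) has_field_derivative - (1 / (w + c)\<^sup>2)) (at w)"
        using w by (auto intro!: derivative_eq_intros simp: power2_eq_square field_simps)
    qed (use w fw left in \<open>auto simp: 2 chart_doms chart_exprs\<close>)
  next
    case 3
    show thesis
    proof (rule transfer[OF T wT])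
      show "((\<lambda>z. 1 / z + c) has_field_derivative - (1 / (1 / w)\<^sup>2)) (at (1 / w))"
        using w0 by (auto intro!: derivative_eq_intros simp: power2_eq_square field_simps)
    qed (use w w0 TI left in \<open>auto simp: 3 chart_doms chart_exprs\<close>)
  next
    case 4
    show thesis
    proof (rule transfer[OF T wT])
      have "((\<lambda>z. 1 / z + c) has_field_derivative - (1 / (1 / w)\<^sup>2)) (at (1 / w))"
        using w0 by (auto intro!: derivative_eq_intros simp: power2_eq_square field_simps)
      from DERIV_chain2[OF has_field_derivative_reciprocal this]
      show "((\<lambda>z. 1 / (1 / z + c)) has_field_derivative - (1 / (w + c)\<^sup>2) * - (1 / (1 / w)\<^sup>2)) (at (1 / w))"
        using w by simp
    qed (use w fw w0 TI left in \<open>auto simp: 4 chart_doms chart_exprs\<close>)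
  qed
qed

theorem quasiconformal: "quasiconformal_sphere k (map_option f)"
  unfolding quasiconformal_sphere_def
proof (intro conjI ballI)
  show "homeomorphic_map riemann_sphere riemann_sphere (map_option f)"
    by (rule homeomorphic_map_sphere[OF cont_f bij])
  fix a b assume ab: "a \<in> sphere_charts" "b \<in> sphere_charts"
  let ?U = "chart_dom a b (map_option f)" and ?g = "chart_expr a b (map_option f)"
  show "weak_Beltrami k ?U ?g"
    by (rule weak_derivative_chart[OF ab])
  have inj: "inj_on ?g ?U"
  proof (rule inj_onI)
    fix x y assume xy: "x \<in> ?U" "y \<in> ?U" "?g x = ?g y"
    have "inj a" using ab chart_inf_props(2) by (auto simp: sphere_charts_def)
    have r: "map_option f (a x) \<in> range b" "map_option f (a y) \<in> range b"
      using CollectD[OF xy(1)[unfolded chart_dom_def]] CollectD[OF xy(2)[unfolded chart_dom_def]] by this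
    have "inv b (map_option f (a x)) = inv b (map_option f (a y))"
      using xy(3) unfolding chart_expr_def o_def .
    then have eq: "map_option f (a x) = map_option f (a y)" by (rule inv_into_injective) (fact r)+
    have "inj (map_option f)" using bij by (intro option.inj_map bij_is_inj)
    from injD[OF \<open>inj a\<close> injD[OF this eq]] show "x = y" .
  qed
  obtain z d where "z \<in> ?U" "d \<noteq> 0" "(?g has_field_derivative d) (at z)"
    by (rule conformal_point_chart[OF ab])
  then show "orientation_preserving_on ?U ?g"
    using orientation_preserving_if_conformal_somewhere[OF chart_dom_open_connected[OF cont_f bij ab]
        weak_derivative_chart(2)[OF ab] inj] by blast
qed
end

section \<open>The displacement and its approximants\<close>

text \<open>Solving \<open>w = (1 - d) / (1 + z d)\<close> for \<open>d\<close> gives \<open>d - 1 = slope z w\<close>: this is the derivative of the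
  displacement \<open>\<psi> - id\<close> at \<open>z\<close> in terms of the quotient bounded by \<open>k\<close>.\<close>

definition slope :: "complex \<Rightarrow> complex \<Rightarrow> complex" where
  "slope z w = - ((1 + z) * w) / (1 + z * w)"

lemma norm_one_plus_ge:
  assumes "cmod z \<le> 1" "cmod w \<le> k"
  shows "1 - k \<le> cmod (1 + z * w)"
proof -
  have "cmod (z * w) \<le> 1 * k" unfolding norm_mult using assms by (intro mult_mono) auto
  then show ?thesis using norm_diff_ineq[of 1 "z * w"] by simp
qed

lemma slope_bound:
  assumes "cmod z \<le> 1" "cmod w \<le> k" "k < 1"
  shows "cmod (slope z w) \<le> k / (1 - k) * cmod (1 + z)"
proof -
  have "cmod (slope z w) = cmod (1 + z) * cmod w / cmod (1 + z * w)"
    by (simp add: slope_def norm_divide norm_mult)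
  also have "\<dots> \<le> cmod (1 + z) * k / (1 - k)"
    using norm_one_plus_ge[OF assms(1,2)] assms
    by (intro frac_le mult_left_mono mult_nonneg_nonneg) (auto intro: order_trans[OF norm_ge_zero])
  finally show ?thesis by (simp add: mult.commute)
qed

lemma slope_diff:
  assumes "cmod z \<le> 1" "cmod v \<le> k" "cmod w \<le> k" "k < 1"
  shows "cmod (slope z v - slope z w) \<le> 2 / (1 - k)\<^sup>2 * cmod (v - w)"
proof -
  have b: "1 - k \<le> cmod (1 + z * v)" "1 - k \<le> cmod (1 + z * w)" using norm_one_plus_ge assms by auto
  have ne: "1 + z * v \<noteq> 0" "1 + z * w \<noteq> 0" using b assms(4) by auto
  have "slope z v - slope z w = (1 + z) * (w - v) / ((1 + z * v) * (1 + z * w))"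
    using ne by (simp add: slope_def field_simps)
  then have "cmod (slope z v - slope z w)
      = cmod (1 + z) * cmod (v - w) / (cmod (1 + z * v) * cmod (1 + z * w))"
    by (simp add: norm_divide norm_mult norm_minus_commute)
  also have "\<dots> \<le> 2 * cmod (v - w) / ((1 - k) * (1 - k))"
    using b assms norm_triangle_ineq[of 1 z]
    by (intro frac_le mult_mono mult_right_mono mult_nonneg_nonneg) auto
  finally show ?thesis by (simp add: power2_eq_square)
qed

lemma isCont_slope:
  assumes "cmod z \<le> 1" "cmod w \<le> k" "k < 1"
  shows "isCont (slope z) w"
  unfolding slope_def[abs_def] using norm_one_plus_ge[OF assms(1,2)] assms(3)
  by (intro continuous_intros) auto

text \<open>The factor \<open>1 + z\<close> of the slope yields the weight that \<open>ray_proj_lipschitz\<close> requires.\<close>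

lemma modulus_from_slope:
  assumes S: "convex S" "S \<subseteq> cball 0 1" and k: "k < 1"
    and der: "\<And>z. z \<in> S \<Longrightarrow> (u has_field_derivative slope z (Q z)) (at z)"
    and Q: "\<And>z. z \<in> S \<Longrightarrow> cmod (Q z) \<le> k"
    and ab: "a \<in> S" "b \<in> S"
  shows "cmod (u a - u b) \<le> k / (1 - k) * cmod (a - b) * max (cmod (1 + a)) (cmod (1 + b))"
proof -
  define B where "B = k / (1 - k) * max (cmod (1 + a)) (cmod (1 + b))"
  have k0: "k \<ge> 0" using Q[OF ab(1)] norm_ge_zero order_trans by blast
  have sub: "closed_segment a b \<subseteq> S" using S(1) ab by (simp add: closed_segment_subset)
  have "cmod (u a - u b) \<le> B * cmod (a - b)"
  proof (rule field_differentiable_bound[where S = "closed_segment a b"])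
    show "(u has_field_derivative slope z (Q z)) (at z within closed_segment a b)"
      if "z \<in> closed_segment a b" for z
      using der sub that by (meson has_field_derivative_at_within subsetD)
    show "cmod (slope z (Q z)) \<le> B" if z: "z \<in> closed_segment a b" for z
    proof -
      obtain t where t: "0 \<le> t" "t \<le> 1" "z = (1 - t) *\<^sub>R a + t *\<^sub>R b"
        using z by (auto simp: closed_segment_def)
      have "1 + z = (1 - t) *\<^sub>R (1 + a) + t *\<^sub>R (1 + b)" using t(3) by (simp add: algebra_simps)
      then have "cmod (1 + z) \<le> (1 - t) * cmod (1 + a) + t * cmod (1 + b)"
        using norm_triangle_ineq[of "(1 - t) *\<^sub>R (1 + a)" "t *\<^sub>R (1 + b)"] t by simp
      also have "\<dots> \<le> max (cmod (1 + a)) (cmod (1 + b))"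
        by (rule convex_bound_le) (use t in auto)
      finally have "k / (1 - k) * cmod (1 + z) \<le> B"
        unfolding B_def using k k0 by (intro mult_left_mono) auto
      moreover have "z \<in> S" using sub z by blast
      then have "cmod (slope z (Q z)) \<le> k / (1 - k) * cmod (1 + z)"
        using S(2) by (intro slope_bound Q k) auto
      ultimately show ?thesis by simp
    qed
  qed auto
  then show ?thesis by (simp add: B_def mult_ac)
qed

lemma boundary_extension:
  assumes C: "C \<ge> 0" and u: "\<And>a b. cmod a < 1 \<Longrightarrow> cmod b < 1 \<Longrightarrow>
      cmod (u a - u b) \<le> C * cmod (a - b) * max (cmod (1 + a)) (cmod (1 + b))"
  obtains v where "\<And>z. cmod z < 1 \<Longrightarrow> v z = u z" "continuous_on (cball 0 1) v"
    "\<And>a b. cmod a \<le> 1 \<Longrightarrow> cmod b \<le> 1 \<Longrightarrow>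
      cmod (v a - v b) \<le> C * cmod (a - b) * max (cmod (1 + a)) (cmod (1 + b))"
proof -
  have "(2 * C)-lipschitz_on (ball 0 1) u"
  proof (rule lipschitz_onI)
    fix a b :: complex assume ab: "a \<in> ball 0 1" "b \<in> ball 0 1"
    then have "max (cmod (1 + a)) (cmod (1 + b)) \<le> 2"
      using norm_triangle_ineq[of 1 a] norm_triangle_ineq[of 1 b] by auto
    then have "C * cmod (a - b) * max (cmod (1 + a)) (cmod (1 + b)) \<le> C * cmod (a - b) * 2"
      using C by (intro mult_left_mono) auto
    then show "dist (u a) (u b) \<le> 2 * C * dist a b" using u[of a b] ab by (simp add: dist_norm)
  qed (use C in simp)
  then have "uniformly_continuous_on (ball 0 1) u" by (rule lipschitz_on_uniformly_continuous)
  then obtain v where v: "uniformly_continuous_on (closure (ball 0 1)) v" "\<And>z. z \<in> ball 0 1 \<Longrightarrow> u z = v z"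
    by (rule uniformly_continuous_on_extension_on_closure) blast
  have cont: "continuous_on (cball 0 1) v"
    using uniformly_continuous_imp_continuous[OF v(1)] by simp
  define s where "s = (\<lambda>n. 1 - 1 / real (Suc n))"
  have s: "s \<longlonglongrightarrow> 1" "\<And>n. 0 \<le> s n" "\<And>n. s n < 1"
  proof -
    have "(\<lambda>n. 1 - 1 / real (Suc n)) \<longlonglongrightarrow> 1 - 0"
      by (intro tendsto_intros LIMSEQ_Suc lim_1_over_n)
    then show "s \<longlonglongrightarrow> 1" by (simp add: s_def)
  qed (auto simp: s_def)
  have in_ball: "cmod (of_real (s n) * z) < 1" if "cmod z \<le> 1" for z n
  proof -
    have "s n * cmod z \<le> s n * 1" using that s(2) by (intro mult_left_mono)
    then show ?thesis using s(2,3)[of n] by (simp add: norm_mult)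
  qed
  have sz: "(\<lambda>n. of_real (s n) * z) \<longlonglongrightarrow> z" for z :: complex
    using tendsto_mult[OF tendsto_of_real[OF s(1)] tendsto_const[of z]] by simp
  have lim: "(\<lambda>n. v (of_real (s n) * z)) \<longlonglongrightarrow> v z" if "cmod z \<le> 1" for z
    by (rule continuous_on_tendsto_compose[OF cont sz])
      (use that in_ball[OF that] in \<open>auto simp: less_imp_le\<close>)
  show ?thesis
  proof (rule that[of v])
    fix a b :: complex assume ab: "cmod a \<le> 1" "cmod b \<le> 1"
    let ?r = "\<lambda>n. C * cmod (of_real (s n) * a - of_real (s n) * b)
        * max (cmod (1 + of_real (s n) * a)) (cmod (1 + of_real (s n) * b))"
    have 1: "?r \<longlonglongrightarrow> C * cmod (a - b) * max (cmod (1 + a)) (cmod (1 + b))"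
      by (intro tendsto_intros sz)
    have 2: "(\<lambda>n. cmod (v (of_real (s n) * a) - v (of_real (s n) * b))) \<longlonglongrightarrow> cmod (v a - v b)"
      by (intro tendsto_intros lim ab)
    have "cmod (v (of_real (s n) * a) - v (of_real (s n) * b)) \<le> ?r n" for n
      using u[OF in_ball[OF ab(1), of n] in_ball[OF ab(2), of n]]
        v(2)[of "of_real (s n) * a"] v(2)[of "of_real (s n) * b"]
        in_ball[OF ab(1), of n] in_ball[OF ab(2), of n] by simp
    then show "cmod (v a - v b) \<le> C * cmod (a - b) * max (cmod (1 + a)) (cmod (1 + b))"
      by (intro LIMSEQ_le[OF 2 1]) blast
  qed (use v(2) cont in auto)
qed

text \<open>Dilating only the argument of \<open>Q\<close> and keeping the factor \<open>1 + z\<close> undilated makes the primitive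
  holomorphic across the unit circle while its derivative still vanishes at \<open>-1\<close>.\<close>

lemma dilated_primitive:
  assumes hol: "Q holomorphic_on ball 0 1" and Q: "\<And>z. cmod z < 1 \<Longrightarrow> cmod (Q z) \<le> k" and k: "k < 1"
    and r: "0 < r" "r < 1"
  obtains v where "v 0 = c" "\<And>z. cmod z \<le> 1 \<Longrightarrow> (v has_field_derivative slope z (Q (of_real r * z))) (at z)"
proof -
  have k0: "0 \<le> k" using order_trans[OF norm_ge_zero Q[of 0]] by simp
  define m where "m = max r k"
  \<comment> \<open>a radius beyond \<open>1\<close> that keeps both \<open>r z\<close> and \<open>z Q\<close> inside the unit disc\<close>
  define R where "R = 2 / (1 + m)"
  have m: "r \<le> m" "k \<le> m" "m < 1" "0 < m" using r k by (auto simp: m_def)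
  have R: "R > 1" "R * m < 1" using m by (auto simp: R_def field_simps)
  have "R * r \<le> R * m" "R * k \<le> R * m" using m R by (intro mult_left_mono; simp)+
  then have Rr: "R * r < 1" "R * k < 1" using R(2) by linarith+
  have arg: "cmod (of_real r * z) < 1" if "z \<in> ball 0 R" for z
  proof -
    have "cmod z * r \<le> R * r" using that r by (intro mult_right_mono) auto
    then have "cmod z * r < 1" using Rr(1) by (rule le_less_trans)
    then show ?thesis using r by (simp add: norm_mult mult.commute)
  qed
  have holQ: "(\<lambda>z. Q (of_real r * z)) holomorphic_on ball 0 R"
  proof -
    have "(\<lambda>z. complex_of_real r * z) ` ball 0 R \<subseteq> ball 0 1"
      by (rule image_subsetI) (subst mem_ball_0, rule arg)
    then have "(Q \<circ> (\<lambda>z. of_real r * z)) holomorphic_on ball 0 R"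
      by (intro holomorphic_on_compose_gen[OF _ hol] holomorphic_intros)
    then show ?thesis by (simp add: o_def)
  qed
  have ne: "1 + z * Q (of_real r * z) \<noteq> 0" if z: "z \<in> ball 0 R" for z
  proof
    assume "1 + z * Q (of_real r * z) = 0"
    then have "z * Q (of_real r * z) = -1" by (simp add: add_eq_0_iff)
    then have "cmod (z * Q (of_real r * z)) = 1" by simp
    moreover have "cmod (z * Q (of_real r * z)) \<le> R * k"
      unfolding norm_mult using z R Q[OF arg[OF z]] by (intro mult_mono) auto
    ultimately show False using Rr by simp
  qed
  have hols: "(\<lambda>z. slope z (Q (of_real r * z))) holomorphic_on ball 0 R"
    unfolding slope_def by (intro holomorphic_intros holQ) (use ne in auto)
  obtain v0 where v0: "\<And>z. z \<in> ball 0 R \<Longrightarrow> (v0 has_field_derivative slope z (Q (of_real r * z))) (at z within ball 0 R)"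
    by (rule holomorphic_convex_primitive'[OF convex_ball open_ball hols]) blast
  define v where "v = (\<lambda>z. v0 z + (c - v0 0))"
  show ?thesis
  proof (rule that[of v])
    show "v 0 = c" by (simp add: v_def)
    fix z :: complex assume "cmod z \<le> 1"
    then have z: "z \<in> ball 0 R" using R by simp
    have "(v0 has_field_derivative slope z (Q (of_real r * z))) (at z)"
      using v0[OF z] unfolding at_within_open[OF z open_ball] .
    from DERIV_add[OF this DERIV_const[of "c - v0 0"]]
    show "(v has_field_derivative slope z (Q (of_real r * z))) (at z)"
      unfolding v_def by (simp only: add_0_right)
  qed
qed

text \<open>On a smaller disc the derivatives converge uniformly; in the remaining collar of width \<open>1 - \<rho>\<close> the
  common Lipschitz constant controls both functions.\<close>

lemma uniform_limit_of_primitives: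
  fixes u :: "complex \<Rightarrow> complex" and v :: "nat \<Rightarrow> complex \<Rightarrow> complex"
  assumes hol: "Q holomorphic_on ball 0 1" and Q: "\<And>z. cmod z < 1 \<Longrightarrow> cmod (Q z) \<le> k" and k: "k < 1"
    and r: "\<And>n. 0 < r n \<and> r n < 1" "r \<longlonglongrightarrow> (1::real)"
    and u: "\<And>z. cmod z < 1 \<Longrightarrow> (u has_field_derivative slope z (Q z)) (at z)"
    and v: "\<And>n z. cmod z \<le> 1 \<Longrightarrow> (v n has_field_derivative slope z (Q (of_real (r n) * z))) (at z)"
    and v0: "\<And>n. v n 0 = u 0"
    and lip_u: "\<And>a b. cmod a \<le> 1 \<Longrightarrow> cmod b \<le> 1 \<Longrightarrow> cmod (u a - u b) \<le> L * cmod (a - b)"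
    and lip_v: "\<And>n a b. cmod a \<le> 1 \<Longrightarrow> cmod b \<le> 1 \<Longrightarrow> cmod (v n a - v n b) \<le> L * cmod (a - b)"
    and e: "e > 0"
  shows "\<forall>\<^sub>F n in sequentially. \<forall>z. cmod z \<le> 1 \<longrightarrow> cmod (v n z - u z) \<le> e"
proof -
  have "L \<ge> 0" using order_trans[OF norm_ge_zero lip_u[of 0 1]] by simp
  define \<rho> where "\<rho> = 1 - min (1/2) (e / (4 * (L + 1)))"
  have \<rho>: "0 < \<rho>" "\<rho> < 1" and L\<rho>: "2 * L * (1 - \<rho>) \<le> e / 2"
  proof -
    have pos: "0 < e / (4 * (L + 1))" using e \<open>L \<ge> 0\<close> by simp
    then show "0 < \<rho>" "\<rho> < 1" by (auto simp: \<rho>_def)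
    have "2 * L * (1 - \<rho>) \<le> 2 * (L + 1) * (e / (4 * (L + 1)))"
      unfolding \<rho>_def using \<open>L \<ge> 0\<close> pos by (intro mult_mono) auto
    also have "\<dots> = e / 2" using \<open>L \<ge> 0\<close> by (simp add: field_simps)
    finally show "2 * L * (1 - \<rho>) \<le> e / 2" .
  qed
  have "continuous_on (cball 0 \<rho>) Q"
    using holomorphic_on_imp_continuous_on[OF hol] by (rule continuous_on_subset) (use \<rho> in auto)
  then have "uniformly_continuous_on (cball 0 \<rho>) Q" by (intro compact_uniformly_continuous compact_cball)
  moreover define \<eta> where "\<eta> = e / 2 * ((1 - k)\<^sup>2 / 2)"
  have \<eta>: "\<eta> > 0" using e k by (simp add: \<eta>_def)
  ultimately obtain d where d: "d > 0"
    "\<And>x y. x \<in> cball 0 \<rho> \<Longrightarrow> y \<in> cball 0 \<rho> \<Longrightarrow> dist x y < d \<Longrightarrow> dist (Q x) (Q y) < \<eta>"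
    unfolding uniformly_continuous_on_def by metis
  have "\<forall>\<^sub>F n in sequentially. dist (r n) 1 < d" by (rule tendstoD[OF r(2) d(1)])
  then show ?thesis
  proof eventually_elim
    case (elim n)
    have near: "cmod (v n z - u z) \<le> e / 2" if z: "cmod z \<le> \<rho>" for z
    proof -
      have "cmod ((v n z - u z) - (v n 0 - u 0)) \<le> e / 2 * cmod (z - 0)"
      proof (rule field_differentiable_bound[where S = "cball 0 \<rho>"])
        fix x :: complex assume "x \<in> cball 0 \<rho>"
        then have x: "cmod x \<le> \<rho>" "cmod x < 1" using \<rho> by auto
        have le: "cmod (of_real (r n) * x) \<le> cmod x"
          using r(1)[of n] mult_right_mono[of "r n" 1 "cmod x"] by (simp add: norm_mult)
        show "((\<lambda>z. v n z - u z) has_field_derivative slope x (Q (of_real (r n) * x)) - slope x (Q x))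
            (at x within cball 0 \<rho>)"
          using x by (intro derivative_intros has_field_derivative_at_within[OF v] has_field_derivative_at_within[OF u]) auto
        have "dist (of_real (r n) * x) x = \<bar>r n - 1\<bar> * cmod x"
        proof -
          have "of_real (r n) * x - x = of_real (r n - 1) * x" by (simp add: algebra_simps)
          then show ?thesis unfolding dist_norm by (simp only: norm_mult norm_of_real)
        qed
        also have "\<dots> \<le> \<bar>r n - 1\<bar> * 1" using x by (intro mult_left_mono) auto
        also have "\<dots> < d" using elim by (simp add: dist_real_def)
        finally have "dist (of_real (r n) * x) x < d" .
        then have "dist (Q (of_real (r n) * x)) (Q x) < \<eta>"
          by (rule d(2)[rotated 2]) (use le x in auto)
        then have "cmod (Q (of_real (r n) * x) - Q x) \<le> \<eta>" by (simp add: dist_norm)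
        moreover have "cmod (slope x (Q (of_real (r n) * x)) - slope x (Q x))
            \<le> 2 / (1 - k)\<^sup>2 * cmod (Q (of_real (r n) * x) - Q x)"
          using x le by (intro slope_diff Q k) auto
        ultimately have "cmod (slope x (Q (of_real (r n) * x)) - slope x (Q x)) \<le> 2 / (1 - k)\<^sup>2 * \<eta>"
          by (meson mult_left_mono order_trans zero_le_divide_iff zero_le_numeral zero_le_power2)
        also have "\<dots> = e / 2" using k by (simp add: \<eta>_def)
        finally show "cmod (slope x (Q (of_real (r n) * x)) - slope x (Q x)) \<le> e / 2" .
      qed (use z \<rho> in auto)
      also have "\<dots> \<le> e / 2 * 1" using z \<rho> e by (intro mult_left_mono) auto
      finally show ?thesis by (simp add: v0)
    qed
    show ?case
    proof (intro allI impI)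
      fix z :: complex assume z: "cmod z \<le> 1"
      define y where "y = of_real \<rho> * z"
      have y: "cmod y \<le> \<rho>" using mult_left_mono[OF z, of \<rho>] \<rho> by (simp add: y_def norm_mult)
      have "z - y = of_real (1 - \<rho>) * z" by (simp add: y_def algebra_simps)
      then have "cmod (z - y) = \<bar>1 - \<rho>\<bar> * cmod z" by (simp only: norm_mult norm_of_real)
      also have "\<dots> \<le> (1 - \<rho>) * 1" using z \<rho> by (intro mult_mono) auto
      finally have "L * cmod (z - y) \<le> L * (1 - \<rho>)" using \<open>L \<ge> 0\<close> by (intro mult_left_mono) auto
      then have "cmod (v n z - v n y) \<le> L * (1 - \<rho>)" "cmod (u z - u y) \<le> L * (1 - \<rho>)"
        using lip_v[of z y n] lip_u[of z y] z y \<rho> by auto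
      moreover have "cmod (v n z - u z) \<le> cmod (v n z - v n y) + cmod (v n y - u y) + cmod (u z - u y)"
      proof -
        have eq: "v n z - u z = ((v n z - v n y) + (v n y - u y)) - (u z - u y)" by simp
        show ?thesis unfolding eq
          by (intro order_trans[OF norm_triangle_ineq4] add_right_mono norm_triangle_ineq)
      qed
      ultimately show "cmod (v n z - u z) \<le> e" using near[OF y] L\<rho> by simp
    qed
  qed
qed

section \<open>Derivatives of the extension\<close>

text \<open>The complex derivatives of \<open>ray_ext u\<close> at \<open>w\<close>, as functions of the value \<open>Q\<close> that the
  Beltrami data takes at the projection of \<open>w\<close>.\<close>

definition coef_dz :: "complex \<Rightarrow> complex \<Rightarrow> complex" where
  "coef_dz w Q = (if cmod w < 1 then 1 + slope w Q
     else if Re w > -1 then 1 + slope ((w + 1) / cnj (w + 1)) Q / cnj (w + 1) else 1)"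

definition coef_dzbar :: "complex \<Rightarrow> complex \<Rightarrow> complex" where
  "coef_dzbar w Q = (if cmod w < 1 then 0
     else if Re w > -1 then - (slope ((w + 1) / cnj (w + 1)) Q * (w + 1) / (cnj (w + 1))\<^sup>2) else 0)"

lemma norm_unit_direction: "cmod (a / cnj a) \<le> 1"
  by (cases "a = 0") (auto simp: norm_divide)

text \<open>Outside the disc, with \<open>a = w + 1\<close>, \<open>z = a / cnj a\<close> and \<open>s = 2 Re a / |a|\<^sup>2 < 1\<close>, the ratio of the
  two coefficients has modulus \<open>s |Q| / |1 + (1 - s) z Q|\<close>, and the denominator is at least \<open>s\<close>.\<close>

lemma Beltrami_bound:
  assumes Q: "cmod Q \<le> k" and k: "k < 1" and w: "cmod w \<noteq> 1"
  shows "cmod (coef_dzbar w Q) \<le> k * cmod (coef_dz w Q)"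
proof -
  have k0: "0 \<le> k" using order_trans[OF norm_ge_zero Q] .
  show ?thesis
  proof (cases "cmod w > 1 \<and> Re w > -1")
    case False
    then show ?thesis using w k0 by (auto simp: coef_dzbar_def)
  next
    case True
    define a where "a = w + 1"
    define z where "z = a / cnj a"
    define s where "s = 2 * Re a / (cmod a)\<^sup>2"
    have a: "Re a > 0" "a \<noteq> 0" using True by (auto simp: a_def complex_eq_iff)
    have "1 < (cmod w)\<^sup>2" using True by (simp add: power_gt1)
    then have "2 * Re a < (cmod a)\<^sup>2"
      unfolding cmod_power2 by (simp add: a_def power2_eq_square algebra_simps)
    then have s: "0 < s" "s < 1" using a by (simp_all add: s_def)
    have z1: "cmod z = 1" using a by (simp add: z_def norm_divide)
    have ne: "1 + z * Q \<noteq> 0" using norm_one_plus_ge[of z Q k] z1 Q k by auto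
    have sc: "of_real s = (a + cnj a) / (a * cnj a)"
      unfolding s_def complex_add_cnj complex_norm_square[symmetric] by simp
    have sl: "slope z Q / cnj a = - (of_real s * z * Q) / (1 + z * Q)"
    proof -
      have key: "(1 + z) / cnj a = of_real s * z" using a unfolding sc by (simp add: z_def field_simps)
      have "slope z Q / cnj a = - ((1 + z) / cnj a * Q) / (1 + z * Q)" by (simp add: slope_def)
      then show ?thesis unfolding key .
    qed
    have "coef_dz w Q = 1 + slope z Q / cnj a"
      using True by (simp add: coef_dz_def z_def a_def)
    then have dz: "coef_dz w Q = (1 + of_real (1 - s) * (z * Q)) / (1 + z * Q)"
      unfolding sl using ne by (simp add: field_simps)
    have "coef_dzbar w Q = - (slope z Q / cnj a * z)"
      using True by (simp add: coef_dzbar_def z_def a_def power2_eq_square)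
    then have dzbar: "cmod (coef_dzbar w Q) = s * cmod Q / cmod (1 + z * Q)"
      using s z1 unfolding sl by (simp add: norm_mult norm_divide)
    have "cmod (of_real (1 - s) * (z * Q)) \<le> (1 - s) * 1"
      unfolding norm_mult norm_of_real using s z1 Q k by (intro mult_mono) auto
    then have "s \<le> cmod (1 + of_real (1 - s) * (z * Q))"
      using norm_diff_ineq[of 1 "of_real (1 - s) * (z * Q)"] by simp
    then have "s * cmod Q \<le> k * cmod (1 + of_real (1 - s) * (z * Q))"
      using mult_mono[OF Q _ k0, of s] s by (subst mult.commute) auto
    then have "s * cmod Q / cmod (1 + z * Q) \<le> k * cmod (1 + of_real (1 - s) * (z * Q)) / cmod (1 + z * Q)"
      by (rule divide_right_mono) simp
    then show ?thesis unfolding dzbar dz by (simp add: norm_divide)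
  qed
qed

lemma coef_continuous:
  assumes lim: "x \<longlonglongrightarrow> y" and y: "cmod y \<le> k" and k: "k < 1"
  shows "(\<lambda>n. coef_dz w (x n)) \<longlonglongrightarrow> coef_dz w y" "(\<lambda>n. coef_dzbar w (x n)) \<longlonglongrightarrow> coef_dzbar w y"
proof -
  have s: "(\<lambda>n. slope z (x n)) \<longlonglongrightarrow> slope z y" if "cmod z \<le> 1" for z
    using isCont_tendsto_compose[OF isCont_slope[OF that y k] lim] .
  have 1: "(\<lambda>n. slope w (x n)) \<longlonglongrightarrow> slope w y" if "cmod w < 1" using s that by simp
  have 2: "(\<lambda>n. slope ((w + 1) / cnj (w + 1)) (x n)) \<longlonglongrightarrow> slope ((w + 1) / cnj (w + 1)) y"
    by (intro s norm_unit_direction)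
  have 3: "cnj (w + 1) \<noteq> 0" if "Re w > -1" using that by (auto simp: complex_eq_iff)
  show "(\<lambda>n. coef_dz w (x n)) \<longlonglongrightarrow> coef_dz w y"
    unfolding coef_dz_def using 1 tendsto_divide[OF 2 tendsto_const] 3
    by (cases "cmod w < 1"; cases "Re w > -1") (simp_all add: tendsto_add)
  show "(\<lambda>n. coef_dzbar w (x n)) \<longlonglongrightarrow> coef_dzbar w y"
  proof (cases "\<not> cmod w < 1 \<and> Re w > -1")
    case True
    have "(\<lambda>n. - (slope ((w + 1) / cnj (w + 1)) (x n) * (w + 1) / (cnj (w + 1))\<^sup>2))
        \<longlonglongrightarrow> - (slope ((w + 1) / cnj (w + 1)) y * (w + 1) / (cnj (w + 1))\<^sup>2)"
      using 3 True by (intro tendsto_minus tendsto_divide tendsto_mult 2 tendsto_const) auto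
    then show ?thesis using True by (simp add: coef_dzbar_def)
  qed (auto simp: coef_dzbar_def)
qed

lemma has_wirtinger_ray_ext:
  assumes v: "\<And>z. cmod z \<le> 1 \<Longrightarrow> (v has_field_derivative slope z (Q z)) (at z)"
    and w: "cmod w \<noteq> 1" "Re w \<noteq> -1"
  shows "has_wirtinger (ray_ext v) (coef_dz w (Q (ray_proj w))) (coef_dzbar w (Q (ray_proj w))) w"
proof -
  consider "cmod w < 1" | "cmod w > 1" "Re w > -1" | "cmod w > 1" "Re w < -1"
    using w Re_pos_closed_disc[of w] by (cases "cmod w < 1"; cases "Re w > -1") (auto simp: not_less)
  then show ?thesis
  proof cases
    case 1
    have "(v has_derivative (*) (slope w (Q w))) (at w)"
      using v[of w] 1 by (simp add: has_field_derivative_def)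
    then have "has_wirtinger (\<lambda>z. z + v z) (1 + slope w (Q w)) 0 w"
      unfolding has_wirtinger_def by (auto intro!: derivative_eq_intros simp: algebra_simps)
    then show ?thesis using 1
      by (simp add: coef_dz_def coef_dzbar_def)
        (rule has_wirtinger_transform[where S = "ball 0 1"], auto simp: ray_ext_def)
  next
    case 2
    define a where "a = w + 1"
    define z where "z = a / cnj a"
    have a: "a \<noteq> 0" "cnj a \<noteq> 0" using 2 by (auto simp: a_def complex_eq_iff)
    have P: "ray_proj w = z" using 2 by (simp add: ray_proj_def z_def a_def)
    have "((\<lambda>w. (w + 1) / cnj (w + 1)) has_derivative (\<lambda>h. (h * cnj (w + 1) - (w + 1) * cnj h) / (cnj (w + 1) * cnj (w + 1)))) (at w)"
      using a by (intro has_derivative_divide' derivative_eq_intros) (auto simp: a_def intro!: derivative_eq_intros)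
    then have proj: "has_wirtinger (\<lambda>w. (w + 1) / cnj (w + 1)) (1 / cnj a) (- a / (cnj a)\<^sup>2) w"
    proof -
      have "(h * cnj (w + 1) - (w + 1) * cnj h) / (cnj (w + 1) * cnj (w + 1))
          = 1 / cnj a * h + (- a / (cnj a)\<^sup>2) * cnj h" for h
        using a unfolding a_def[symmetric] by (simp add: field_simps power2_eq_square)
      then show ?thesis using \<open>(_ has_derivative _) (at w)\<close> unfolding has_wirtinger_def by presburger
    qed
    have dv: "(v has_field_derivative slope z (Q z)) (at ((w + 1) / cnj (w + 1)))"
      using v[of z] norm_unit_direction[of a] by (simp add: z_def a_def)
    have "has_wirtinger (\<lambda>w. v ((w + 1) / cnj (w + 1))) (slope z (Q z) * (1 / cnj a)) (slope z (Q z) * (- a / (cnj a)\<^sup>2)) w"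
      by (rule has_wirtinger_postcompose[where g = v, OF proj dv])
    then have "has_wirtinger (\<lambda>w. w + v ((w + 1) / cnj (w + 1))) (1 + slope z (Q z) * (1 / cnj a)) (slope z (Q z) * (- a / (cnj a)\<^sup>2)) w"
      unfolding has_wirtinger_def by (auto intro!: derivative_eq_intros simp: algebra_simps)
    then have "has_wirtinger (ray_ext v) (1 + slope z (Q z) * (1 / cnj a)) (slope z (Q z) * (- a / (cnj a)\<^sup>2)) w"
    proof (rule has_wirtinger_transform[where S = "- cball 0 1 \<inter> {w. Re w > -1}"])
      show "open (- cball 0 1 \<inter> {w::complex. Re w > -1})"
        by (intro open_Int open_Compl closed_cball open_halfspace_Re_gt)
    qed (use 2 in \<open>auto simp: ray_ext_def ray_proj_def\<close>)
    moreover have "coef_dz w (Q z) = 1 + slope z (Q z) * (1 / cnj a)"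
      using 2 by (simp add: coef_dz_def z_def a_def)
    moreover have "coef_dzbar w (Q z) = - (slope z (Q z) * a / (cnj a)\<^sup>2)"
      using 2 by (simp add: coef_dzbar_def z_def a_def)
    then have "coef_dzbar w (Q z) = slope z (Q z) * (- a / (cnj a)\<^sup>2)" by simp
    ultimately show ?thesis unfolding P by simp
  next
    case 3
    have "has_wirtinger (\<lambda>w. w + v (-1)) 1 0 w"
      unfolding has_wirtinger_def by (auto intro!: derivative_eq_intros)
    then have "has_wirtinger (ray_ext v) 1 0 w"
    proof (rule has_wirtinger_transform[where S = "{w. Re w < -1}"])
      show "open {w. Re w < -1}" by (rule open_halfspace_Re_lt)
    qed (use 3 in \<open>auto simp: ray_ext_def ray_proj_left\<close>)
    then show ?thesis using 3 by (simp add: coef_dz_def coef_dzbar_def)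
  qed
qed

section \<open>The quasiconformal extension\<close>

lemma AE_off_interfaces: "AE w::complex in lebesgue. cmod w \<noteq> 1 \<and> Re w \<noteq> -1"
proof -
  have "negligible (sphere (0::complex) 1)" by (rule negligible_sphere)
  moreover have "negligible {w::complex. 1 \<bullet> w = -1}" by (rule negligible_hyperplane) simp
  ultimately have "sphere (0::complex) 1 \<union> {w. 1 \<bullet> w = -1} \<in> null_sets lebesgue"
    by (simp add: negligible_iff_null_sets[symmetric])
  then show ?thesis
  proof (rule AE_I')
    show "{w \<in> space lebesgue. \<not> (cmod w \<noteq> 1 \<and> Re w \<noteq> -1)} \<subseteq> sphere (0::complex) 1 \<union> {w. 1 \<bullet> w = -1}"
      by (auto simp: inner_complex_def)
  qed
qed

text \<open>The given inequality says \<open>|1 - d| < |1 + z d|\<close> for \<open>d = \<psi>'(z)\<close>; expanding the squares gives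
  \<open>(1 - |z|\<^sup>2) |d|\<^sup>2 < 2 Re ((1 + z) d)\<close>.\<close>

lemma Re_pos_from_bound:
  assumes "cmod (1 - d) < cmod (1 + z * d)" "cmod z < 1"
  shows "Re ((1 + z) * d) > 0"
proof -
  have "(cmod (1 - d))\<^sup>2 < (cmod (1 + z * d))\<^sup>2" using assms(1) by (intro power_strict_mono) auto
  moreover have "(cmod (1 - d))\<^sup>2 = 1 - 2 * Re d + (cmod d)\<^sup>2"
    unfolding cmod_power2 by (simp add: power2_eq_square algebra_simps)
  moreover have "(cmod (1 + z * d))\<^sup>2 = 1 + 2 * Re (z * d) + (cmod (z * d))\<^sup>2"
    unfolding cmod_power2[of "1 + z * d"] cmod_power2[of "z * d"] by (simp add: power2_eq_square algebra_simps)
  moreover have "cmod (z * d) \<le> 1 * cmod d" unfolding norm_mult using assms(2) by (intro mult_right_mono) auto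
  then have "(cmod (z * d))\<^sup>2 \<le> (cmod d)\<^sup>2" by (intro power_mono) auto
  moreover have "Re ((1 + z) * d) = Re d + Re (z * d)" by (simp add: algebra_simps)
  ultimately show ?thesis by linarith
qed

text \<open>The maps \<open>v n\<close> belong to the dilated data \<open>z \<mapsto> Q (r n * z)\<close>. Along the chosen radii these data converge
  at the projection of almost every point, which is where \<open>coef_dz\<close> and \<open>coef_dzbar\<close> evaluate them.\<close>

lemma extension_is_quasiconformal:
  fixes u :: "complex \<Rightarrow> complex"
  assumes hol: "Q holomorphic_on ball 0 1" and Q: "\<And>z. cmod z < 1 \<Longrightarrow> cmod (Q z) \<le> k" and k: "k < 1"
    and der: "\<And>z. cmod z < 1 \<Longrightarrow> (u has_field_derivative slope z (Q z)) (at z)"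
    and modulus: "\<And>a b. cmod a \<le> 1 \<Longrightarrow> cmod b \<le> 1 \<Longrightarrow>
      cmod (u a - u b) \<le> k / (1 - k) * cmod (a - b) * max (cmod (1 + a)) (cmod (1 + b))"
    and bij: "bij (ray_ext u)"
  shows "quasiconformal_sphere k (map_option (ray_ext u))"
proof -
  define C where "C = k / (1 - k)"
  have k0: "0 \<le> k" using order_trans[OF norm_ge_zero Q[of 0]] by simp
  have C: "C \<ge> 0" using k0 k by (simp add: C_def)
  have lip: "cmod (v a - v b) \<le> 2 * C * cmod (a - b)"
    if v: "\<And>a b. cmod a \<le> 1 \<Longrightarrow> cmod b \<le> 1 \<Longrightarrow>
      cmod (v a - v b) \<le> C * cmod (a - b) * max (cmod (1 + a)) (cmod (1 + b))"
      and ab: "cmod a \<le> 1" "cmod b \<le> 1" for v :: "complex \<Rightarrow> complex" and a b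
    using ray_proj_lipschitz[OF C v, of a b] ab by simp
  obtain r where r: "\<And>n. 0 < r n \<and> r n < 1" "r \<longlonglongrightarrow> 1"
    and circ: "AE t in circle_measure. convergent (\<lambda>n. Q (of_real (r n) * cis t))"
    by (rule radial_limit_ae_circle[OF hol, of k]) (use Q in auto)
  have "\<exists>v. v 0 = u 0 \<and> (\<forall>z. cmod z \<le> 1 \<longrightarrow> (v has_field_derivative slope z (Q (of_real (r n) * z))) (at z))" for n
  proof -
    have "0 < r n" "r n < 1" using r(1) by auto
    from dilated_primitive[OF hol Q k this, of "u 0"] show ?thesis by metis
  qed
  then obtain v where v0: "\<And>n. v n 0 = u 0"
    and v: "\<And>n z. cmod z \<le> 1 \<Longrightarrow> (v n has_field_derivative slope z (Q (of_real (r n) * z))) (at z)"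
    by metis
  have small: "cmod (of_real (r n) * z) < 1" if "cmod z \<le> 1" for n z
  proof -
    have "r n * cmod z \<le> r n * 1" using that r(1)[of n] by (intro mult_left_mono) auto
    then have "r n * cmod z < 1" using r(1)[of n] by linarith
    then show ?thesis using r(1)[of n] by (simp add: norm_mult)
  qed
  have Qr: "cmod (Q (of_real (r n) * z)) \<le> k" if "cmod z \<le> 1" for n z
    by (rule Q[OF small[OF that]])
  have modv: "cmod (v n a - v n b) \<le> C * cmod (a - b) * max (cmod (1 + a)) (cmod (1 + b))"
    if "cmod a \<le> 1" "cmod b \<le> 1" for n a b
    unfolding C_def
    by (rule modulus_from_slope[of "cball 0 1" k "v n" "\<lambda>z. Q (of_real (r n) * z)"])
      (use k v Qr that in auto)
  have modu: "cmod (u a - u b) \<le> C * cmod (a - b) * max (cmod (1 + a)) (cmod (1 + b))"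
    if "cmod a \<le> 1" "cmod b \<le> 1" for a b
    unfolding C_def by (rule modulus[OF that])
  define Qlim where "Qlim = (\<lambda>w. if cmod w < 1 then Q w
      else lim (\<lambda>n. Q (of_real (r n) * ((w + 1) / cnj (w + 1)))))"
  have "AE z in lebesgue. convergent (\<lambda>n. Q (of_real (r n) * (z / cnj z)))"
    by (rule AE_double_angle[OF circ])
  from AE_shift[OF this, of 1]
  have Qconv: "AE w in lebesgue. cmod w \<noteq> 1 \<and> Re w \<noteq> -1 \<and> cmod (Qlim w) \<le> k \<and>
      (cmod w < 1 \<or> Re w > -1 \<longrightarrow> (\<lambda>n. Q (of_real (r n) * ray_proj w)) \<longlonglongrightarrow> Qlim w)"
    using AE_off_interfaces
  proof eventually_elim
    case (elim w)
    show ?case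
    proof (cases "cmod w < 1")
      case True
      have "isCont Q w"
        using holomorphic_on_imp_continuous_on[OF hol] True by (simp add: continuous_on_eq_continuous_at)
      moreover have "(\<lambda>n. of_real (r n) * w) \<longlonglongrightarrow> w"
        using tendsto_mult[OF tendsto_of_real[OF r(2)] tendsto_const[of w]] by simp
      ultimately have "(\<lambda>n. Q (of_real (r n) * w)) \<longlonglongrightarrow> Q w" by (rule isCont_tendsto_compose)
      then show ?thesis using True Q[OF True] elim(2) by (simp add: Qlim_def)
    next
      case False
      let ?z = "(w + 1) / cnj (w + 1)"
      have lim: "(\<lambda>n. Q (of_real (r n) * ?z)) \<longlonglongrightarrow> Qlim w"
        using elim(1) False unfolding Qlim_def by (simp add: convergent_LIMSEQ_iff)
      have "cmod (Qlim w) \<le> k"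
        by (rule Lim_norm_ubound[OF _ lim])
          (rule trivial_limit_sequentially, intro always_eventually allI Qr[OF norm_unit_direction])
      moreover have "ray_proj w = ?z" if "Re w > -1" using that False elim(2) by (simp add: ray_proj_def)
      ultimately show ?thesis using lim False elim(2) by auto
    qed
  qed
  interpret plane_qc_approximation "ray_ext u" "\<lambda>n. ray_ext (v n)"
    "\<lambda>n w. coef_dz w (Q (of_real (r n) * ray_proj w))" "\<lambda>n w. coef_dzbar w (Q (of_real (r n) * ray_proj w))"
    "\<lambda>w. coef_dz w (Qlim w)" "\<lambda>w. coef_dzbar w (Qlim w)" "1 + 2 * C" "cmod (u 0) + 2 * C" k "u (-1)"
  proof
    fix n x y
    have "(1 + 2 * C)-lipschitz_on UNIV (ray_ext (v n))"
      by (rule ray_ext_lipschitz[OF C]) (rule modv)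
    from lipschitz_onD[OF this, of x y]
    show "cmod (ray_ext (v n) x - ray_ext (v n) y) \<le> (1 + 2 * C) * cmod (x - y)" by (simp add: dist_norm)
  next
    fix e :: real assume e: "e > 0"
    have "\<forall>\<^sub>F n in sequentially. \<forall>z. cmod z \<le> 1 \<longrightarrow> cmod (v n z - u z) \<le> e"
    proof (rule uniform_limit_of_primitives[where Q = Q and k = k and r = r and L = "2 * C"])
      show "\<And>a b. cmod a \<le> 1 \<Longrightarrow> cmod b \<le> 1 \<Longrightarrow> cmod (u a - u b) \<le> 2 * C * cmod (a - b)"
        by (rule lip[OF modu])
      show "\<And>n a b. cmod a \<le> 1 \<Longrightarrow> cmod b \<le> 1 \<Longrightarrow> cmod (v n a - v n b) \<le> 2 * C * cmod (a - b)"
        by (rule lip[OF modv])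
    qed (fact hol Q k r der v v0 e)+
    then show "\<forall>\<^sub>F n in sequentially. \<forall>z. cmod (ray_ext (v n) z - ray_ext u z) \<le> e"
      by eventually_elim (simp add: ray_ext_def norm_ray_proj_le)
  next
    fix z
    have "cmod (u (ray_proj z) - u 0) \<le> 2 * C * cmod (ray_proj z - 0)"
      by (rule lip[OF modu norm_ray_proj_le]) auto
    also have "\<dots> \<le> 2 * C * 1" using norm_ray_proj_le C by (intro mult_left_mono) auto
    finally show "cmod (ray_ext u z - z) \<le> cmod (u 0) + 2 * C"
      unfolding ray_ext_diff using norm_triangle_sub[of "u (ray_proj z)" "u 0"] by simp
  next
    fix n
    show "AE w in lebesgue. has_wirtinger (ray_ext (v n)) (coef_dz w (Q (of_real (r n) * ray_proj w)))
        (coef_dzbar w (Q (of_real (r n) * ray_proj w))) w"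
      using AE_off_interfaces
    proof eventually_elim
      case (elim w)
      show ?case by (rule has_wirtinger_ray_ext[where Q = "\<lambda>z. Q (of_real (r n) * z)"]) (use v elim in auto)
    qed
  next
    show "AE w in lebesgue. (\<lambda>n. coef_dz w (Q (of_real (r n) * ray_proj w))) \<longlonglongrightarrow> coef_dz w (Qlim w) \<and>
        (\<lambda>n. coef_dzbar w (Q (of_real (r n) * ray_proj w))) \<longlonglongrightarrow> coef_dzbar w (Qlim w)"
      using Qconv
    proof eventually_elim
      case (elim w)
      show ?case
      proof (cases "cmod w < 1 \<or> Re w > -1")
        case True
        then show ?thesis using elim coef_continuous[of _ "Qlim w" k w] k by blast
      next
        case False
        then have "coef_dz w = (\<lambda>_. 1)" "coef_dzbar w = (\<lambda>_. 0)"
          by (auto simp: coef_dz_def coef_dzbar_def fun_eq_iff)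
        then show ?thesis by simp
      qed
    qed
  next
    show "AE w in lebesgue. cmod (coef_dzbar w (Qlim w)) \<le> k * cmod (coef_dz w (Qlim w))"
      using Qconv by eventually_elim (intro Beltrami_bound k; simp)
  next
    show "bij (ray_ext u)" by (rule bij)
  next
    fix w assume "Re w < -1"
    then show "ray_ext u w = w + u (-1)" by (simp add: ray_ext_def ray_proj_left)
  qed
  show ?thesis by (rule quasiconformal)
qed

theorem corollary5p17:
  fixes \<psi> :: "complex \<Rightarrow> complex" and k :: real
  assumes "\<psi> holomorphic_on ball 0 1"
    and "0 \<le> k" and "k < 1"
    and "\<And>\<zeta>. \<zeta> \<in> ball 0 1 \<Longrightarrow> 1 + \<zeta> * deriv \<psi> \<zeta> \<noteq> 0"
    and "\<And>\<zeta>. \<zeta> \<in> ball 0 1 \<Longrightarrow> norm ((1 - deriv \<psi> \<zeta>) / (1 + \<zeta> * deriv \<psi> \<zeta>)) \<le> k"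
  shows "admits_qc_extension k \<psi>"
proof -
  define Q where "Q = (\<lambda>z. (1 - deriv \<psi> z) / (1 + z * deriv \<psi> z))"
  have Q: "cmod (Q z) \<le> k" if "cmod z < 1" for z using assms(5)[of z] that by (simp add: Q_def)
  have hol: "Q holomorphic_on ball 0 1"
    unfolding Q_def by (intro holomorphic_intros holomorphic_deriv assms(1)) (use assms(4) in auto)
  have d\<psi>: "(\<psi> has_field_derivative deriv \<psi> z) (at z)" if "cmod z < 1" for z
    by (rule holomorphic_derivI[OF assms(1) open_ball]) (use that in simp)
  have slope: "slope z (Q z) = deriv \<psi> z - 1" if z: "cmod z < 1" for z
  proof -
    define d where "d = deriv \<psi> z"
    have ne: "1 + z * d \<noteq> 0" using assms(4)[of z] z by (simp add: d_def)
    have nz: "1 + z \<noteq> 0" using z by (metis add_eq_0_iff less_irrefl norm_minus_cancel norm_one)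
    have eq: "1 + z * Q z = (1 + z) / (1 + z * d)"
      unfolding Q_def d_def[symmetric] using ne by (simp add: field_simps)
    have "slope z (Q z) = - (Q z * (1 + z * d))" unfolding slope_def eq using ne nz by simp
    also have "Q z * (1 + z * d) = 1 - d" using ne by (simp add: Q_def d_def)
    finally show ?thesis by (simp add: d_def)
  qed
  define u0 where "u0 = (\<lambda>z. \<psi> z - z)"
  have du0: "(u0 has_field_derivative slope z (Q z)) (at z)" if "cmod z < 1" for z
    unfolding slope[OF that] u0_def by (intro DERIV_diff d\<psi> that DERIV_ident)
  have mod0: "cmod (u0 a - u0 b) \<le> k / (1 - k) * cmod (a - b) * max (cmod (1 + a)) (cmod (1 + b))"
    if "cmod a < 1" "cmod b < 1" for a b
    by (rule modulus_from_slope[of "ball 0 1" k u0 Q]) (use assms(3) du0 Q that in auto)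
  have Cge: "k / (1 - k) \<ge> 0" using assms(2,3) by simp
  obtain u where u: "\<And>z. cmod z < 1 \<Longrightarrow> u z = u0 z" "continuous_on (cball 0 1) u"
    and modu: "\<And>a b. cmod a \<le> 1 \<Longrightarrow> cmod b \<le> 1 \<Longrightarrow>
      cmod (u a - u b) \<le> k / (1 - k) * cmod (a - b) * max (cmod (1 + a)) (cmod (1 + b))"
    by (rule boundary_extension[where C = "k / (1 - k)" and u = u0], rule Cge, rule mod0, assumption+, rule that)
  have du: "(u has_field_derivative slope z (Q z)) (at z)" if "cmod z < 1" for z
    by (rule has_field_derivative_transform_within_open[OF du0[OF that] open_ball[of 0 1]])
      (use that u(1) in auto)
  have \<psi>u: "z + u z = \<psi> z" if "cmod z < 1" for z using u(1)[OF that] by (simp add: u0_def)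
  have dpsi: "((\<lambda>z. z + u z) has_field_derivative deriv \<psi> z) (at z)" if "cmod z < 1" for z
    by (rule has_field_derivative_transform_within_open[OF d\<psi>[OF that] open_ball[of 0 1]])
      (use that \<psi>u in auto)
  have "inj (ray_ext u)"
  proof (rule inj_ray_ext)
    show "continuous_on (cball 0 1) (\<lambda>z. z + u z)" by (intro continuous_intros u(2))
    show "(\<lambda>z. z + u z) holomorphic_on ball 0 1"
      unfolding holomorphic_on_open[OF open_ball] by (intro ballI exI, rule dpsi) simp
    fix z :: complex assume "z \<in> ball 0 1"
    then have z: "cmod z < 1" by simp
    have ne: "1 + z * deriv \<psi> z \<noteq> 0" using assms(4) z by simp
    have "cmod (1 - deriv \<psi> z) / cmod (1 + z * deriv \<psi> z) < 1"
      using assms(5)[of z] assms(3) z by (simp add: norm_divide)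
    then have "cmod (1 - deriv \<psi> z) < cmod (1 + z * deriv \<psi> z)" using ne by (simp add: divide_less_eq)
    then have "Re ((1 + z) * deriv \<psi> z) > 0" using z by (rule Re_pos_from_bound)
    then show "Re ((1 + z) * deriv (\<lambda>z. z + u z) z) > 0"
      unfolding DERIV_imp_deriv[OF dpsi[OF z]] .
  qed
  moreover have "surj (ray_ext u)"
  proof -
    have cont: "continuous_on UNIV (ray_ext u)"
      by (rule lipschitz_on_continuous_on, rule ray_ext_lipschitz[OF Cge], rule modu)
    have "bounded (u ` cball 0 1)"
      by (intro compact_imp_bounded compact_continuous_image u(2) compact_cball)
    then obtain B where "\<forall>y\<in>u ` cball 0 1. cmod y \<le> B" unfolding bounded_iff by blast
    then have "cmod (ray_ext u z - z) \<le> B" for z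
      unfolding ray_ext_diff using norm_ray_proj_le[of z] by simp
    then show ?thesis by (rule surj_bounded_perturbation[OF cont])
  qed
  ultimately have bij: "bij (ray_ext u)" by (rule bijI)
  have "quasiconformal_sphere k (map_option (ray_ext u))"
    by (rule extension_is_quasiconformal[where Q = Q]) (fact hol Q assms(3) du modu bij)+
  moreover have "map_option (ray_ext u) (Some z) = Some (\<psi> z)" if "z \<in> ball 0 1" for z
    using that \<psi>u by (simp add: ray_ext_def)
  ultimately show ?thesis unfolding admits_qc_extension_def by blast
qed

end
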